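(* Let $n,k,d$ be positive integers, let $\xi\in\mathbb{C}$ be a primitive $k$-th root of unity, and let $S=\mathbb{C}[x_0,\ldots,x_n]$. Let $I_k^{(d)}\subset S$ be the ideal of the scheme of fat points of multiplicity $d$ supported on the $k^n$ points $[1:\xi^{g_1}:\cdots:\xi^{g_n}]\in\mathbb{P}^n$, $0\le g_j\le k-1$ for $j=1,\ldots,n$. Then the graded Betti numbers of the quotient $S/I_k^{(d)}$ are given by $$\beta_{i,\,kd+k(i-1)}=\binom{d+i-2}{i-1}\binom{d+n-1}{n-i},\qquad i=1,\ldots,n$$ (all other graded Betti numbers in homological degree $i\ge 1$ being zero). Moreover, the ideal $I_k^{(d)}$ is generated by the forms of degree $kd$ $$\mathcal{G}_{i_1,\ldots,i_n}:=\prod_{j=1}^n (x_j^k-x_0^k)^{i_j}$$ for all $(i_1,\ldots,i_n)\in\mathbb{N}^n$ with $i_1+\cdots+i_n=d$.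
   Context: $\mathbb{N}$ includes $0$. For a point $P\in\mathbb{P}^n$ let $\wp_P\subset S$ be the homogeneous prime ideal generated by all forms vanishing at $P$. The ideal of the scheme of fat points of multiplicity $d$ supported on points $P_1,\ldots,P_g$ is $\wp_{P_1}^d\cap\cdots\cap\wp_{P_g}^d$. Graded Betti numbers are $\beta_{i,j}(S/I)=\dim_{\mathbb{C}}\mathrm{Tor}_i^S(S/I,\mathbb{C})_j$. *)

theory Defs
  imports "HOL-Library.Poly_Mapping" "HOL-Library.FuncSet" "HOL-Algebra.Ideal_Product"
    "Jordan_Normal_Form.Matrix_Kernel"
begin

section \<open>The polynomial ring \<open>\<complex>[x\<^sub>0,\<dots>,x\<^sub>n]\<close>\<close>

text \<open>A polynomial is a finitely supported map from exponent vectors to coefficients; the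
  variables \<open>x\<^sub>0, x\<^sub>1, \<dots>\<close> are indexed by \<^typ>\<open>nat\<close>.\<close>

type_synonym mpoly = "(nat \<Rightarrow>\<^sub>0 nat) \<Rightarrow>\<^sub>0 complex"

definition Var :: "nat \<Rightarrow> mpoly" where
  "Var i = Poly_Mapping.single (Poly_Mapping.single i 1) 1"

definition poly_ring :: "nat \<Rightarrow> mpoly ring" where
  "poly_ring n = class_ring\<lparr>carrier :=
     {p. \<forall>m\<in>Poly_Mapping.keys p. Poly_Mapping.keys m \<subseteq> {0..n}}\<rparr>"

definition eval_mpoly :: "(nat \<Rightarrow> complex) \<Rightarrow> mpoly \<Rightarrow> complex" where
  "eval_mpoly a p = (\<Sum>m\<in>Poly_Mapping.keys p. Poly_Mapping.lookup p m *
     (\<Prod>i\<in>Poly_Mapping.keys m. a i ^ Poly_Mapping.lookup m i))"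

definition total_degree :: "(nat \<Rightarrow>\<^sub>0 nat) \<Rightarrow> nat" where
  "total_degree m = (\<Sum>i\<in>Poly_Mapping.keys m. Poly_Mapping.lookup m i)"

text \<open>The degree is an integer, so that it can be compared with the twists of a graded free
  module. The zero polynomial is homogeneous of every degree, and the only homogeneous
  polynomial of negative degree.\<close>

definition homogeneous :: "int \<Rightarrow> mpoly \<Rightarrow> bool" where
  "homogeneous e p \<longleftrightarrow> (\<forall>m\<in>Poly_Mapping.keys p. int (total_degree m) = e)"


section \<open>Ideals of fat points\<close>

text \<open>A point of \<open>\<PP>\<^sup>n\<close> is given by homogeneous coordinates \<open>[a 0 : \<dots> : a n]\<close>; only
  the values of \<open>a\<close> on \<open>{0..n}\<close> matter, and forms vanish independently of their scaling.\<close>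

definition point_ideal :: "nat \<Rightarrow> (nat \<Rightarrow> complex) \<Rightarrow> mpoly set" where
  "point_ideal n a = Idl\<^bsub>poly_ring n\<^esub>
     {f \<in> carrier (poly_ring n). (\<exists>e. homogeneous e f) \<and> eval_mpoly a f = 0}"

text \<open>The power is taken in the monoid of ideals under the ideal product.\<close>

definition fat_points_ideal :: "nat \<Rightarrow> nat \<Rightarrow> (nat \<Rightarrow> complex) set \<Rightarrow> mpoly set" where
  "fat_points_ideal n d pts = carrier (poly_ring n) \<inter>
     (\<Inter>a\<in>pts. point_ideal n a [^]\<^bsub>ideals_set (poly_ring n)\<^esub> d)"

definition primitive_root_of_unity :: "nat \<Rightarrow> complex \<Rightarrow> bool" where
  "primitive_root_of_unity k \<xi> \<longleftrightarrow> 0 < k \<and> \<xi> ^ k = 1 \<and> (\<forall>m. 0 < m \<and> m < k \<longrightarrow> \<xi> ^ m \<noteq> 1)"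

text \<open>The points \<open>[1 : \<xi>^g\<^sub>1 : \<dots> : \<xi>^g\<^sub>n]\<close> with \<open>0 \<le> g\<^sub>j \<le> k - 1\<close>.\<close>

definition root_points :: "nat \<Rightarrow> nat \<Rightarrow> complex \<Rightarrow> (nat \<Rightarrow> complex) set" where
  "root_points n k \<xi> =
     (\<lambda>g i. if i = 0 then 1 else \<xi> ^ g i) ` ({1..n} \<rightarrow>\<^sub>E {0..k - 1})"


section \<open>Graded free resolutions, Tor and graded Betti numbers\<close>

text \<open>
  Write \<open>S = \<complex>[x\<^sub>0,\<dots>,x\<^sub>n]\<close>. An element of type \<open>free_cplx\<close> describes an augmented sequence
  of finitely generated graded free modules
    \<open>\<dots> \<rightarrow> F\<^sub>2 \<rightarrow> F\<^sub>1 \<rightarrow> F\<^sub>0 \<rightarrow> S/I\<close>.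
  The module \<open>F\<^sub>i\<close> is the direct sum of \<open>S(- fdeg i c)\<close> over \<open>c < frank i\<close>, the matrix of the map
  from \<open>F\<^sub>i\<^sub>+\<^sub>1\<close> to \<open>F\<^sub>i\<close> is \<open>fdiff i\<close>, and the \<open>c\<close>-th basis vector of \<open>F\<^sub>0\<close> is sent to the class of
  \<open>faug $ c\<close> in \<open>S/I\<close>.\<close>

record free_cplx =
  frank :: "nat \<Rightarrow> nat"
  fdeg :: "nat \<Rightarrow> nat \<Rightarrow> int"
  fdiff :: "nat \<Rightarrow> mpoly mat"
  faug :: "mpoly vec"

definition free_mod :: "nat \<Rightarrow> nat \<Rightarrow> mpoly vec set" where
  "free_mod n r = {v \<in> carrier_vec r. \<forall>c<r. v $ c \<in> carrier (poly_ring n)}"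

definition graded_free_resolution :: "nat \<Rightarrow> mpoly set \<Rightarrow> free_cplx \<Rightarrow> bool" where
  "graded_free_resolution n I F \<longleftrightarrow>
     \<comment> \<open>all maps are defined over \<open>S\<close> and homogeneous of degree 0\<close>
     faug F \<in> free_mod n (frank F 0) \<and>
     (\<forall>c<frank F 0. homogeneous (fdeg F 0 c) (faug F $ c)) \<and>
     (\<forall>i. fdiff F i \<in> carrier_mat (frank F i) (frank F (Suc i)) \<and>
        (\<forall>a<frank F i. \<forall>c<frank F (Suc i).
           fdiff F i $$ (a, c) \<in> carrier (poly_ring n) \<and>
           homogeneous (fdeg F (Suc i) c - fdeg F i a) (fdiff F i $$ (a, c)))) \<and>
     \<comment> \<open>exactness at \<open>S/I\<close>, at \<open>F\<^sub>0\<close> and at \<open>F\<^sub>i\<^sub>+\<^sub>1\<close>\<close>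
     (\<forall>p\<in>carrier (poly_ring n). \<exists>v\<in>free_mod n (frank F 0). p - faug F \<bullet> v \<in> I) \<and>
     {v \<in> free_mod n (frank F 0). faug F \<bullet> v \<in> I} =
       (\<lambda>w. fdiff F 0 *\<^sub>v w) ` free_mod n (frank F 1) \<and>
     (\<forall>i. free_mod n (frank F (Suc i)) \<inter> mat_kernel (fdiff F i) =
       (\<lambda>w. fdiff F (Suc i) *\<^sub>v w) ` free_mod n (frank F (Suc (Suc i))))"

text \<open>
  Here \<open>\<complex> = S/(x\<^sub>0,\<dots>,x\<^sub>n)\<close>, so \<open>F\<^sub>i \<otimes> \<complex>\<close> is the graded vector space with one basis vector in
  degree \<open>fdeg i c\<close> for each \<open>c < frank i\<close>, and the matrix of \<open>fdiff i \<otimes> \<complex>\<close> is obtained by taking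
  the constant terms of the entries of \<open>fdiff i\<close>.\<close>

definition tensor_diff :: "free_cplx \<Rightarrow> nat \<Rightarrow> complex mat" where
  "tensor_diff F i = map_mat (\<lambda>p. Poly_Mapping.lookup p 0) (fdiff F i)"

definition tensor_strand :: "free_cplx \<Rightarrow> nat \<Rightarrow> int \<Rightarrow> complex vec set" where
  "tensor_strand F i j =
     {v \<in> carrier_vec (frank F i). \<forall>c<frank F i. fdeg F i c \<noteq> j \<longrightarrow> v $ c = 0}"

definition tensor_cycles :: "free_cplx \<Rightarrow> nat \<Rightarrow> int \<Rightarrow> complex vec set" where
  "tensor_cycles F i j = (case i of
       0 \<Rightarrow> tensor_strand F 0 j
     | Suc i' \<Rightarrow> tensor_strand F i j \<inter> mat_kernel (tensor_diff F i'))"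

definition tensor_boundaries :: "free_cplx \<Rightarrow> nat \<Rightarrow> int \<Rightarrow> complex vec set" where
  "tensor_boundaries F i j = (\<lambda>w. tensor_diff F i *\<^sub>v w) ` tensor_strand F (Suc i) j"

definition subspace_dim :: "nat \<Rightarrow> complex vec set \<Rightarrow> nat" where
  "subspace_dim r W = vectorspace.dim class_ring (module_vec TYPE(complex) r\<lparr>carrier := W\<rparr>)"

text \<open>For a resolution \<open>F\<close> the boundaries form a subspace of the finite-dimensional space of
  cycles, so the difference is the dimension of the degree-\<open>j\<close> part of \<open>H\<^sub>i(F \<otimes> \<complex>)\<close>.\<close>

definition tensor_homology_dim :: "free_cplx \<Rightarrow> nat \<Rightarrow> int \<Rightarrow> nat" where
  "tensor_homology_dim F i j =
     subspace_dim (frank F i) (tensor_cycles F i j) -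
     subspace_dim (frank F i) (tensor_boundaries F i j)"

text \<open>\<open>\<beta>\<^sub>i\<^sub>,\<^sub>j(S/I)\<close> is the dimension of the degree-\<open>j\<close> part of \<open>Tor\<^sub>i\<^sup>S(S/I, \<complex>)\<close>. As usual, Tor is
  computed from an arbitrarily chosen graded free resolution of \<open>S/I\<close>: for a homogeneous ideal
  one with finitely generated terms exists, and the result does not depend on the choice.\<close>

definition graded_betti :: "nat \<Rightarrow> mpoly set \<Rightarrow> nat \<Rightarrow> int \<Rightarrow> nat" where
  "graded_betti n I i j =
     tensor_homology_dim (SOME F. graded_free_resolution n I F) i j"

end

theory Submission
  imports Defs
begin

text \<open>Write \<open>f\<^sub>j = x\<^sub>j\<^sup>k - x\<^sub>0\<^sup>k\<close>; the points are the common zeros of the regular sequence \<open>f\<^sub>1, \<dots>, f\<^sub>n\<close>.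
  Division by \<open>f\<^sub>m\<close> shows, by induction on \<open>m\<close> and \<open>d\<close>, that \<open>(f\<^sub>1, \<dots>, f\<^sub>m)\<^sup>d\<close> consists of the polynomials
  vanishing to order \<open>d\<close> along every line through a zero of \<open>f\<^sub>1, \<dots>, f\<^sub>m\<close> with \<open>x\<^sub>0 \<noteq> 0\<close>. Hence the ideal of
  the fat points is \<open>(f\<^sub>1, \<dots>, f\<^sub>n)\<^sup>d\<close>, and \<open>f\<^sub>m\<^sub>+\<^sub>1\<close> is a nonzerodivisor modulo \<open>(f\<^sub>1, \<dots>, f\<^sub>m)\<^sup>d\<close>.

  With \<open>J(m,d) = (f\<^sub>1, \<dots>, f\<^sub>m)\<^sup>d\<close> one has \<open>J(m+1,d+1) = J(m,d+1) + f\<^sub>m\<^sub>+\<^sub>1 J(m+1,d)\<close>, and the two summands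
  intersect in \<open>f\<^sub>m\<^sub>+\<^sub>1 J(m,d+1)\<close>. The horseshoe lemma applied to the syzygies therefore yields a resolution
  in which all maps after the first have entries of degree \<open>k\<close>; it is minimal, and its ranks satisfy a
  Pascal recursion. Comparing an arbitrary graded free resolution with a minimal one gives the
  Betti numbers.\<close>

section \<open>Polynomials in a set of variables\<close>

text \<open>Order of vanishing is measured along lines x + t y, as divisibility by a power of t in
  one-variable polynomials. Restriction to a line is a ring homomorphism, so sums, products and
  division with remainder can be followed without derivatives in several variables or localisation.
  For m < n the zero set of \<open>f_1, ..., f_m\<close> is a union of linear spaces of positive
  dimension, so x must run over all its points and y over all directions. Points with
  \<open>x_0 = 0\<close> are left out: there \<open>x_1, ..., x_m\<close> vanish too, each
  \<open>f_j\<close> has a zero of order at least k, and a factor \<open>f_j\<close> could not be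
  cancelled at the cost of one order. What is lost at exceptional parameters is recovered by
  continuity of the coefficients.

  Minimality is a matter of degrees. A horseshoe construction may produce unit entries in general;
  here all generators in one homological degree have the same degree, and it rises by k at each
  later step, so no constant can occur. The definition of \<open>graded_betti\<close> chooses an
  unspecified resolution, and the comparison of complexes is what makes the minimal one
  decisive.\<close>

definition polys :: "nat set \<Rightarrow> mpoly set" where
  "polys W = {p. \<forall>m\<in>Poly_Mapping.keys p. Poly_Mapping.keys m \<subseteq> W}"

lemma carrier_poly_ring: "carrier (poly_ring n) = polys {0..n}"
  by (simp add: poly_ring_def polys_def)

lemma poly_ring_simps [simp]:
  "mult (poly_ring n) = (*)" "add (poly_ring n) = (+)"
  "zero (poly_ring n) = 0" "one (poly_ring n) = 1"
  by (simp_all add: poly_ring_def)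

lemma keys_add_nat: "Poly_Mapping.keys (m + m') = Poly_Mapping.keys m \<union> Poly_Mapping.keys (m' :: 'a \<Rightarrow>\<^sub>0 nat)"
  by (auto simp: in_keys_iff lookup_add)

lemma polys_zero [simp]: "0 \<in> polys W"
  by (simp add: polys_def)

lemma polys_single: "Poly_Mapping.keys m \<subseteq> W \<Longrightarrow> Poly_Mapping.single m c \<in> polys W"
  by (simp add: polys_def)

lemma polys_one [simp]: "1 \<in> polys W"
  by (simp add: polys_def)

lemma polys_add [simp]: "p \<in> polys W \<Longrightarrow> q \<in> polys W \<Longrightarrow> p + q \<in> polys W"
  using keys_add[of p q] by (auto simp: polys_def)

lemma keys_uminus [simp]: "Poly_Mapping.keys (- p) = Poly_Mapping.keys (p :: 'a \<Rightarrow>\<^sub>0 'b::ab_group_add)"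
  by (auto simp: in_keys_iff)

lemma polys_uminus [simp]: "p \<in> polys W \<Longrightarrow> - p \<in> polys W"
  by (auto simp: polys_def)

lemma polys_diff [simp]: "p \<in> polys W \<Longrightarrow> q \<in> polys W \<Longrightarrow> p - q \<in> polys W"
  using polys_add[of p W "- q"] by auto

lemma polys_mult [simp]: "p \<in> polys W \<Longrightarrow> q \<in> polys W \<Longrightarrow> p * q \<in> polys W"
  using keys_mult[of p q] by (fastforce simp: polys_def keys_add_nat)

lemma polys_sum [simp]: "(\<And>i. i \<in> A \<Longrightarrow> p i \<in> polys W) \<Longrightarrow> sum p A \<in> polys W"
  by (induction A rule: infinite_finite_induct) auto

lemma polys_prod [simp]: "(\<And>i. i \<in> A \<Longrightarrow> p i \<in> polys W) \<Longrightarrow> prod p A \<in> polys W"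
  by (induction A rule: infinite_finite_induct) auto

lemma polys_power [simp]: "p \<in> polys W \<Longrightarrow> p ^ e \<in> polys W"
  by (induction e) auto

lemma polys_Var [simp]: "i \<in> W \<Longrightarrow> Var i \<in> polys W"
  by (simp add: Var_def polys_single)

lemma polys_mono: "p \<in> polys V \<Longrightarrow> V \<subseteq> W \<Longrightarrow> p \<in> polys W"
  by (auto simp: polys_def)

lemma poly_ring_ring: "cring (poly_ring n)"
  by (rule cringI, rule abelian_groupI)
    (auto simp: carrier_poly_ring algebra_simps intro!: comm_monoidI bexI[of _ "- _"])

lemma sum_monomials:
  "(\<Sum>m\<in>Poly_Mapping.keys p. Poly_Mapping.single m (Poly_Mapping.lookup p m)) =
    (p :: 'a \<Rightarrow>\<^sub>0 'b::comm_monoid_add)"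
  by (rule poly_mapping_eqI) (simp add: lookup_sum lookup_single when_def in_keys_iff)

lemma polys_induct [consumes 1, case_names zero single add]:
  assumes "p \<in> polys W" and "P 0"
    and "\<And>m c. Poly_Mapping.keys m \<subseteq> W \<Longrightarrow> P (Poly_Mapping.single m c)"
    and "\<And>p q. p \<in> polys W \<Longrightarrow> q \<in> polys W \<Longrightarrow> P p \<Longrightarrow> P q \<Longrightarrow> P (p + q)"
  shows "P p"
proof -
  have "sum (\<lambda>m. Poly_Mapping.single m (Poly_Mapping.lookup p m)) A \<in> polys W \<and>
      P (\<Sum>m\<in>A. Poly_Mapping.single m (Poly_Mapping.lookup p m))"
    if "A \<subseteq> Poly_Mapping.keys p" for A
    using finite_subset[OF that finite_keys] that
  proof (induction A rule: finite_induct)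
    case (insert m A)
    have "Poly_Mapping.keys m \<subseteq> W" using insert.prems assms(1) by (auto simp: polys_def)
    with insert show ?case by (auto intro!: assms(3,4) polys_add polys_single)
  qed (use assms in auto)
  from this[OF order_refl] show ?thesis by (simp add: sum_monomials)
qed

lemma polys_UNIV [simp]: "p \<in> polys UNIV"
  by (simp add: polys_def)

lemma single_eq_prod_Var:
  "Poly_Mapping.single m c =
    Poly_Mapping.single 0 c * (\<Prod>i\<in>Poly_Mapping.keys m. Var i ^ Poly_Mapping.lookup m i)"
proof -
  have pow: "Var i ^ e = Poly_Mapping.single (Poly_Mapping.single i e) 1" for i e
    by (induction e) (simp_all add: Var_def mult_single single_add [symmetric])
  have "(\<Prod>i\<in>A. Var i ^ Poly_Mapping.lookup m i) =
      Poly_Mapping.single (\<Sum>i\<in>A. Poly_Mapping.single i (Poly_Mapping.lookup m i)) 1"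
    if "finite A" for A
    using that by (induction A rule: finite_induct) (simp_all add: pow mult_single)
  from this[of "Poly_Mapping.keys m"] show ?thesis
    by (simp add: mult_single sum_monomials)
qed

lemma polys_induct_ring [consumes 1, case_names const Var add mult]:
  assumes "p \<in> polys W" and "\<And>c. P (Poly_Mapping.single 0 c)"
    and "\<And>i. i \<in> W \<Longrightarrow> P (Var i)"
    and "\<And>p q. p \<in> polys W \<Longrightarrow> q \<in> polys W \<Longrightarrow> P p \<Longrightarrow> P q \<Longrightarrow> P (p + q)"
    and "\<And>p q. p \<in> polys W \<Longrightarrow> q \<in> polys W \<Longrightarrow> P p \<Longrightarrow> P q \<Longrightarrow> P (p * q)"
  shows "P p"
  using assms(1)
proof (induction p rule: polys_induct)
  case zero
  show ?case using assms(2)[of 0] by simp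
next
  case (single m c)
  have one: "P 1" using assms(2)[of 1] by simp
  have pw: "P (Var i ^ e)" if "i \<in> W" for i e
    using that by (induction e) (auto intro!: assms(3,5) one)
  have "(\<Prod>i\<in>A. Var i ^ Poly_Mapping.lookup m i) \<in> polys W \<and>
      P (\<Prod>i\<in>A. Var i ^ Poly_Mapping.lookup m i)"
    if "finite A" "A \<subseteq> W" for A
    using that
    by (induction A rule: finite_induct) (auto intro!: assms(5) one pw polys_prod)
  with single have "P (\<Prod>i\<in>Poly_Mapping.keys m. Var i ^ Poly_Mapping.lookup m i)"
      "(\<Prod>i\<in>Poly_Mapping.keys m. Var i ^ Poly_Mapping.lookup m i) \<in> polys W"
    by auto
  then show ?case
    unfolding single_eq_prod_Var[of m c] by (intro assms(5) assms(2) polys_single) auto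
next
  case (add p q)
  then show ?case by (rule assms(4))
qed

text \<open>Regards the ring as one-variable polynomials in \<open>Var w\<close> over
  \<open>polys W\<close>; the coefficients stay free of \<open>w\<close>, so they are unaffected
  when the value of that coordinate is changed.\<close>

lemma polys_insert_decomp:
  assumes "p \<in> polys (insert w W)" and "w \<notin> W"
  shows "\<exists>N q. (\<forall>r. q r \<in> polys W) \<and> p = (\<Sum>r<N. q r * Var w ^ r)"
  using assms(1)
proof (induction p rule: polys_induct_ring)
  case (const c)
  show ?case
    by (intro exI[of _ 1] exI[of _ "\<lambda>r. Poly_Mapping.single 0 c"]) (auto intro: polys_single)
next
  case (Var i)
  show ?case
  proof (cases "i = w")
    case True
    then show ?thesis
      by (intro exI[of _ 2] exI[of _ "\<lambda>r. if r = 1 then 1 else 0"]) (auto simp: numeral_2_eq_2)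
  next
    case False
    then show ?thesis using Var
      by (intro exI[of _ 1] exI[of _ "\<lambda>r. Var i"]) auto
  qed
next
  case (add p q)
  then obtain M a N b where a: "\<forall>r. a r \<in> polys W" "p = (\<Sum>r<M. a r * Var w ^ r)"
    and b: "\<forall>r. b r \<in> polys W" "q = (\<Sum>r<N. b r * Var w ^ r)"
    by blast
  \<comment> \<open>Beyond \<open>M\<close> and \<open>N\<close> the families \<open>a\<close> and
    \<open>b\<close> are arbitrary, so they are cut off before being added.\<close>
  define c where "c r = (if r < M then a r else 0) + (if r < N then b r else 0)" for r
  have "p = (\<Sum>r<M + N. (if r < M then a r else 0) * Var w ^ r)"
    unfolding a by (rule sum.mono_neutral_cong_left) auto
  moreover have "q = (\<Sum>r<M + N. (if r < N then b r else 0) * Var w ^ r)"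
    unfolding b by (rule sum.mono_neutral_cong_left) auto
  ultimately have "p + q = (\<Sum>r<M + N. c r * Var w ^ r)"
    by (simp add: c_def sum.distrib distrib_right)
  moreover have "\<forall>r. c r \<in> polys W" using a(1) b(1) by (auto simp: c_def)
  ultimately show ?case by (intro exI[of _ "M + N"] exI[of _ c]) simp
next
  case (mult p q)
  then obtain M a N b where a: "\<forall>r. a r \<in> polys W" "p = (\<Sum>r<M. a r * Var w ^ r)"
    and b: "\<forall>r. b r \<in> polys W" "q = (\<Sum>r<N. b r * Var w ^ r)"
    by blast
  \<comment> \<open>The convolution runs over pairs of indices within the bounds, which keeps the
    arbitrary tails of \<open>a\<close> and \<open>b\<close> out of it.\<close>
  define c where "c r = (\<Sum>(i,j)\<in>{..<M}\<times>{..<N}. if i + j = r then a i * b j else 0)" for r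
  have "p * q = (\<Sum>(i,j)\<in>{..<M}\<times>{..<N}. a i * b j * Var w ^ (i + j))"
    unfolding a b by (simp add: sum_product sum.cartesian_product power_add mult_ac)
  also have "\<dots> = (\<Sum>(i,j)\<in>{..<M}\<times>{..<N}. \<Sum>r<M + N.
      (if i + j = r then a i * b j else 0) * Var w ^ r)"
  proof (rule sum.cong[OF refl], clarify)
    fix i j assume ij: "i < M" "j < N"
    have "(\<Sum>r<M + N. (if i + j = r then a i * b j else 0) * Var w ^ r) =
        (\<Sum>r<M + N. if i + j = r then a i * b j * Var w ^ r else 0)"
      by (rule sum.cong) auto
    also have "\<dots> = a i * b j * Var w ^ (i + j)" using ij by (simp add: sum.delta)
    finally show "a i * b j * Var w ^ (i + j) =
        (\<Sum>r<M + N. (if i + j = r then a i * b j else 0) * Var w ^ r)" by simp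
  qed
  also have "\<dots> = (\<Sum>r<M + N. c r * Var w ^ r)"
    unfolding c_def sum_distrib_right case_prod_unfold by (rule sum.swap)
  finally have "p * q = (\<Sum>r<M + N. c r * Var w ^ r)" .
  moreover have "\<forall>r. c r \<in> polys W"
    unfolding c_def using a(1) b(1) by (simp add: case_prod_unfold)
  ultimately show ?case by (intro exI[of _ "M + N"] exI[of _ c]) simp
qed


section \<open>Restriction of a polynomial to a line\<close>

text \<open>The monomial part of p(x + t y) as a polynomial in t. Keeping t formal, rather than
  evaluating, turns the order of vanishing at x in direction y into a divisibility
  statement.\<close>

definition line_mon :: "(nat \<Rightarrow> complex) \<Rightarrow> (nat \<Rightarrow> complex) \<Rightarrow> (nat \<Rightarrow>\<^sub>0 nat) \<Rightarrow> complex poly" where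
  "line_mon x y m = (\<Prod>i\<in>Poly_Mapping.keys m. [:x i, y i:] ^ Poly_Mapping.lookup m i)"

definition line :: "(nat \<Rightarrow> complex) \<Rightarrow> (nat \<Rightarrow> complex) \<Rightarrow> mpoly \<Rightarrow> complex poly" where
  "line x y p = (\<Sum>m\<in>Poly_Mapping.keys p. [:Poly_Mapping.lookup p m:] * line_mon x y m)"

lemma line_mon_superset:
  "finite A \<Longrightarrow> Poly_Mapping.keys m \<subseteq> A \<Longrightarrow>
    line_mon x y m = (\<Prod>i\<in>A. [:x i, y i:] ^ Poly_Mapping.lookup m i)"
  unfolding line_mon_def by (rule prod.mono_neutral_left) (auto simp: in_keys_iff)

lemma line_mon_add: "line_mon x y (m + m') = line_mon x y m * line_mon x y m'"
  by (simp add: line_mon_superset[of "Poly_Mapping.keys m \<union> Poly_Mapping.keys m'"] keys_add_nat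
      lookup_add power_add prod.distrib)

lemma line_superset:
  "finite A \<Longrightarrow> Poly_Mapping.keys p \<subseteq> A \<Longrightarrow>
    line x y p = (\<Sum>m\<in>A. [:Poly_Mapping.lookup p m:] * line_mon x y m)"
  unfolding line_def by (rule sum.mono_neutral_left) (auto simp: in_keys_iff)

lemma line_zero [simp]: "line x y 0 = 0"
  by (simp add: line_def)

lemma line_add [simp]: "line x y (p + q) = line x y p + line x y q"
proof -
  have "[:a + b:] * r = [:a:] * r + [:b:] * r" for a b and r :: "complex poly"
    by (simp add: smult_add_left)
  then show ?thesis
    using keys_add[of p q]
    by (simp add: line_superset[of "Poly_Mapping.keys p \<union> Poly_Mapping.keys q"] lookup_add
        sum.distrib del: mult_pCons_left)
qed

lemma line_single: "line x y (Poly_Mapping.single m c) = [:c:] * line_mon x y m"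
  by (simp add: line_def)

lemma line_const [simp]: "line x y (Poly_Mapping.single 0 c) = [:c:]"
  by (simp add: line_single line_mon_def)

lemma line_one [simp]: "line x y 1 = 1"
  using line_const[of x y 1] by (simp add: one_pCons)

lemma line_Var [simp]: "line x y (Var i) = [:x i, y i:]"
  by (simp add: Var_def line_single line_mon_def)

lemma line_mult [simp]: "line x y (p * q) = line x y p * line x y q"
proof -
  have "p \<in> polys UNIV" "q \<in> polys UNIV" by simp_all
  then show ?thesis
  proof (induction p rule: polys_induct)
    case (single m c)
    from single(2) show ?case
      by (induction q rule: polys_induct)
        (simp_all add: mult_single line_single line_mon_add distrib_left distrib_right smult_add_right mult_ac)
  qed (simp_all add: distrib_right)
qed

lemma line_uminus [simp]: "line x y (- p) = - line x y p"
proof -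
  have "line x y (- p) + line x y p = 0"
    unfolding line_add [symmetric] by simp
  then show ?thesis by (simp only: eq_neg_iff_add_eq_0)
qed

lemma line_diff [simp]: "line x y (p - q) = line x y p - line x y q"
  unfolding diff_conv_add_uminus line_add line_uminus ..

lemma line_power [simp]: "line x y (p ^ e) = line x y p ^ e"
  by (induction e) simp_all

lemma line_sum [simp]: "line x y (sum p A) = (\<Sum>i\<in>A. line x y (p i))"
  by (induction A rule: infinite_finite_induct) simp_all

lemma line_cong:
  assumes "p \<in> polys W" "\<And>i. i \<in> W \<Longrightarrow> x i = x' i" "\<And>i. i \<in> W \<Longrightarrow> y i = y' i"
  shows "line x y p = line x' y' p"
  using assms(1) by (induction p rule: polys_induct_ring) (simp_all add: assms)

lemma poly_line: "poly (line x y p) s = eval_mpoly (\<lambda>i. x i + s * y i) p"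
  by (simp add: line_def line_mon_def eval_mpoly_def poly_sum poly_prod mult.commute)

lemma eval_mpoly_eq_line: "eval_mpoly x p = poly (line x y p) 0"
  by (simp add: poly_line)

text \<open>Allows an identity for one coefficient, proved for all but finitely many values of a
  parameter in the base point or the direction, to be extended to the remaining values.\<close>

lemma continuous_coeff_line:
  assumes "\<And>i. continuous_on UNIV (\<lambda>s. X s i)" "\<And>i. continuous_on UNIV (\<lambda>s. Y s i)"
  shows "continuous_on UNIV (\<lambda>s::complex. coeff (line (X s) (Y s) p) e)"
proof -
  have "p \<in> polys UNIV" by simp
  then show ?thesis
  proof (induction p arbitrary: e rule: polys_induct_ring)
    case (Var i)
    have eq: "(\<lambda>s. coeff (line (X s) (Y s) (Var i)) e) =
        (if e = 0 then \<lambda>s. X s i else if e = 1 then \<lambda>s. Y s i else (\<lambda>s. 0))"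
      by (auto simp: coeff_pCons fun_eq_iff split: nat.splits)
    show ?case unfolding eq using assms by simp
  next
    case (const c)
    show ?case by simp
  next
    case (add p q)
    then show ?case by (simp add: continuous_on_add)
  next
    case (mult p q)
    then show ?case by (simp add: coeff_mult continuous_on_sum continuous_on_mult)
  qed
qed

lemma continuous_eq_0:
  fixes h :: "complex \<Rightarrow> complex"
  assumes "continuous_on UNIV h" "finite B" "\<And>s. s \<notin> B \<Longrightarrow> h s = 0"
  shows "h s = 0"
proof -
  \<comment> \<open>The point \<open>s\<close> itself may lie in \<open>B\<close>; only a punctured
    neighbourhood of it has to avoid \<open>B\<close>.\<close>
  have "open (- (B - {s}))"
    using assms(2) by (intro open_Compl finite_imp_closed) simp
  then have "eventually (\<lambda>t. h t = 0) (at s)"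
    unfolding eventually_at_topological using assms(3) by (intro exI[of _ "- (B - {s})"]) auto
  then have "(h \<longlongrightarrow> 0) (at s)" by (rule tendsto_eventually)
  moreover have "(h \<longlongrightarrow> h s) (at s)"
    using assms(1) by (simp add: continuous_on_def)
  ultimately show ?thesis by (intro tendsto_unique[of "at s" h]) auto
qed

text \<open>With the other coordinates fixed, a polynomial in \<open>Var w\<close> that vanishes for
  all values of \<open>w\<close> has zero coefficients; these are evaluations of polynomials in
  fewer variables, to which the induction applies.\<close>

lemma eval_eq_0_imp_eq_0:
  assumes "finite W" "p \<in> polys W" "\<And>x. eval_mpoly x p = 0"
  shows "p = 0"
  using assms
proof (induction W arbitrary: p rule: finite_induct)
  case empty
  have "p = Poly_Mapping.single 0 (Poly_Mapping.lookup p 0)"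
    using empty(1) by (intro poly_mapping_eqI) (auto simp: polys_def in_keys_iff lookup_single when_def)
  moreover have "Poly_Mapping.lookup p 0 = 0"
    using empty(2)[of "\<lambda>_. 0"]
    by (subst (asm) calculation) (simp add: eval_mpoly_eq_line[where y = "\<lambda>_. 0"])
  ultimately show ?case by simp
next
  case (insert w W)
  obtain N q where q: "\<And>r. q r \<in> polys W" and p: "p = (\<Sum>r<N. q r * Var w ^ r)"
    using polys_insert_decomp[OF insert.prems(1) insert.hyps(2)] by blast
  let ?e = "\<lambda>x p. poly (line x (\<lambda>_. 0) p) 0"
  have "?e x (q r) = 0" if "r < N" for x r
  proof -
    have "(\<Sum>r<N. ?e x (q r) * z ^ r) = 0" for z
    proof -
      have "?e (x(w := z)) p = 0"
        using insert.prems(2) by (simp add: eval_mpoly_eq_line[where y = "\<lambda>_. 0"])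
      moreover have "line (x(w := z)) (\<lambda>_. 0) (q r) = line x (\<lambda>_. 0) (q r)" for r
        by (rule line_cong[OF q]) (use insert.hyps in auto)
      ultimately show ?thesis by (simp add: p poly_sum)
    qed
    then have "(\<Sum>r<N. monom (?e x (q r)) r) = 0"
      by (intro poly_all_0_iff_0[THEN iffD1]) (simp add: poly_sum poly_monom)
    then have "coeff (\<Sum>r<N. monom (?e x (q r)) r) r = 0" by simp
    then show ?thesis using that by (simp add: coeff_sum)
  qed
  then have "q r = 0" if "r < N" for r
    using that by (intro insert.IH[OF q]) (simp add: eval_mpoly_eq_line[where y = "\<lambda>_. 0"])
  then show ?case by (simp add: p)
qed


section \<open>Powers of the complete intersection ideal\<close>

definition binom :: "nat \<Rightarrow> nat \<Rightarrow> mpoly" where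
  "binom k j = Var j ^ k - Var 0 ^ k"

lemma binom_polys [simp]: "j \<le> n \<Longrightarrow> binom k j \<in> polys {0..n}"
  by (simp add: binom_def)

text \<open>\<open>pow_ideal n k m d\<close> is the ideal \<open>(f\<^sub>1, \<dots>, f\<^sub>m)\<^sup>d\<close> with \<open>f\<^sub>j = x\<^sub>j\<^sup>k - x\<^sub>0\<^sup>k\<close>.\<close>

fun pow_ideal :: "nat \<Rightarrow> nat \<Rightarrow> nat \<Rightarrow> nat \<Rightarrow> mpoly set" where
  "pow_ideal n k m 0 = polys {0..n}"
| "pow_ideal n k 0 (Suc d) = {0}"
| "pow_ideal n k (Suc m) (Suc d) =
     {u + binom k (Suc m) * w | u w. u \<in> pow_ideal n k m (Suc d) \<and> w \<in> pow_ideal n k (Suc m) d}"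

text \<open>The points x are those of the affine zero set of \<open>f_1, ..., f_m\<close> off the
  hyperplane \<open>x_0 = 0\<close>, with arbitrary scaling and with the coordinates above m free.
  For m = 0 this is a dense open set, for m = n the cone over the given points without its
  vertex.\<close>

definition vanishing :: "nat \<Rightarrow> nat \<Rightarrow> nat \<Rightarrow> nat \<Rightarrow> mpoly set" where
  "vanishing n k m d = {p \<in> polys {0..n}. \<forall>x y. x 0 \<noteq> 0 \<and> (\<forall>j\<in>{1..m}. x j ^ k = x 0 ^ k) \<longrightarrow>
     [:0, 1:] ^ d dvd line x y p}"

lemma vanishingD:
  "p \<in> vanishing n k m d \<Longrightarrow> x 0 \<noteq> 0 \<Longrightarrow> (\<And>j. j \<in> {1..m} \<Longrightarrow> x j ^ k = x 0 ^ k) \<Longrightarrow>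
    [:0, 1:] ^ d dvd line x y p"
  by (simp add: vanishing_def)

lemma vanishing_polys: "p \<in> vanishing n k m d \<Longrightarrow> p \<in> polys {0..n}"
  by (simp add: vanishing_def)

lemma vanishing_0 [simp]: "vanishing n k m 0 = polys {0..n}"
  by (auto simp: vanishing_def)

lemma vanishing_zero [simp]: "0 \<in> vanishing n k m d"
  by (simp add: vanishing_def)

lemma vanishing_add [simp]:
  "p \<in> vanishing n k m d \<Longrightarrow> q \<in> vanishing n k m d \<Longrightarrow> p + q \<in> vanishing n k m d"
  by (auto simp: vanishing_def)

lemma vanishing_mult [simp]:
  "p \<in> polys {0..n} \<Longrightarrow> q \<in> vanishing n k m d \<Longrightarrow> p * q \<in> vanishing n k m d"
  by (auto simp: vanishing_def)

lemma vanishing_uminus [simp]: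
  "p \<in> vanishing n k m d \<Longrightarrow> - p \<in> vanishing n k m d"
  by (auto simp: vanishing_def)

lemma vanishing_diff [simp]:
  "p \<in> vanishing n k m d \<Longrightarrow> q \<in> vanishing n k m d \<Longrightarrow> p - q \<in> vanishing n k m d"
  using vanishing_add[of p n k m d "- q"] by simp

lemma vanishing_mono:
  "p \<in> vanishing n k m d \<Longrightarrow> m \<le> m' \<Longrightarrow> p \<in> vanishing n k m' d"
  by (auto simp: vanishing_def)

lemma vanishing_antimono:
  "p \<in> vanishing n k m d \<Longrightarrow> d' \<le> d \<Longrightarrow> p \<in> vanishing n k m d'"
  by (auto simp: vanishing_def intro: dvd_trans[OF le_imp_power_dvd])

lemma line_binom_dvd:
  assumes "x j ^ k = x 0 ^ k"
  shows "[:0, 1:] dvd line x y (binom k j)"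
proof -
  have "poly (line x y (binom k j)) 0 = 0"
    using assms by (simp add: binom_def)
  then show ?thesis by (simp add: poly_eq_0_iff_dvd)
qed

lemma vanishing_binom_mult:
  assumes "1 \<le> j" "j \<le> m" "j \<le> n" "p \<in> vanishing n k m d"
  shows "binom k j * p \<in> vanishing n k m (Suc d)"
proof -
  have "[:0, 1:] ^ Suc d dvd line x y (binom k j * p)"
    if "x 0 \<noteq> 0 \<and> (\<forall>j\<in>{1..m}. x j ^ k = x 0 ^ k)" for x y
    unfolding power_Suc line_mult
    by (intro mult_dvd_mono line_binom_dvd vanishingD[OF assms(4)]) (use that assms in auto)
  then show ?thesis
    using assms by (simp add: vanishing_def del: power_Suc line_mult)
qed

section \<open>Powers of t dividing one-variable polynomials\<close>

lemma X_pow_dvd_iff: "[:0, 1:] ^ d dvd (p :: complex poly) \<longleftrightarrow> (\<forall>e<d. coeff p e = 0)"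
proof -
  have X: "[:0, 1:] ^ d = monom (1::complex) d"
    by (simp add: monom_altdef)
  have "monom 1 d dvd p" if "\<forall>e<d. coeff p e = 0"
  proof -
    have "p = monom 1 d * poly_shift d p"
      using that by (intro poly_eqI) (auto simp: coeff_monom_mult coeff_poly_shift)
    then show ?thesis by (rule dvdI)
  qed
  moreover have "coeff p e = 0" if "monom 1 d dvd p" "e < d" for e
    using that by (auto simp: coeff_monom_mult elim!: dvdE)
  ultimately show ?thesis unfolding X by blast
qed

text \<open>A polynomial with nonzero constant term is invertible as a power series, so it does not
  affect the order in t; the coefficients of \<open>q\<close> are cleared one after another.\<close>

lemma X_pow_dvd_mult_cancel:
  assumes "[:0, 1:] ^ d dvd p * q" "coeff p 0 \<noteq> (0::complex)"
  shows "[:0, 1:] ^ d dvd q"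
proof -
  have "coeff q e = 0" if "e < d" for e
    using that
  proof (induction e rule: less_induct)
    case (less e)
    have "(\<Sum>i\<le>e. coeff p i * coeff q (e - i)) = 0"
      using assms(1) less.prems by (simp add: X_pow_dvd_iff coeff_mult)
    moreover have "(\<Sum>i\<le>e. coeff p i * coeff q (e - i)) = (\<Sum>i\<in>{0}. coeff p i * coeff q (e - i))"
      by (rule sum.mono_neutral_right) (use less in auto)
    ultimately show ?case using assms(2) by simp
  qed
  then show ?thesis by (simp add: X_pow_dvd_iff)
qed

lemma continuous_on_fun_upd: "continuous_on S (\<lambda>s. (x(i := s)) j)"
  by (cases "i = j") simp_all

lemma vanishing_0_Suc: "vanishing n k 0 (Suc d) = {0}"
proof -
  have "p = 0" if "p \<in> vanishing n k 0 (Suc d)" for p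
  proof (rule eval_eq_0_imp_eq_0)
    show "p \<in> polys {0..n}" using that by (rule vanishing_polys)
    fix x :: "nat \<Rightarrow> complex"
    have "coeff (line (x(0 := s)) (\<lambda>_. 0) p) 0 = 0" if "s \<notin> {0}" for s
      using vanishingD[OF \<open>p \<in> vanishing n k 0 (Suc d)\<close>, of "x(0 := s)" "\<lambda>_. 0"] that
      unfolding X_pow_dvd_iff by simp
    then have "coeff (line (x(0 := s)) (\<lambda>_. 0) p) 0 = 0" for s
      by (rule continuous_eq_0[rotated 2])
        (auto intro!: continuous_coeff_line continuous_on_fun_upd simp del: fun_upd_apply)
    from this[of "x 0"] show "eval_mpoly x p = 0"
      by (simp add: eval_mpoly_eq_line[where y = "\<lambda>_. 0"] poly_0_coeff_0)
  qed simp
  then show ?thesis by auto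
qed

text \<open>As a polynomial in \<open>Var j\<close>, \<open>binom k j\<close> is monic of degree
  \<open>k\<close>. Replacing \<open>Var j ^ k\<close> by \<open>Var 0 ^ k\<close> modulo it lowers
  the exponent by \<open>k\<close>; since \<open>j\<close> is not 0, the factor
  \<open>Var 0 ^ k\<close> stays among the coefficients free of \<open>Var j\<close>.\<close>

lemma binom_division:
  assumes "p \<in> polys {0..n}" "1 \<le> j" "j \<le> n" "k > 0"
  shows "\<exists>w u. w \<in> polys {0..n} \<and> (\<forall>r. u r \<in> polys ({0..n} - {j})) \<and>
    p = binom k j * w + (\<Sum>r<k. u r * Var j ^ r)"
proof -
  let ?W = "{0..n} - {j}"
  let ?P = "\<lambda>p. \<exists>w u. w \<in> polys {0..n} \<and> (\<forall>r. u r \<in> polys ?W) \<and>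
    p = binom k j * w + (\<Sum>r<k. u r * Var j ^ r)"
  have add: "?P (p + q)" if Pp: "?P p" and Pq: "?P q" for p q
  proof -
    obtain w u where "w \<in> polys {0..n}" "\<forall>r. u r \<in> polys ?W"
      "p = binom k j * w + (\<Sum>r<k. u r * Var j ^ r)" using Pp by blast
    moreover obtain w' u' where "w' \<in> polys {0..n}" "\<forall>r. u' r \<in> polys ?W"
      "q = binom k j * w' + (\<Sum>r<k. u' r * Var j ^ r)" using Pq by blast
    ultimately show ?thesis
      by (intro exI[of _ "w + w'"] exI[of _ "\<lambda>r. u r + u' r"])
        (simp add: distrib_left distrib_right sum.distrib)
  qed
  have monom: "?P (q * Var j ^ N)" if "q \<in> polys ?W" for N q
    using that
  proof (induction N arbitrary: q rule: less_induct)
    case (less N)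
    show ?case
    proof (cases "N < k")
      case True
      then show ?thesis using less.prems
        by (intro exI[of _ 0] exI[of _ "\<lambda>r. if r = N then q else 0"])
          (simp add: if_distrib[of "\<lambda>x. x * _"] sum.delta cong: if_cong)
    next
      case False
      define M where "M = N - k"
      have N: "N = M + k" "M < N" using False \<open>k > 0\<close> by (auto simp: M_def)
      have "Var 0 ^ k * q \<in> polys ?W" using less.prems assms by simp
      then have 1: "?P (Var 0 ^ k * q * Var j ^ M)" by (rule less.IH[OF N(2)])
      have 2: "?P (binom k j * (q * Var j ^ M))"
        using less.prems assms polys_mono[of q ?W "{0..n}"]
        by (intro exI[of _ "q * Var j ^ M"] exI[of _ "\<lambda>_. 0"]) simp
      have "q * Var j ^ N = binom k j * (q * Var j ^ M) + Var 0 ^ k * q * Var j ^ M"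
        by (simp add: N binom_def power_add algebra_simps)
      then show ?thesis using add[OF 2 1] by (simp only:)
    qed
  qed
  have "insert j ?W = {0..n}" using assms by auto
  with assms obtain N q where q: "\<And>r. q r \<in> polys ?W" and p: "p = (\<Sum>r<N. q r * Var j ^ r)"
    using polys_insert_decomp[of p j ?W] by auto
  have "?P (\<Sum>r<N. q r * Var j ^ r)" for N
  proof (induction N)
    case 0
    show ?case by (intro exI[of _ 0] exI[of _ "\<lambda>_. 0"]) simp
  next
    case (Suc N)
    show ?case unfolding sum.lessThan_Suc by (rule add[OF Suc monom[OF q]])
  qed
  then show ?thesis unfolding p .
qed

section \<open>Powers of a primitive root of unity\<close>

lemma primitive_root_inj:
  assumes "primitive_root_of_unity k \<xi>"
  shows "inj_on (\<lambda>s. \<xi> ^ s) {..<k}"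
proof -
  have "\<xi> \<noteq> 0" using assms by (auto simp: primitive_root_of_unity_def zero_power)
  have "s = t" if "s \<le> t" "t < k" "\<xi> ^ s = \<xi> ^ t" for s t
  proof (rule ccontr)
    assume "s \<noteq> t"
    then have "0 < t - s" "t - s < k" using that by auto
    moreover have "\<xi> ^ (t - s) = 1"
      using that \<open>\<xi> \<noteq> 0\<close> by (simp add: power_diff)
    ultimately show False using assms by (auto simp: primitive_root_of_unity_def)
  qed
  then show ?thesis
    by (intro inj_onI) (metis lessThan_iff nle_le)
qed

lemma primitive_root_exhaust:
  assumes "primitive_root_of_unity k \<xi>" "z ^ k = 1"
  shows "\<exists>s<k. z = \<xi> ^ s"
proof -
  have k: "k > 0" "\<xi> ^ k = 1" using assms by (auto simp: primitive_root_of_unity_def)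
  let ?R = "{z::complex. z ^ k = 1}"
  have "(\<lambda>s. \<xi> ^ s) ` {..<k} = ?R"
  proof (rule card_subset_eq)
    show "finite ?R" by (rule finite_roots_unity) (use k in auto)
    show "(\<lambda>s. \<xi> ^ s) ` {..<k} \<subseteq> ?R"
      using k by (auto simp: power_mult [symmetric] mult.commute[of _ k]) (simp add: power_mult)
    have "card ((\<lambda>s. \<xi> ^ s) ` {..<k}) = k"
      using card_image[OF primitive_root_inj[OF assms(1)]] by simp
    then show "card ((\<lambda>s. \<xi> ^ s) ` {..<k}) = card ?R"
      using card_roots_unity_eq k by simp
  qed
  with assms(2) show ?thesis by blast
qed

text \<open>On the hyperplane \<open>f\<^sub>j = 0\<close> the remainder of the division by \<open>f\<^sub>j\<close> is a polynomial of degree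
  less than \<open>k\<close> in \<open>x\<^sub>j\<close> with the \<open>k\<close> roots \<open>\<xi>\<^sup>s x\<^sub>0\<close>, so all its coefficients vanish.\<close>

lemma vanishing_remainder:
  assumes \<xi>: "primitive_root_of_unity k \<xi>" and "Suc m \<le> n"
    and p: "p \<in> vanishing n k (Suc m) d" and w: "w \<in> polys {0..n}"
    and u: "\<And>r. u r \<in> polys ({0..n} - {Suc m})"
    and eq: "p = binom k (Suc m) * w + (\<Sum>r<k. u r * Var (Suc m) ^ r)"
  shows "(\<Sum>r<k. u r * Var (Suc m) ^ r) \<in> vanishing n k m d"
proof -
  have k: "\<xi> ^ k = 1" using \<xi> by (auto simp: primitive_root_of_unity_def)
  have "[:0, 1:] ^ d dvd line x y (\<Sum>r<k. u r * Var (Suc m) ^ r)"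
    if x: "x 0 \<noteq> 0" "\<And>j. j \<in> {1..m} \<Longrightarrow> x j ^ k = x 0 ^ k" for x y
  proof -
    let ?X = "[:x 0, y 0:]"
    have "[:0, 1:] ^ d dvd line x y (u r) * ?X ^ r" if r: "r < k" for r
      unfolding X_pow_dvd_iff
    proof (intro allI impI)
      fix e assume e: "e < d"
      \<comment> \<open>For fixed \<open>e\<close> these numbers are taken as the coefficients of an
        auxiliary polynomial of degree below \<open>k\<close>, which will be evaluated at the powers
        of \<open>\<xi>\<close>.\<close>
      let ?c = "\<lambda>r. coeff (line x y (u r) * ?X ^ r) e"
      have "(\<Sum>r<k. ?c r * (\<xi> ^ s) ^ r) = 0" for s
      proof -
        \<comment> \<open>Base point and direction are changed together, so coordinate
          \<open>Suc m\<close> is \<open>\<xi> ^ s\<close> times coordinate 0 along the entire line.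
          Then \<open>binom k (Suc m)\<close> restricts to the zero polynomial, which removes the
          quotient \<open>w\<close>, while the \<open>u r\<close> do not see the change.\<close>
        let ?x = "x(Suc m := x 0 * \<xi> ^ s)" and ?y = "y(Suc m := y 0 * \<xi> ^ s)"
        have LX: "line ?x ?y (Var (Suc m)) = ?X * [:\<xi> ^ s:]" by simp
        have "(\<xi> ^ s) ^ k = 1" using k by (metis mult.commute power_mult power_one)
        then have xk: "(x 0 * \<xi> ^ s) ^ k = x 0 ^ k"
          and Xk: "(?X * [:\<xi> ^ s:]) ^ k = ?X ^ k"
          by (simp_all only: power_mult_distrib poly_const_pow mult_1_right one_pCons [symmetric])
        have "line ?x ?y (binom k (Suc m)) = 0"
          by (simp only: binom_def line_diff line_power LX Xk) simp
        moreover have "[:0, 1:] ^ d dvd line ?x ?y p"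
          by (rule vanishingD[OF p]) (use x xk in \<open>auto simp: le_Suc_eq\<close>)
        moreover have "line ?x ?y (u r) = line x y (u r)" for r
          by (rule line_cong[OF u]) auto
        ultimately have "[:0, 1:] ^ d dvd (\<Sum>r<k. line x y (u r) * (?X * [:\<xi> ^ s:]) ^ r)"
          by (simp only: eq line_add line_mult line_sum line_power LX mult_zero_left add_0)
        moreover have "(\<Sum>r<k. line x y (u r) * (?X * [:\<xi> ^ s:]) ^ r) =
            (\<Sum>r<k. Polynomial.smult ((\<xi> ^ s) ^ r) (line x y (u r) * ?X ^ r))"
          by (simp only: power_mult_distrib poly_const_pow) (simp add: mult_ac)
        ultimately have "[:0, 1:] ^ d dvd (\<Sum>r<k. Polynomial.smult ((\<xi> ^ s) ^ r) (line x y (u r) * ?X ^ r))"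
          by (simp only:)
        then show ?thesis using e
          by (simp add: X_pow_dvd_iff coeff_sum mult.commute)
      qed
      then have zero: "poly (\<Sum>r<k. monom (?c r) r) (\<xi> ^ s) = 0" for s
        by (simp add: poly_sum poly_monom)
      \<comment> \<open>The \<open>k\<close> distinct powers of \<open>\<xi>\<close> are roots,
        which exceeds the degree.\<close>
      have "(\<Sum>r<k. monom (?c r) r) = 0"
      proof (rule ccontr)
        assume *: "(\<Sum>r<k. monom (?c r) r) \<noteq> 0"
        have "k = card ((\<lambda>s. \<xi> ^ s) ` {..<k})"
          using card_image[OF primitive_root_inj[OF \<xi>]] by simp
        also have "\<dots> \<le> card {z. poly (\<Sum>r<k. monom (?c r) r) z = 0}"
          by (rule card_mono) (use * zero poly_roots_finite in auto)
        also have "\<dots> \<le> degree (\<Sum>r<k. monom (?c r) r)"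
          by (rule card_poly_roots_bound[OF *])
        also have "\<dots> < k"
          by (rule degree_sum_less) (use r in \<open>auto intro: le_less_trans[OF degree_monom_le]\<close>)
        finally show False by simp
      qed
      then have "coeff (\<Sum>r<k. monom (?c r) r) r = 0" by simp
      then show "?c r = 0" using r by (simp add: coeff_sum)
    qed
    \<comment> \<open>The power of \<open>?X\<close> can be cancelled because its constant term is a
      power of \<open>x 0\<close>, which is nonzero.\<close>
    then have "[:0, 1:] ^ d dvd line x y (u r)" if "r < k" for r
      using that x(1)
      by (intro X_pow_dvd_mult_cancel[of d "?X ^ r" "line x y (u r)"]) 
        (auto simp: mult.commute coeff_0_power)
    then show ?thesis by (auto intro!: dvd_sum)
  qed
  moreover have "u r \<in> polys {0..n}" for r
    by (rule polys_mono[OF u]) auto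
  ultimately show ?thesis
    using \<open>Suc m \<le> n\<close> by (simp add: vanishing_def)
qed

lemma vanishing_binom_cancel:
  assumes "Suc m \<le> n" "k > 0" "w \<in> polys {0..n}"
    and p: "binom k (Suc m) * w \<in> vanishing n k (Suc m) (Suc d)"
  shows "w \<in> vanishing n k (Suc m) d"
proof -
  have "coeff (line x y w) e = 0"
    if x: "x 0 \<noteq> 0" "\<And>j. j \<in> {1..Suc m} \<Longrightarrow> x j ^ k = x 0 ^ k" and e: "e < d" for x y e
  proof -
    \<comment> \<open>With \<open>s\<close> in place of \<open>y (Suc m)\<close>, the linear
      coefficient of \<open>binom k (Suc m)\<close> along the line is \<open>a * s - b\<close>, so
      \<open>b / a\<close> is the only exceptional direction.\<close>
    define a where "a = of_nat k * x (Suc m) ^ (k - 1)"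
    define b where "b = of_nat k * x 0 ^ (k - 1) * y 0"
    have xk: "x (Suc m) ^ k = x 0 ^ k" using x(2) by simp
    then have "x (Suc m) \<noteq> 0" using x(1) \<open>k > 0\<close> by (auto simp: zero_power)
    then have "a \<noteq> 0" using \<open>k > 0\<close> by (simp add: a_def)
    have coeff1: "coeff ([:c, s:] ^ k) 1 = of_nat k * c ^ (k - 1) * s" for c s :: complex
    proof -
      have "coeff ([:c, s:] ^ k) 1 = poly (pderiv ([:c, s:] ^ k)) 0"
        by (simp add: poly_0_coeff_0 coeff_pderiv)
      also have "\<dots> = of_nat k * c ^ (k - 1) * s"
        by (simp add: pderiv_power pderiv_pCons)
      finally show ?thesis .
    qed
    have "coeff (line x (y(Suc m := s)) w) e = 0" if "s \<notin> {b / a}" for s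
    proof -
      let ?f = "line x (y(Suc m := s)) (binom k (Suc m))"
      have "[:0, 1:] dvd ?f" by (rule line_binom_dvd[OF xk])
      then obtain g where g: "?f = [:0, 1:] * g" by (elim dvdE)
      have "coeff g 0 = coeff ?f 1" unfolding g by simp
      also have "\<dots> = a * s - b" by (simp add: binom_def coeff1[unfolded One_nat_def] a_def b_def)
      finally have "coeff g 0 \<noteq> 0" using that \<open>a \<noteq> 0\<close> by (auto simp: field_simps)
      moreover have "[:0, 1:] ^ Suc d dvd line x (y(Suc m := s)) (binom k (Suc m) * w)"
        by (rule vanishingD[OF p]) (use x in auto)
      then have "[:0, 1:] ^ d dvd g * line x (y(Suc m := s)) w"
        by (simp only: line_mult g power_Suc mult.assoc dvd_mult_cancel_left) simp
      ultimately have "[:0, 1:] ^ d dvd line x (y(Suc m := s)) w"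
        by (rule X_pow_dvd_mult_cancel[rotated])
      then show ?thesis using e unfolding X_pow_dvd_iff by simp
    qed
    then have "coeff (line x (y(Suc m := s)) w) e = 0" for s
      by (rule continuous_eq_0[rotated 2])
        (auto intro!: continuous_coeff_line continuous_on_fun_upd simp del: fun_upd_apply)
    from this[of "y (Suc m)"] show ?thesis by simp
  qed
  then show ?thesis using assms(3) by (simp add: vanishing_def X_pow_dvd_iff)
qed

text \<open>The outer induction on \<open>m\<close> accounts for the remainder of the division, the
  inner one on \<open>d\<close> for the quotient, matching the two summands in the recursion of
  \<open>pow_ideal\<close>.\<close>

theorem pow_ideal_eq_vanishing:
  assumes \<xi>: "primitive_root_of_unity k \<xi>"
  shows "m \<le> n \<Longrightarrow> pow_ideal n k m d = vanishing n k m d"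
proof (induction m arbitrary: d)
  case 0
  show ?case by (cases d) (simp_all add: vanishing_0_Suc)
next
  case (Suc m)
  have k: "k > 0" using \<xi> by (simp add: primitive_root_of_unity_def)
  have IH1: "pow_ideal n k m d = vanishing n k m d" for d
    using Suc by simp
  show ?case
  proof (induction d)
    case (Suc d)
    show ?case
    proof (intro Set.set_eqI iffI)
      fix p assume "p \<in> pow_ideal n k (Suc m) (Suc d)"
      then show "p \<in> vanishing n k (Suc m) (Suc d)"
        using \<open>Suc m \<le> n\<close>
        by (auto simp: IH1 Suc.IH intro!: vanishing_add vanishing_binom_mult intro: vanishing_mono)
    next
      fix p assume p: "p \<in> vanishing n k (Suc m) (Suc d)"
      obtain w u where w: "w \<in> polys {0..n}" and u: "\<And>r. u r \<in> polys ({0..n} - {Suc m})"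
        and eq: "p = binom k (Suc m) * w + (\<Sum>r<k. u r * Var (Suc m) ^ r)"
        using binom_division[OF vanishing_polys[OF p], of "Suc m" k] \<open>Suc m \<le> n\<close> k by auto
      let ?u = "\<Sum>r<k. u r * Var (Suc m) ^ r"
      have u': "?u \<in> vanishing n k m (Suc d)"
        by (rule vanishing_remainder[OF \<xi> \<open>Suc m \<le> n\<close> p w u eq])
      \<comment> \<open>Imposing more equations leaves fewer points to test, so the remainder can be
        subtracted from \<open>p\<close>; what is left is \<open>binom k (Suc m) * w\<close>, from
        which one order is cancelled.\<close>
      then have "?u \<in> vanishing n k (Suc m) (Suc d)"
        by (rule vanishing_mono) simp
      with p have "p - ?u \<in> vanishing n k (Suc m) (Suc d)"
        by (rule vanishing_diff)
      then have "w \<in> vanishing n k (Suc m) d"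
        using vanishing_binom_cancel[OF \<open>Suc m \<le> n\<close> k w] by (simp add: eq)
      with u' show "p \<in> pow_ideal n k (Suc m) (Suc d)"
        by (auto simp: IH1 Suc.IH eq add.commute[of "binom k (Suc m) * w"])
    qed
  qed simp
qed


section \<open>Homogeneous components\<close>

lemma total_degree_superset:
  "finite A \<Longrightarrow> Poly_Mapping.keys m \<subseteq> A \<Longrightarrow> total_degree m = (\<Sum>i\<in>A. Poly_Mapping.lookup m i)"
  unfolding total_degree_def by (rule sum.mono_neutral_left) (auto simp: in_keys_iff)

lemma total_degree_add: "total_degree (m + m') = total_degree m + total_degree m'"
  by (simp add: total_degree_superset[of "Poly_Mapping.keys m \<union> Poly_Mapping.keys m'"] keys_add_nat
      lookup_add sum.distrib)

lemma homogeneous_zero [simp]: "homogeneous e 0"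
  by (simp add: homogeneous_def)

lemma homogeneous_one [simp]: "homogeneous 0 1"
  by (simp add: homogeneous_def total_degree_def)

lemma homogeneous_add [simp]: "homogeneous e p \<Longrightarrow> homogeneous e q \<Longrightarrow> homogeneous e (p + q)"
  using keys_add[of p q] by (auto simp: homogeneous_def)

lemma homogeneous_uminus [simp]: "homogeneous e (- p) \<longleftrightarrow> homogeneous e p"
  by (simp add: homogeneous_def)

lemma homogeneous_diff [simp]: "homogeneous e p \<Longrightarrow> homogeneous e q \<Longrightarrow> homogeneous e (p - q)"
  using homogeneous_add[of e p "- q"] by simp

lemma homogeneous_sum: "(\<And>i. i \<in> A \<Longrightarrow> homogeneous e (p i)) \<Longrightarrow> homogeneous e (sum p A)"
  by (induction A rule: infinite_finite_induct) simp_all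

lemma homogeneous_mult: "homogeneous e p \<Longrightarrow> homogeneous e' q \<Longrightarrow> homogeneous (e + e') (p * q)"
  using keys_mult[of p q] by (fastforce simp: homogeneous_def total_degree_add)

lemma homogeneous_Var: "homogeneous 1 (Var i)"
  by (simp add: homogeneous_def Var_def total_degree_def)

lemma homogeneous_power: "homogeneous e p \<Longrightarrow> homogeneous (int r * e) (p ^ r)"
proof (induction r)
  case (Suc r)
  have "homogeneous (e + int r * e) (p * p ^ r)"
    using Suc by (intro homogeneous_mult) simp_all
  then show ?case by (simp add: algebra_simps)
qed simp

lemma homogeneous_prod:
  "(\<And>i. i \<in> A \<Longrightarrow> homogeneous (e i) (p i)) \<Longrightarrow> homogeneous (\<Sum>i\<in>A. e i) (prod p A)"
  by (induction A rule: infinite_finite_induct) (simp_all add: homogeneous_mult)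

lemma homogeneous_binom: "homogeneous (int k) (binom k j)"
  using homogeneous_power[OF homogeneous_Var, of k] by (simp add: binom_def)

definition hom_part :: "int \<Rightarrow> mpoly \<Rightarrow> mpoly" where
  "hom_part e p = (\<Sum>m\<in>{m \<in> Poly_Mapping.keys p. int (total_degree m) = e}.
     Poly_Mapping.single m (Poly_Mapping.lookup p m))"

lemma lookup_hom_part:
  "Poly_Mapping.lookup (hom_part e p) m = (if int (total_degree m) = e then Poly_Mapping.lookup p m else 0)"
  by (auto simp: hom_part_def lookup_sum lookup_single when_def in_keys_iff)

lemma homogeneous_hom_part [simp]: "homogeneous e (hom_part e p)"
  by (auto simp: homogeneous_def in_keys_iff lookup_hom_part split: if_splits)

lemma hom_part_polys [simp]: "p \<in> polys W \<Longrightarrow> hom_part e p \<in> polys W"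
  by (auto simp: polys_def in_keys_iff[of _ "hom_part e p"] in_keys_iff[of _ p] lookup_hom_part split: if_splits)

lemma hom_part_zero [simp]: "hom_part e 0 = 0"
  by (simp add: hom_part_def)

lemma hom_part_add: "hom_part e (p + q) = hom_part e p + hom_part e q"
  by (rule poly_mapping_eqI) (simp add: lookup_hom_part lookup_add)

lemma hom_part_diff: "hom_part e (p - q) = hom_part e p - hom_part e q"
  by (rule poly_mapping_eqI) (simp add: lookup_hom_part lookup_minus)

lemma hom_part_sum: "hom_part e (sum p A) = (\<Sum>i\<in>A. hom_part e (p i))"
  by (induction A rule: infinite_finite_induct) (simp_all add: hom_part_add)

lemma hom_part_homogeneous: "homogeneous e p \<Longrightarrow> hom_part e p = p"
  by (rule poly_mapping_eqI) (auto simp: lookup_hom_part homogeneous_def in_keys_iff)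

lemma hom_part_homogeneous_neq: "homogeneous e' p \<Longrightarrow> e \<noteq> e' \<Longrightarrow> hom_part e p = 0"
  by (rule poly_mapping_eqI) (auto simp: lookup_hom_part homogeneous_def in_keys_iff)

text \<open>The source of all graded lifts below: in a linear equation with homogeneous coefficients
  and right-hand side, a solution may be replaced by suitable homogeneous components.\<close>

lemma hom_part_mult:
  assumes "homogeneous h g"
  shows "hom_part e (w * g) = hom_part (e - h) w * g"
proof -
  have "w \<in> polys UNIV" by simp
  then show ?thesis
  proof (induction w rule: polys_induct)
    case (single m c)
    let ?w = "Poly_Mapping.single m c"
    have hom: "homogeneous (int (total_degree m)) ?w"
      by (simp add: homogeneous_def)
    show ?case
    proof (cases "int (total_degree m) = e - h")
      case True
      then have "homogeneous e (?w * g)"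
        using homogeneous_mult[OF hom assms] by simp
      then show ?thesis using hom True by (simp add: hom_part_homogeneous)
    next
      case False
      then have "hom_part e (?w * g) = 0"
        using homogeneous_mult[OF hom assms] by (intro hom_part_homogeneous_neq) auto
      moreover have "hom_part (e - h) ?w = 0"
        using hom False by (intro hom_part_homogeneous_neq) auto
      ultimately show ?thesis by simp
    qed
  qed (simp_all add: distrib_right hom_part_add)
qed

lemma hom_part_pow_ideal:
  "p \<in> pow_ideal n k m d \<Longrightarrow> hom_part e p \<in> pow_ideal n k m d"
proof (induction n k m d arbitrary: p e rule: pow_ideal.induct)
  case (3 n k m d)
  then obtain u w where u: "u \<in> pow_ideal n k m (Suc d)" and w: "w \<in> pow_ideal n k (Suc m) d"
    and p: "p = u + w * binom k (Suc m)" by (auto simp: mult.commute)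
  have "hom_part e p = hom_part e u + binom k (Suc m) * hom_part (e - int k) w"
    by (simp add: p hom_part_add hom_part_mult[OF homogeneous_binom])
  with 3(1)[OF u] 3(2)[OF w] show ?case by auto
qed auto


section \<open>Fat points\<close>

interpretation poly_ring: cring "poly_ring n"
  by (rule poly_ring_ring)

lemma poly_ring_idealI:
  assumes "A \<subseteq> polys {0..n}" "0 \<in> A" "\<And>p q. p \<in> A \<Longrightarrow> q \<in> A \<Longrightarrow> p + q \<in> A"
    and mult: "\<And>p q. p \<in> polys {0..n} \<Longrightarrow> q \<in> A \<Longrightarrow> p * q \<in> A"
  shows "ideal A (poly_ring n)"
proof (rule idealI)
  show "ring (poly_ring n)" by (rule poly_ring.ring_axioms)
  have inv: "\<ominus>\<^bsub>poly_ring n\<^esub> p = - p" if "p \<in> polys {0..n}" for p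
    using that by (intro poly_ring.minus_equality) (simp_all add: carrier_poly_ring)
  have "- p \<in> A" if "p \<in> A" for p
    using mult[of "-1" p] that by simp
  then show "subgroup A (add_monoid (poly_ring n))"
    using assms inv by (intro poly_ring.add.subgroupI) (auto simp: carrier_poly_ring subset_iff)
next
  fix a x assume "a \<in> A" "x \<in> carrier (poly_ring n)"
  then show "x \<otimes>\<^bsub>poly_ring n\<^esub> a \<in> A" "a \<otimes>\<^bsub>poly_ring n\<^esub> x \<in> A"
    using mult[of x a] by (simp_all add: carrier_poly_ring mult.commute)
qed

lemma poly_ring_idealD:
  assumes "ideal A (poly_ring n)"
  shows "A \<subseteq> polys {0..n}" "0 \<in> A" "p \<in> A \<Longrightarrow> q \<in> A \<Longrightarrow> p + q \<in> A"
    and "p \<in> polys {0..n} \<Longrightarrow> q \<in> A \<Longrightarrow> p * q \<in> A"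
proof -
  interpret ideal A "poly_ring n" by fact
  show "A \<subseteq> polys {0..n}" "0 \<in> A" "p \<in> A \<Longrightarrow> q \<in> A \<Longrightarrow> p + q \<in> A"
    using a_subset zero_closed a_closed by (auto simp: carrier_poly_ring)
  show "p \<in> polys {0..n} \<Longrightarrow> q \<in> A \<Longrightarrow> p * q \<in> A"
    using I_l_closed[of q p] by (auto simp: carrier_poly_ring)
qed

lemma ideals_set_simps [simp]:
  "mult (ideals_set R) = ideal_prod R" "one (ideals_set R) = carrier R"
  by (simp_all add: ideals_set_def)

lemma ideal_power_ideal:
  assumes "ideal A (poly_ring n)"
  shows "ideal (A [^]\<^bsub>ideals_set (poly_ring n)\<^esub> (d::nat)) (poly_ring n)"
proof (induction d)
  case 0
  show ?case by (auto simp: carrier_poly_ring intro!: poly_ring_idealI)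
next
  case (Suc d)
  then show ?case using assms by (simp add: poly_ring.ideal_prod_is_ideal)
qed

lemma prod_power_in_ideal_power:
  assumes "ideal A (poly_ring n)" "finite B" "\<And>j. j \<in> B \<Longrightarrow> f j \<in> A"
  shows "(\<Prod>j\<in>B. f j ^ a j) \<in> A [^]\<^bsub>ideals_set (poly_ring n)\<^esub> (\<Sum>j\<in>B. a j :: nat)"
  using assms(2,3)
proof (induction B rule: finite_induct)
  case (insert j B)
  have step: "p * f j ^ r \<in> A [^]\<^bsub>ideals_set (poly_ring n)\<^esub> (r + e)"
    if "p \<in> A [^]\<^bsub>ideals_set (poly_ring n)\<^esub> e" for p and r e :: nat
  proof (induction r)
    case (Suc r)
    from ideal_prod.prod[OF this insert.prems[of j], of "poly_ring n"]
    show ?case by (simp add: mult_ac)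
  qed (use that in simp)
  show ?case using step[OF insert.IH, of "a j"] insert by (simp add: mult.commute)
qed (simp add: carrier_poly_ring)

lemma point_ideal_ideal: "ideal (point_ideal n a) (poly_ring n)"
  unfolding point_ideal_def by (rule poly_ring.genideal_ideal) auto

lemma eval_homogeneous_scale:
  assumes "homogeneous (int e) p"
  shows "eval_mpoly (\<lambda>i. c * a i) p = c ^ e * eval_mpoly a p"
proof -
  have "(\<Prod>i\<in>Poly_Mapping.keys m. (c * a i) ^ Poly_Mapping.lookup m i) =
      c ^ e * (\<Prod>i\<in>Poly_Mapping.keys m. a i ^ Poly_Mapping.lookup m i)"
    if "m \<in> Poly_Mapping.keys p" for m
  proof -
    have "e = total_degree m" using assms that by (simp add: homogeneous_def)
    then show ?thesis
      by (simp add: power_mult_distrib prod.distrib total_degree_def power_sum)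
  qed
  then show ?thesis
    by (simp add: eval_mpoly_def sum_distrib_left mult_ac cong: sum.cong)
qed

lemma eval_homogeneous_eq_0:
  assumes "homogeneous e p" "eval_mpoly a p = 0"
  shows "eval_mpoly (\<lambda>i. c * a i) p = 0"
proof (cases "p = 0")
  case False
  \<comment> \<open>The degree is an integer; a monomial of \<open>p\<close> shows that it is a
    natural number and can serve as an exponent of \<open>c\<close>.\<close>
  then obtain m where "m \<in> Poly_Mapping.keys p" by fastforce
  then have "e = int (total_degree m)" using assms(1) by (simp add: homogeneous_def)
  then show ?thesis using eval_homogeneous_scale[of "total_degree m" p c a] assms by simp
qed (simp add: eval_mpoly_def)

text \<open>Each generating form vanishes at all multiples of \<open>a\<close>, so each element of
  the point ideal gains a factor t along a line through \<open>c\<close> times \<open>a\<close>, and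
  a product of \<open>d\<close> of them gains t^d. The scalar \<open>c\<close> is there because
  \<open>vanishing\<close> admits every scaling of a point.\<close>

lemma point_ideal_power_line:
  assumes "p \<in> point_ideal n a [^]\<^bsub>ideals_set (poly_ring n)\<^esub> d"
  shows "[:0, 1:] ^ d dvd line (\<lambda>i. c * a i) y p"
  using assms
proof (induction d arbitrary: p)
  case (Suc d)
  let ?L = "{p \<in> polys {0..n}. [:0, 1:] dvd line (\<lambda>i. c * a i) y p}"
  have "point_ideal n a \<subseteq> ?L"
    unfolding point_ideal_def
  proof (rule poly_ring.genideal_minimal)
    show "ideal ?L (poly_ring n)" by (rule poly_ring_idealI) auto
    show "{f \<in> carrier (poly_ring n). (\<exists>e. homogeneous e f) \<and> eval_mpoly a f = 0} \<subseteq> ?L"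
      by (auto simp: carrier_poly_ring poly_line poly_eq_0_iff_dvd [of _ 0, simplified, symmetric]
          dest: eval_homogeneous_eq_0)
  qed
  then have L: "[:0, 1:] dvd line (\<lambda>i. c * a i) y q" if "q \<in> point_ideal n a" for q
    using that by auto
  have "p \<in> ideal_prod (poly_ring n) (point_ideal n a [^]\<^bsub>ideals_set (poly_ring n)\<^esub> d)
      (point_ideal n a)"
    using Suc.prems by simp
  then show ?case
  proof (induction rule: ideal_prod.induct)
    case (prod q r)
    show ?case unfolding poly_ring_simps line_mult power_Suc2
      by (intro mult_dvd_mono Suc.IH prod L)
  next
    case (sum q r)
    then show ?case by (simp del: power_Suc)
  qed
qed simp

lemma fat_points_subset_vanishing:
  assumes "primitive_root_of_unity k \<xi>"
  shows "fat_points_ideal n d (root_points n k \<xi>) \<subseteq> vanishing n k n d"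
proof
  fix p assume p: "p \<in> fat_points_ideal n d (root_points n k \<xi>)"
  then have pp: "p \<in> polys {0..n}" by (simp add: fat_points_ideal_def carrier_poly_ring)
  have "[:0, 1:] ^ d dvd line x y p"
    if x: "x 0 \<noteq> 0" "\<And>j. j \<in> {1..n} \<Longrightarrow> x j ^ k = x 0 ^ k" for x y
  proof -
    have "\<exists>s<k. x j / x 0 = \<xi> ^ s" if "j \<in> {1..n}" for j
      using x that by (intro primitive_root_exhaust[OF assms]) (simp add: power_divide)
    then obtain s where s: "\<And>j. j \<in> {1..n} \<Longrightarrow> s j < k \<and> x j / x 0 = \<xi> ^ s j" by metis
    define g where "g = restrict s {1..n}"
    define a where "a = (\<lambda>i. if i = 0 then 1 else \<xi> ^ g i)"
    have "s j \<le> k - 1" if "j \<in> {1..n}" for j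
      using conjunct1[OF s[OF that]] by linarith
    then have "g \<in> {1..n} \<rightarrow>\<^sub>E {0..k - 1}"
      by (intro PiE_I) (auto simp: g_def)
    then have "a \<in> root_points n k \<xi>"
      unfolding root_points_def a_def by (rule rev_image_eqI) simp
    then have "p \<in> point_ideal n a [^]\<^bsub>ideals_set (poly_ring n)\<^esub> d"
      using p by (auto simp: fat_points_ideal_def)
    then have "[:0, 1:] ^ d dvd line (\<lambda>i. x 0 * a i) y p"
      by (rule point_ideal_power_line)
    moreover have "line (\<lambda>i. x 0 * a i) y p = line x y p"
    proof (rule line_cong[OF pp])
      fix i assume "i \<in> {0..n}"
      then show "x 0 * a i = x i"
        using s[of i] x(1) by (cases "i = 0") (auto simp: a_def g_def field_simps)
    qed simp
    ultimately show ?thesis by simp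
  qed
  with pp show "p \<in> vanishing n k n d" by (simp add: vanishing_def)
qed

lemma binom_in_point_ideal:
  assumes "primitive_root_of_unity k \<xi>" "a \<in> root_points n k \<xi>" "j \<in> {1..n}"
  shows "binom k j \<in> point_ideal n a"
proof -
  obtain g where a: "a = (\<lambda>i. if i = 0 then 1 else \<xi> ^ g i)"
    using assms(2) by (auto simp: root_points_def)
  have "\<xi> ^ k = 1" using assms(1) by (simp add: primitive_root_of_unity_def)
  then have "a j ^ k = a 0 ^ k" using assms(3)
    by (simp add: a) (metis mult.commute power_mult power_one)
  then have "eval_mpoly a (binom k j) = 0"
    by (simp add: eval_mpoly_eq_line[where y = "\<lambda>_. 0"] binom_def)
  moreover have "\<exists>e. homogeneous e (binom k j)" using homogeneous_binom by blast
  ultimately show ?thesis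
    unfolding point_ideal_def using assms(3)
    by (intro subsetD[OF poly_ring.genideal_self]) (auto simp: carrier_poly_ring)
qed

text \<open>The recursion of \<open>pow_ideal\<close> splits off one factor
  \<open>binom k (Suc m)\<close> at a time; \<open>h\<close> collects the factors already split off,
  so that the claim survives the induction. It is used with \<open>h = 1\<close>.\<close>

lemma pow_ideal_subset_ideal:
  assumes K: "ideal K (poly_ring n)"
  shows "m \<le> n \<Longrightarrow> h \<in> polys {0..n} \<Longrightarrow>
    (\<And>a. (\<Sum>j\<in>{1..m}. a j) = d \<Longrightarrow> h * (\<Prod>j\<in>{1..m}. binom k j ^ a j) \<in> K) \<Longrightarrow>
    p \<in> pow_ideal n k m d \<Longrightarrow> h * p \<in> K"
proof (induction m arbitrary: d h p)
  case 0
  show ?case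
  proof (cases d)
    case 0
    then have "h \<in> K" using "0.prems"(3)[of "\<lambda>_. 0"] by simp
    then show ?thesis using "0.prems"(4) 0 poly_ring_idealD(4)[OF K, of p h]
      by (simp add: mult.commute)
  next
    case (Suc d')
    then show ?thesis using "0.prems"(4) poly_ring_idealD(2)[OF K] by simp
  qed
next
  case (Suc m)
  have split: "{1..Suc m} = insert (Suc m) {1..m}" by auto
  note IH = Suc.IH
  show ?case
    using Suc.prems
  proof (induction d arbitrary: h p)
    case 0
    then have "h \<in> K" using "0.prems"(3)[of "\<lambda>_. 0"] by simp
    then show ?case using "0.prems"(4) poly_ring_idealD(4)[OF K, of p h]
      by (simp add: mult.commute)
  next
    case (Suc d)
    obtain u w where u: "u \<in> pow_ideal n k m (Suc d)" and w: "w \<in> pow_ideal n k (Suc m) d"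
      and p: "p = u + binom k (Suc m) * w" using Suc.prems(4) by auto
    have "h * u \<in> K"
    proof (rule IH[OF _ Suc.prems(2) _ u])
      fix a assume a: "(\<Sum>j\<in>{1..m}. a j) = Suc d"
      \<comment> \<open>The exponent at \<open>Suc m\<close> is unconstrained by the sum over
        \<open>{1..m}\<close> and is set to 0 to obtain an exponent vector of the longer
        product.\<close>
      let ?a = "a(Suc m := 0)"
      have "(\<Sum>j\<in>{1..m}. ?a j) = Suc d"
        "(\<Prod>j\<in>{1..m}. binom k j ^ ?a j) = (\<Prod>j\<in>{1..m}. binom k j ^ a j)"
        using a by (auto intro!: sum.cong prod.cong)
      then show "h * (\<Prod>j\<in>{1..m}. binom k j ^ a j) \<in> K"
        using Suc.prems(3)[of ?a] unfolding split by simp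
    qed (use Suc.prems in simp)
    moreover have "(h * binom k (Suc m)) * w \<in> K"
    proof (rule Suc.IH[OF Suc.prems(1) _ _ w])
      show "h * binom k (Suc m) \<in> polys {0..n}" using Suc.prems by simp
      fix a assume a: "(\<Sum>j\<in>{1..Suc m}. a j) = d"
      let ?a = "a(Suc m := Suc (a (Suc m)))"
      have "(\<Sum>j\<in>{1..m}. ?a j) = (\<Sum>j\<in>{1..m}. a j)"
        "(\<Prod>j\<in>{1..m}. binom k j ^ ?a j) = (\<Prod>j\<in>{1..m}. binom k j ^ a j)"
        by (auto intro!: sum.cong prod.cong)
      then show "h * binom k (Suc m) * (\<Prod>j\<in>{1..Suc m}. binom k j ^ a j) \<in> K"
        using Suc.prems(3)[of ?a] a unfolding split by (simp add: mult_ac)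
    qed
    ultimately show ?case
      using poly_ring_idealD(3)[OF K] by (simp add: p distrib_left mult.assoc)
  qed
qed

text \<open>The three ideals are arranged in a cycle of inclusions: fat points in
  \<open>pow_ideal\<close> by vanishing orders, \<open>pow_ideal\<close> in the ideal generated by
  the products, and each product in the \<open>d\<close>-th power of every point ideal.\<close>

theorem fat_points_ideal_eq:
  assumes \<xi>: "primitive_root_of_unity k \<xi>"
  shows "fat_points_ideal n d (root_points n k \<xi>) = pow_ideal n k n d"
    and "pow_ideal n k n d =
      Idl\<^bsub>poly_ring n\<^esub> {\<Prod>j\<in>{1..n}. binom k j ^ a j | a. (\<Sum>j\<in>{1..n}. a j) = d}"
proof -
  let ?G = "{\<Prod>j\<in>{1..n}. binom k j ^ a j | a. (\<Sum>j\<in>{1..n}. a j) = d}"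
  let ?F = "fat_points_ideal n d (root_points n k \<xi>)"
  have G: "?G \<subseteq> polys {0..n}" by (auto intro!: polys_prod polys_power binom_polys)
  have "?F \<subseteq> pow_ideal n k n d"
    using fat_points_subset_vanishing[OF \<xi>] pow_ideal_eq_vanishing[OF \<xi>] by simp
  moreover have "pow_ideal n k n d \<subseteq> Idl\<^bsub>poly_ring n\<^esub> ?G"
  proof
    fix p assume p: "p \<in> pow_ideal n k n d"
    have "1 * p \<in> Idl\<^bsub>poly_ring n\<^esub> ?G"
    proof (rule pow_ideal_subset_ideal[OF poly_ring.genideal_ideal order_refl _ _ p])
      fix a assume "(\<Sum>j\<in>{1..n}. a j) = d"
      then have "(\<Prod>j\<in>{1..n}. binom k j ^ a j) \<in> ?G" by blast
      then show "1 * (\<Prod>j\<in>{1..n}. binom k j ^ a j) \<in> Idl\<^bsub>poly_ring n\<^esub> ?G"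
        using subsetD[OF poly_ring.genideal_self[of ?G n]] G by (simp add: carrier_poly_ring)
    qed (use G in \<open>auto simp: carrier_poly_ring\<close>)
    then show "p \<in> Idl\<^bsub>poly_ring n\<^esub> ?G" by simp
  qed
  moreover have "Idl\<^bsub>poly_ring n\<^esub> ?G \<subseteq> ?F"
  proof (rule poly_ring.genideal_minimal)
    note D = poly_ring_idealD[OF ideal_power_ideal[OF point_ideal_ideal]]
    show "ideal ?F (poly_ring n)"
      by (rule poly_ring_idealI)
        (auto simp: fat_points_ideal_def carrier_poly_ring intro: D)
    have "g \<in> ?F" if g: "g \<in> ?G" for g
    proof -
      obtain a where a: "g = (\<Prod>j\<in>{1..n}. binom k j ^ a j)" "(\<Sum>j\<in>{1..n}. a j) = d"
        using g by blast
      have "g \<in> point_ideal n P [^]\<^bsub>ideals_set (poly_ring n)\<^esub> d" if "P \<in> root_points n k \<xi>" for P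
        using prod_power_in_ideal_power[OF point_ideal_ideal[of n P], of "{1..n}" "binom k" a]
          binom_in_point_ideal[OF \<xi> that] a by simp
      then show ?thesis using G g by (auto simp: fat_points_ideal_def carrier_poly_ring)
    qed
    then show "?G \<subseteq> ?F" by blast
  qed
  ultimately show "?F = pow_ideal n k n d" "pow_ideal n k n d = Idl\<^bsub>poly_ring n\<^esub> ?G"
    by auto
qed


section \<open>Linear resolutions\<close>

text \<open>Vectors over the polynomial ring are functions on \<^typ>\<open>nat\<close>; the elements of \<open>S\<^sup>r\<close> are those
  supported on \<open>{..<r}\<close>.\<close>

definition comb :: "nat \<Rightarrow> (nat \<Rightarrow> nat \<Rightarrow> mpoly) \<Rightarrow> (nat \<Rightarrow> mpoly) \<Rightarrow> nat \<Rightarrow> mpoly" where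
  "comb r g v = (\<lambda>j. \<Sum>c<r. v c * g c j)"

definition fvecs :: "nat \<Rightarrow> nat \<Rightarrow> (nat \<Rightarrow> mpoly) set" where
  "fvecs n r = {v. (\<forall>c. v c \<in> polys {0..n}) \<and> (\<forall>c\<ge>r. v c = 0)}"

definition syz :: "nat \<Rightarrow> nat \<Rightarrow> (nat \<Rightarrow> nat \<Rightarrow> mpoly) \<Rightarrow> (nat \<Rightarrow> mpoly) set" where
  "syz n r g = {v \<in> fvecs n r. comb r g v = (\<lambda>_. 0)}"

definition hom_vec :: "int \<Rightarrow> (nat \<Rightarrow> mpoly) \<Rightarrow> bool" where
  "hom_vec h v \<longleftrightarrow> (\<forall>j. homogeneous h (v j))"

text \<open>\<open>lin_res n k N M h rs\<close>: the module \<open>M\<close> has a resolution of length at most \<open>N\<close> with ranks \<open>rs\<close>,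
  whose first map has entries homogeneous of degree \<open>h\<close> and whose other maps have entries
  homogeneous of degree \<open>k\<close>.\<close>

primrec lin_res :: "nat \<Rightarrow> int \<Rightarrow> nat \<Rightarrow> (nat \<Rightarrow> mpoly) set \<Rightarrow> int \<Rightarrow> (nat \<Rightarrow> nat) \<Rightarrow> bool" where
  "lin_res n k 0 M h rs \<longleftrightarrow> M = {\<lambda>_. 0}"
| "lin_res n k (Suc N) M h rs \<longleftrightarrow> (\<exists>g. (\<forall>c<rs 0. (\<forall>j. g c j \<in> polys {0..n}) \<and> hom_vec h (g c)) \<and>
     M = comb (rs 0) g ` fvecs n (rs 0) \<and> lin_res n k N (syz n (rs 0) g) k (\<lambda>i. rs (Suc i)))"

text \<open>In the function encoding of free modules this is the pair (u, w) in the direct sum of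
  rank \<open>a\<close> and the rest; \<open>vshift a\<close> is the projection to the second
  summand. Since \<open>comb a\<close> reads only indices below \<open>a\<close>, the first summand
  can be used untruncated.\<close>

definition vappend :: "nat \<Rightarrow> (nat \<Rightarrow> 'a) \<Rightarrow> (nat \<Rightarrow> 'a) \<Rightarrow> nat \<Rightarrow> 'a" where
  "vappend a u w = (\<lambda>c. if c < a then u c else w (c - a))"

definition vshift :: "nat \<Rightarrow> (nat \<Rightarrow> 'a) \<Rightarrow> nat \<Rightarrow> 'a" where
  "vshift a v = (\<lambda>c. v (c + a))"

lemma shift_append [simp]: "vshift a (vappend a u w) = w"
  by (simp add: vshift_def vappend_def)

lemma append_shift [simp]: "vappend a v (vshift a v) = v"
  by (auto simp: vshift_def vappend_def)

lemma comb_0 [simp]: "comb 0 g v = (\<lambda>_. 0)"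
  by (simp add: comb_def)

lemma comb_Suc: "comb (Suc r) g v = (\<lambda>j. comb r g v j + v r * g r j)"
  by (simp add: comb_def)

lemma comb_cong:
  "(\<And>c. c < r \<Longrightarrow> g c = g' c) \<Longrightarrow> (\<And>c. c < r \<Longrightarrow> v c = v' c) \<Longrightarrow> comb r g v = comb r g' v'"
  by (simp add: comb_def cong: sum.cong_simp)

lemma comb_append:
  "comb (a + b) (vappend a g g') v = (\<lambda>j. comb a g v j + comb b g' (vshift a v) j)"
proof (induction b)
  case 0
  have "comb a (vappend a g g') v = comb a g v"
    by (rule comb_cong) (simp_all add: vappend_def)
  then show ?case by simp
next
  case (Suc b)
  then show ?case by (simp add: comb_Suc vappend_def vshift_def add_ac)
qed

lemma comb_append_left [simp]: "comb a g (vappend a u w) = comb a g u"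
  by (rule comb_cong) (simp_all add: vappend_def)

lemma comb_scale: "comb r (\<lambda>c j. p * g c j) v = (\<lambda>j. p * comb r g v j)"
  by (simp add: comb_def sum_distrib_left mult_ac)

lemma comb_zero_gens: "(\<And>c. c < r \<Longrightarrow> g c = (\<lambda>_. 0)) \<Longrightarrow> comb r g v = (\<lambda>_. 0)"
  by (simp add: comb_def)

lemma comb_unit: "c < r \<Longrightarrow> comb r g (\<lambda>i. if i = c then 1 else 0) = g c"
  by (simp add: comb_def if_distrib[of "\<lambda>x. x * _"] cong: if_cong)

lemma unit_fvecs: "c < r \<Longrightarrow> (\<lambda>i. if i = c then 1 else 0) \<in> fvecs n r"
  by (simp add: fvecs_def)

lemma gens_mem: "c < r \<Longrightarrow> g c \<in> comb r g ` fvecs n r"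
  using comb_unit[of c r g] unit_fvecs[of c r n] by (metis image_eqI)

lemma fvecs_polys: "v \<in> fvecs n r \<Longrightarrow> v c \<in> polys {0..n}"
  by (simp add: fvecs_def)

lemma append_fvecs: "u \<in> fvecs n a \<Longrightarrow> w \<in> fvecs n b \<Longrightarrow> vappend a u w \<in> fvecs n (a + b)"
  by (simp add: fvecs_def vappend_def)

lemma shift_fvecs: "v \<in> fvecs n (a + b) \<Longrightarrow> vshift a v \<in> fvecs n b"
  by (simp add: fvecs_def vshift_def)

lemma trunc_fvecs: "v \<in> fvecs n r \<Longrightarrow> vappend a v (\<lambda>_. 0) \<in> fvecs n a"
  by (simp add: fvecs_def vappend_def)

lemma zero_fvecs [simp]: "(\<lambda>_. 0) \<in> fvecs n r"
  by (simp add: fvecs_def)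

lemma fvecs_0 [simp]: "fvecs n 0 = {\<lambda>_. 0}"
  by (auto simp: fvecs_def)

lemma comb_mem_image: "v \<in> fvecs n s \<Longrightarrow> comb r g v \<in> comb r g ` fvecs n r"
  by (rule rev_image_eqI[OF trunc_fvecs]) simp_all

lemma hom_vec_append: "hom_vec h u \<Longrightarrow> hom_vec h w \<Longrightarrow> hom_vec h (vappend a u w)"
  by (simp add: hom_vec_def vappend_def)

lemma hom_vec_zero [simp]: "hom_vec h (\<lambda>_. 0)"
  by (simp add: hom_vec_def)

lemma hom_vec_comb:
  assumes "hom_vec k v" "\<And>c. c < r \<Longrightarrow> hom_vec h (g c)"
  shows "hom_vec (k + h) (comb r g v)"
  using assms by (auto simp: hom_vec_def comb_def intro!: homogeneous_sum homogeneous_mult)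

text \<open>Taking the components of degree \<open>k\<close> of arbitrary coefficients suffices,
  because all generators have the same degree \<open>h\<close>.\<close>

lemma hom_vec_lift:
  assumes z: "z \<in> comb r g ` fvecs n r" "hom_vec (k + h) z"
    and g: "\<And>c. c < r \<Longrightarrow> hom_vec h (g c)"
  obtains v where "v \<in> fvecs n r" "hom_vec k v" "comb r g v = z"
proof -
  obtain u where u: "u \<in> fvecs n r" "z = comb r g u" using z by blast
  let ?v = "\<lambda>c. hom_part k (u c)"
  have "comb r g ?v j = z j" for j
  proof -
    have "hom_part (k + h) (z j) = (\<Sum>c<r. hom_part (k + h) (u c * g c j))"
      by (simp add: u comb_def hom_part_sum)
    also have "\<dots> = (\<Sum>c<r. hom_part k (u c) * g c j)"
      by (rule sum.cong) (use g in \<open>auto simp: hom_vec_def hom_part_mult[where h = h]\<close>)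
    finally show ?thesis
      using z(2) by (simp add: hom_vec_def hom_part_homogeneous comb_def)
  qed
  then show ?thesis using u by (intro that[of ?v]) (auto simp: fvecs_def hom_vec_def)
qed

section \<open>Submodules, linear maps and the horseshoe lemma\<close>

definition submod :: "nat \<Rightarrow> (nat \<Rightarrow> mpoly) set \<Rightarrow> bool" where
  "submod n M \<longleftrightarrow> (\<lambda>_. 0) \<in> M \<and> (\<forall>x\<in>M. \<forall>y\<in>M. (\<lambda>j. x j + y j) \<in> M) \<and>
     (\<forall>p\<in>polys {0..n}. \<forall>x\<in>M. (\<lambda>j. p * x j) \<in> M)"

definition linear_on :: "nat \<Rightarrow> (nat \<Rightarrow> mpoly) set \<Rightarrow> ((nat \<Rightarrow> mpoly) \<Rightarrow> nat \<Rightarrow> mpoly) \<Rightarrow> bool" where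
  "linear_on n M \<pi> \<longleftrightarrow> (\<forall>x\<in>M. \<forall>y\<in>M. \<pi> (\<lambda>j. x j + y j) = (\<lambda>j. \<pi> x j + \<pi> y j)) \<and>
     (\<forall>p\<in>polys {0..n}. \<forall>x\<in>M. \<pi> (\<lambda>j. p * x j) = (\<lambda>j. p * \<pi> x j))"

lemma submodD:
  assumes "submod n M"
  shows "(\<lambda>_. 0) \<in> M" "x \<in> M \<Longrightarrow> y \<in> M \<Longrightarrow> (\<lambda>j. x j + y j) \<in> M"
    "p \<in> polys {0..n} \<Longrightarrow> x \<in> M \<Longrightarrow> (\<lambda>j. p * x j) \<in> M"
    "x \<in> M \<Longrightarrow> (\<lambda>j. - x j) \<in> M"
proof -
  show *: "(\<lambda>_. 0) \<in> M" "x \<in> M \<Longrightarrow> y \<in> M \<Longrightarrow> (\<lambda>j. x j + y j) \<in> M"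
    "p \<in> polys {0..n} \<Longrightarrow> x \<in> M \<Longrightarrow> (\<lambda>j. p * x j) \<in> M" for p
    using assms by (simp_all add: submod_def)
  show "x \<in> M \<Longrightarrow> (\<lambda>j. - x j) \<in> M" using *(3)[of "- 1"] by simp
qed

lemma linear_onD:
  assumes "linear_on n M \<pi>" "submod n M"
  shows "\<pi> (\<lambda>_. 0) = (\<lambda>_. 0)"
    "x \<in> M \<Longrightarrow> y \<in> M \<Longrightarrow> \<pi> (\<lambda>j. x j + y j) = (\<lambda>j. \<pi> x j + \<pi> y j)"
    "p \<in> polys {0..n} \<Longrightarrow> x \<in> M \<Longrightarrow> \<pi> (\<lambda>j. p * x j) = (\<lambda>j. p * \<pi> x j)"
    "x \<in> M \<Longrightarrow> \<pi> (\<lambda>j. - x j) = (\<lambda>j. - \<pi> x j)"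
proof -
  show *: "x \<in> M \<Longrightarrow> y \<in> M \<Longrightarrow> \<pi> (\<lambda>j. x j + y j) = (\<lambda>j. \<pi> x j + \<pi> y j)"
    "p \<in> polys {0..n} \<Longrightarrow> x \<in> M \<Longrightarrow> \<pi> (\<lambda>j. p * x j) = (\<lambda>j. p * \<pi> x j)" for p x
    using assms(1) by (simp_all add: linear_on_def)
  show "x \<in> M \<Longrightarrow> \<pi> (\<lambda>j. - x j) = (\<lambda>j. - \<pi> x j)" using *(2)[of "- 1" x] by simp
  show "\<pi> (\<lambda>_. 0) = (\<lambda>_. 0)" using *(2)[of 0 "\<lambda>_. 0"] submodD(1)[OF assms(2)] by simp
qed

lemma comb_mem:
  assumes "submod n M" "\<And>c. c < r \<Longrightarrow> g c \<in> M" "\<And>c. v c \<in> polys {0..n}"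
  shows "comb r g v \<in> M"
  using assms(2) by (induction r) (simp_all add: comb_Suc submodD[OF assms(1)] assms(3))

lemma linear_on_comb:
  assumes M: "submod n M" and \<pi>: "linear_on n M \<pi>"
    and "\<And>c. c < r \<Longrightarrow> g c \<in> M" and v: "\<And>c. v c \<in> polys {0..n}"
  shows "\<pi> (comb r g v) = comb r (\<lambda>c. \<pi> (g c)) v"
  using assms(3)
proof (induction r)
  case (Suc r)
  have "comb r g v \<in> M" by (rule comb_mem[OF M]) (use Suc.prems v in auto)
  then show ?case using Suc v
    by (simp add: comb_Suc linear_onD[OF \<pi> M] submodD[OF M])
qed (simp add: linear_onD[OF \<pi> M])

lemma comb_add: "comb r g (\<lambda>c. v c + w c) = (\<lambda>j. comb r g v j + comb r g w j)"
  by (simp add: comb_def distrib_right sum.distrib)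

lemma comb_mult: "comb r g (\<lambda>c. p * v c) = (\<lambda>j. p * comb r g v j)"
  by (simp add: comb_def sum_distrib_left mult_ac)

lemma submod_syz: "submod n (syz n r g)"
  unfolding submod_def
proof (intro conjI ballI)
  show "(\<lambda>_. 0) \<in> syz n r g" by (simp add: syz_def comb_def)
  show "(\<lambda>j. x j + y j) \<in> syz n r g" if "x \<in> syz n r g" "y \<in> syz n r g" for x y
    using that by (simp add: syz_def comb_add fvecs_def)
  show "(\<lambda>j. p * x j) \<in> syz n r g" if "p \<in> polys {0..n}" "x \<in> syz n r g" for p x
    using that by (simp add: syz_def comb_mult fvecs_def)
qed

lemma linear_on_shift: "linear_on n M (vshift a)"
  by (simp add: linear_on_def vshift_def)

lemma syzD: "v \<in> syz n r g \<Longrightarrow> v \<in> fvecs n r" "v \<in> syz n r g \<Longrightarrow> comb r g v = (\<lambda>_. 0)"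
  by (simp_all add: syz_def)

lemma fvecs_append_zero: "vshift a x = (\<lambda>_. 0) \<Longrightarrow> vappend a x (\<lambda>_. 0) = x"
  by (metis append_shift)

text \<open>The horseshoe lemma for an exact sequence \<open>0 \<rightarrow> M' \<rightarrow> M \<rightarrow> M'' \<rightarrow> 0\<close>. The generators of \<open>M\<close> are those
  of \<open>M'\<close> followed by lifts of those of \<open>M''\<close>, and the syzygy modules form an exact sequence again.\<close>

lemma horseshoe:
  assumes "lin_res n k N M' h r'" "lin_res n k N M'' h'' r''"
    and "submod n M" "linear_on n M \<pi>"
    and "M' = {x \<in> M. \<pi> x = (\<lambda>_. 0)}"
    and "\<And>x. x \<in> M \<Longrightarrow> \<pi> x \<in> M''"
    and "\<And>z. z \<in> M'' \<Longrightarrow> hom_vec h'' z \<Longrightarrow> \<exists>x\<in>M. hom_vec h x \<and> \<pi> x = z"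
    and "\<And>x j. x \<in> M \<Longrightarrow> x j \<in> polys {0..n}"
  shows "lin_res n k N M h (\<lambda>i. r' i + r'' i)"
  using assms
proof (induction N arbitrary: M' h r' M'' h'' r'' M \<pi>)
  case 0
  then show ?case using submodD(1)[of n M] by auto
next
  case (Suc N)
  note M = Suc.prems(3) and \<pi> = Suc.prems(4) and M' = Suc.prems(5) and img = Suc.prems(6)
    and lift = Suc.prems(7) and polysM = Suc.prems(8)
  let ?a = "r' 0" and ?b = "r'' 0"
  obtain g' where g': "\<And>c. c < ?a \<Longrightarrow> hom_vec h (g' c)"
    and M'g: "M' = comb ?a g' ` fvecs n ?a" and res': "lin_res n k N (syz n ?a g') k (\<lambda>i. r' (Suc i))"
    using Suc.prems(1) by auto
  obtain g'' where g'': "\<And>c. c < ?b \<Longrightarrow> hom_vec h'' (g'' c)"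
    and M''g: "M'' = comb ?b g'' ` fvecs n ?b" and res'': "lin_res n k N (syz n ?b g'') k (\<lambda>i. r'' (Suc i))"
    using Suc.prems(2) by auto
  \<comment> \<open>The map \<open>\<pi>\<close> may shift degrees: generators of degree
    \<open>h''\<close> are lifted to degree \<open>h\<close>, so all generators of \<open>M\<close>
    end up in one degree.\<close>
  have "\<exists>x\<in>M. hom_vec h x \<and> \<pi> x = g'' c" if "c < ?b" for c
    using that by (intro lift g'') (simp_all add: M''g gens_mem)
  then obtain t where t: "\<And>c. c < ?b \<Longrightarrow> t c \<in> M" "\<And>c. c < ?b \<Longrightarrow> hom_vec h (t c)"
    "\<And>c. c < ?b \<Longrightarrow> \<pi> (t c) = g'' c" by metis
  have g'M: "g' c \<in> M" "\<pi> (g' c) = (\<lambda>_. 0)" if "c < ?a" for c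
    using gens_mem[OF that, of g' n] M' M'g by auto
  let ?g = "vappend ?a g' t"
  have g: "?g c \<in> M" "hom_vec h (?g c)" if "c < ?a + ?b" for c
    using that g'M t g' by (simp_all add: vappend_def)
  have \<pi>t: "\<pi> (comb ?b t w) = comb ?b g'' w" if "\<And>c. w c \<in> polys {0..n}" for w
    using linear_on_comb[OF M \<pi>, of ?b t w] t that comb_cong[of ?b "\<lambda>c. \<pi> (t c)" g'' w w] by simp
  have \<pi>g': "\<pi> (comb ?a g' w) = (\<lambda>_. 0)" if "\<And>c. w c \<in> polys {0..n}" for w
    using linear_on_comb[OF M \<pi>, of ?a g' w] g'M that comb_zero_gens[of ?a "\<lambda>c. \<pi> (g' c)" w] by simp
  have "M \<subseteq> comb (?a + ?b) ?g ` fvecs n (?a + ?b)"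
  proof
    fix x assume x: "x \<in> M"
    then obtain w where w: "w \<in> fvecs n ?b" "\<pi> x = comb ?b g'' w" using img M''g by blast
    let ?y = "\<lambda>j. - comb ?b t w j"
    have tw: "comb ?b t w \<in> M" by (rule comb_mem[OF M]) (use t w fvecs_polys in auto)
    have y: "?y \<in> M" by (rule submodD(4)[OF M tw])
    have "\<pi> (\<lambda>j. x j + ?y j) = (\<lambda>_. 0)"
      unfolding linear_onD(2)[OF \<pi> M x y] linear_onD(4)[OF \<pi> M tw]
      using w \<pi>t[of w, OF fvecs_polys[OF w(1)]] by simp
    then have "(\<lambda>j. x j + ?y j) \<in> M'"
      using submodD(2)[OF M x y] M' by simp
    then obtain u where u: "u \<in> fvecs n ?a" "(\<lambda>j. x j + ?y j) = comb ?a g' u" using M'g by blast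
    have "x = comb (?a + ?b) ?g (vappend ?a u w)"
      unfolding comb_append by (simp add: u(2) [symmetric])
    then show "x \<in> comb (?a + ?b) ?g ` fvecs n (?a + ?b)"
      using append_fvecs[OF u(1) w(1)] by blast
  qed
  moreover have "comb (?a + ?b) ?g ` fvecs n (?a + ?b) \<subseteq> M"
  proof (rule image_subsetI)
    fix v assume "v \<in> fvecs n (?a + ?b)"
    then show "comb (?a + ?b) ?g v \<in> M"
      by (intro comb_mem[OF M g(1)] fvecs_polys)
  qed
  moreover have "lin_res n k N (syz n (?a + ?b) ?g) k (\<lambda>i. r' (Suc i) + r'' (Suc i))"
  \<comment> \<open>The three syzygy modules form a short exact sequence with projection
    \<open>vshift\<close>, and from here on the degree is \<open>k\<close> on both sides.\<close>
  proof (rule Suc.IH[OF res' res'' submod_syz linear_on_shift])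
    show "syz n ?a g' = {x \<in> syz n (?a + ?b) ?g. vshift ?a x = (\<lambda>_. 0)}"
    proof (intro Set.set_eqI iffI)
      fix x assume x: "x \<in> syz n ?a g'"
      then have "vshift ?a x = (\<lambda>_. 0)" by (simp add: syz_def fvecs_def vshift_def)
      with x show "x \<in> {x \<in> syz n (?a + ?b) ?g. vshift ?a x = (\<lambda>_. 0)}"
        by (simp add: syz_def comb_append) (simp add: fvecs_def comb_def)
    next
      fix x assume "x \<in> {x \<in> syz n (?a + ?b) ?g. vshift ?a x = (\<lambda>_. 0)}"
      then have x: "x \<in> syz n (?a + ?b) ?g" "vshift ?a x = (\<lambda>_. 0)" by auto
      have "x \<in> fvecs n ?a"
        using trunc_fvecs[OF syzD(1)[OF x(1)], of ?a] by (simp add: fvecs_append_zero[OF x(2)])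
      then show "x \<in> syz n ?a g'"
        using syzD(2)[OF x(1)] by (simp add: syz_def comb_append x(2)) (simp add: comb_def)
    qed
  next
    fix x assume x: "x \<in> syz n (?a + ?b) ?g"
    note xp = fvecs_polys[OF syzD(1)[OF x]]
    then have sp: "vshift ?a x c \<in> polys {0..n}" for c by (simp add: vshift_def)
    have gx: "comb ?a g' x \<in> M" by (rule comb_mem[OF M]) (use g'M xp in auto)
    have "(\<lambda>j. comb ?a g' x j + comb ?b t (vshift ?a x) j) = (\<lambda>_. 0)"
      using syzD(2)[OF x] by (simp add: comb_append)
    then have "comb ?b t (vshift ?a x) = (\<lambda>j. - comb ?a g' x j)"
      by (auto simp: fun_eq_iff add_eq_0_iff)
    then have "comb ?b g'' (vshift ?a x) = (\<lambda>_. 0)"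
      using \<pi>t[of "vshift ?a x", OF sp] linear_onD(4)[OF \<pi> M gx] \<pi>g'[of x, OF xp] by simp
    then show "vshift ?a x \<in> syz n ?b g''"
      using shift_fvecs[OF syzD(1)[OF x]] by (simp add: syz_def)
  next
    fix w assume w: "w \<in> syz n ?b g''" "hom_vec k w"
    note wp = fvecs_polys[OF syzD(1)[OF w(1)]]
    \<comment> \<open>The first component of a lift of \<open>w\<close> has to cancel the
      combination of the \<open>t c\<close>. As \<open>w\<close> is a syzygy of \<open>g''\<close>,
      this combination lies in the kernel of \<open>\<pi>\<close>, which \<open>g'\<close>
      generates; its degree \<open>k + h\<close> permits coefficients of degree
      \<open>k\<close>.\<close>
    let ?z = "\<lambda>j. - comb ?b t w j"
    have tw: "comb ?b t w \<in> M" by (rule comb_mem[OF M]) (use t wp in auto)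
    have "\<pi> ?z = (\<lambda>_. 0)"
      using linear_onD(4)[OF \<pi> M tw] \<pi>t[of w, OF wp] syzD(2)[OF w(1)] by simp
    then have "?z \<in> comb ?a g' ` fvecs n ?a"
      using submodD(4)[OF M tw] M' M'g by simp
    moreover have "hom_vec (k + h) ?z"
      using hom_vec_comb[OF w(2) t(2)] by (simp add: hom_vec_def)
    ultimately obtain u where u: "u \<in> fvecs n ?a" "hom_vec k u" "comb ?a g' u = ?z"
      by (rule hom_vec_lift[OF _ _ g'])
    show "\<exists>x\<in>syz n (?a + ?b) ?g. hom_vec k x \<and> vshift ?a x = w"
      by (rule bexI[of _ "vappend ?a u w"])
        (simp_all add: hom_vec_append syz_def comb_append u w append_fvecs[OF u(1) syzD(1)[OF w(1)]])
  next
    show "x j \<in> polys {0..n}" if "x \<in> syz n (?a + ?b) ?g" for x j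
      using that by (rule fvecs_polys[OF syzD(1)])
  qed
  ultimately show ?case
    using g polysM by (intro lin_res.simps(2)[THEN iffD2] exI[of _ ?g]) auto
qed


lemma lin_res_zero: "lin_res n k N {\<lambda>_. 0} h (\<lambda>_. 0)"
proof (induction N arbitrary: h)
  case (Suc N)
  have "syz n 0 g = {\<lambda>_. 0}" for g by (auto simp: syz_def)
  then show ?case using Suc by simp
qed simp

lemma linear_on_comb_shift: "linear_on n M (\<lambda>v. comb r g (vshift a v))"
  using comb_add[of r g] comb_mult[of r g] by (simp add: linear_on_def vshift_def)

text \<open>The direct sum of two syzygy modules is a split extension, so the horseshoe lemma
  applies with the lift that has first component zero.\<close>

lemma lin_res_syz_product:
  assumes "lin_res n k N (syz n a g) k r'" "lin_res n k N (syz n b g') k r''"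
  shows "lin_res n k N {v \<in> fvecs n (a + b). comb a g v = (\<lambda>_. 0) \<and> comb b g' (vshift a v) = (\<lambda>_. 0)}
    k (\<lambda>i. r' i + r'' i)" (is "lin_res n k N ?M k _")
proof (rule horseshoe[OF assms _ linear_on_shift[of n _ a]])
  show "submod n ?M"
    using comb_add[of a g] comb_mult[of a g] comb_add[of b g'] comb_mult[of b g']
    by (auto simp: submod_def vshift_def fvecs_def) (simp_all add: comb_def)
  show "syz n a g = {x \<in> ?M. vshift a x = (\<lambda>_. 0)}"
  proof (intro Set.set_eqI iffI)
    fix x assume x: "x \<in> syz n a g"
    then have "vshift a x = (\<lambda>_. 0)" by (simp add: syz_def fvecs_def vshift_def)
    with x show "x \<in> {x \<in> ?M. vshift a x = (\<lambda>_. 0)}"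
      by (simp add: syz_def) (simp add: fvecs_def comb_def)
  next
    fix x assume x: "x \<in> {x \<in> ?M. vshift a x = (\<lambda>_. 0)}"
    then have "x \<in> fvecs n a"
      using trunc_fvecs[of x n "a + b" a] by (simp add: fvecs_append_zero)
    with x show "x \<in> syz n a g" by (simp add: syz_def)
  qed
  show "vshift a x \<in> syz n b g'" if "x \<in> ?M" for x
    using that shift_fvecs[of x n a b] by (simp add: syz_def)
  show "\<exists>x\<in>?M. hom_vec k x \<and> vshift a x = z" if "z \<in> syz n b g'" "hom_vec k z" for z
  proof (rule bexI[of _ "vappend a (\<lambda>_. 0) z"])
    have "comb a g (\<lambda>_. 0) = (\<lambda>_. 0)" by (simp add: comb_def)
    then show "vappend a (\<lambda>_. 0) z \<in> ?M"
      using that append_fvecs[of "\<lambda>_. 0" n a z b] by (simp add: syz_def)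
  qed (use that in \<open>simp add: hom_vec_append\<close>)
  show "x j \<in> polys {0..n}" if "x \<in> ?M" for x j
    using that by (auto simp: fvecs_def)
qed


section \<open>The resolution of a power of the complete intersection ideal\<close>

text \<open>Coordinate \<open>Suc m\<close> of the base point is not constrained by the first
  \<open>m\<close> equations. Away from finitely many of its values \<open>binom k (Suc m)\<close>
  is nonzero at the base point and can be cancelled without losing an order; continuity does the
  rest.\<close>

lemma vanishing_binom_regular:
  assumes "Suc m \<le> n" "k > 0" "b \<in> polys {0..n}" "binom k (Suc m) * b \<in> vanishing n k m d"
  shows "b \<in> vanishing n k m d"
proof -
  have "coeff (line x y b) e = 0"
    if x: "x 0 \<noteq> 0" "\<And>j. j \<in> {1..m} \<Longrightarrow> x j ^ k = x 0 ^ k" and e: "e < d" for x y e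
  proof -
    have "finite {z::complex. z ^ k = x 0 ^ k}" using \<open>k > 0\<close> by (rule finite_nth_roots)
    moreover have "coeff (line (x(Suc m := s)) y b) e = 0" if "s \<notin> {z. z ^ k = x 0 ^ k}" for s
    proof -
      let ?x = "x(Suc m := s)"
      have "[:0, 1:] ^ d dvd line ?x y (binom k (Suc m)) * line ?x y b"
        unfolding line_mult [symmetric] by (rule vanishingD[OF assms(4)]) (use x in auto)
      moreover have "coeff (line ?x y (binom k (Suc m))) 0 \<noteq> 0"
        using that by (simp add: binom_def coeff_0_power)
      ultimately have "[:0, 1:] ^ d dvd line ?x y b" by (rule X_pow_dvd_mult_cancel)
      then show ?thesis using e unfolding X_pow_dvd_iff by simp
    qed
    ultimately have "coeff (line (x(Suc m := s)) y b) e = 0" for s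
      by (rule continuous_eq_0[rotated 1])
        (auto intro!: continuous_coeff_line continuous_on_fun_upd simp del: fun_upd_apply)
    from this[of "x (Suc m)"] show ?thesis by simp
  qed
  then show ?thesis using assms(3) by (simp add: vanishing_def X_pow_dvd_iff)
qed

text \<open>The ranks forced by the resolution step: the two summands of the ideal contribute in the
  same place, while \<open>J(m, d+1)\<close> occurs once more as a quotient of the syzygy module and
  is therefore shifted by one. The index counts from the generators of the ideal, one less than for
  the quotient ring.\<close>

fun res_rank :: "nat \<Rightarrow> nat \<Rightarrow> nat \<Rightarrow> nat" where
  "res_rank m 0 i = (if i = 0 then 1 else 0)"
| "res_rank 0 (Suc d) i = 0"
| "res_rank (Suc m) (Suc d) i = res_rank m (Suc d) i + res_rank (Suc m) d i +
     (case i of 0 \<Rightarrow> 0 | Suc i' \<Rightarrow> res_rank m (Suc d) i')"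

text \<open>Pascal's rule is used twice, on the first factor to merge the second and third terms of
  the recursion, then on the second factor. For \<open>d = 0\<close> the truncated
  \<open>d + i - 1\<close> still gives 1 at \<open>i = 0\<close> and 0 elsewhere.\<close>

lemma res_rank_eq: "res_rank m d i = ((d + i - 1) choose i) * ((d + m - 1) choose (d + i))"
proof (induction m d i rule: res_rank.induct)
  case (3 m d i)
  show ?case
  proof (cases i)
    case 0
    then show ?thesis using 3 by simp
  next
    case (Suc i')
    then have "res_rank (Suc m) (Suc d) i =
        ((d + i) choose i) * ((d + m) choose (d + i + 1)) +
        (((d + i - 1) choose i) + ((d + i - 1) choose i')) * ((d + m) choose (d + i))"
      using 3 by (simp add: distrib_right)
    also have "((d + i - 1) choose i) + ((d + i - 1) choose i') = (d + i) choose i"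
      by (simp add: Suc)
    finally show ?thesis by (simp add: distrib_left [symmetric])
  qed
qed (auto simp: binomial_eq_0)

text \<open>An ideal, a submodule of the free module of rank 1, is represented by functions constant
  in the coordinate; coordinate 0 is read off when matrices are formed.\<close>

abbreviation const_vecs :: "mpoly set \<Rightarrow> (nat \<Rightarrow> mpoly) set" where
  "const_vecs A \<equiv> (\<lambda>p _. p) ` A"

text \<open>Let A and B be the two ideals and f the new binomial, so that the ideal is A + f B.
  Sending a syzygy (u, w) of the joint generators to the element of B that \<open>w\<close>
  represents has as kernel the pairs of syzygies of A and of B, and its image is exactly A. This
  exact sequence goes into \<open>horseshoe\<close>; \<open>res\<close> is one term shorter because
  it resolves a quotient of the syzygies.\<close>

lemma lin_res_pow_ideal_step:
  assumes \<xi>: "primitive_root_of_unity k \<xi>" and m: "Suc m \<le> n"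
    and res': "lin_res n (int k) (Suc N) (const_vecs (pow_ideal n k m (Suc d))) (int (k * Suc d)) r'"
    and res'': "lin_res n (int k) (Suc N) (const_vecs (pow_ideal n k (Suc m) d)) (int (k * d)) r''"
    and res: "lin_res n (int k) N (const_vecs (pow_ideal n k m (Suc d))) (int (k * Suc d)) r"
  shows "lin_res n (int k) (Suc N) (const_vecs (pow_ideal n k (Suc m) (Suc d))) (int (k * Suc d))
    (\<lambda>i. r' i + r'' i + (case i of 0 \<Rightarrow> 0 | Suc i' \<Rightarrow> r i'))"
proof -
  have k: "k > 0" using \<xi> by (simp add: primitive_root_of_unity_def)
  let ?a = "r' 0" and ?b = "r'' 0" and ?f = "binom k (Suc m)"
  let ?A = "pow_ideal n k m (Suc d)" and ?B = "pow_ideal n k (Suc m) d"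
  have f: "?f \<in> polys {0..n}" "homogeneous (int k) ?f"
    using m by (simp_all add: homogeneous_binom)
  have A: "?A = vanishing n k m (Suc d)" and B: "?B = vanishing n k (Suc m) d"
    using m by (simp_all only: pow_ideal_eq_vanishing[OF \<xi>] Suc_leD)
  obtain g' where g': "\<And>c j. c < ?a \<Longrightarrow> g' c j \<in> polys {0..n}" "\<And>c. c < ?a \<Longrightarrow> hom_vec (int (k * Suc d)) (g' c)"
    and Ag: "const_vecs ?A = comb ?a g' ` fvecs n ?a"
    and syz': "lin_res n k N (syz n ?a g') k (\<lambda>i. r' (Suc i))"
    using res' by auto
  obtain g'' where g'': "\<And>c j. c < ?b \<Longrightarrow> g'' c j \<in> polys {0..n}" "\<And>c. c < ?b \<Longrightarrow> hom_vec (int (k * d)) (g'' c)"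
    and Bg: "const_vecs ?B = comb ?b g'' ` fvecs n ?b"
    and syz'': "lin_res n k N (syz n ?b g'') k (\<lambda>i. r'' (Suc i))"
    using res'' by auto
  let ?g = "vappend ?a g' (\<lambda>c j. ?f * g'' c j)"
  have comb_g: "comb (?a + ?b) ?g v = (\<lambda>j. comb ?a g' v j + ?f * comb ?b g'' (vshift ?a v) j)" for v
    by (simp add: comb_append comb_scale)
  have inA: "\<exists>p\<in>?A. comb ?a g' v = (\<lambda>_. p)" if "v \<in> fvecs n s" for v s
    using comb_mem_image[OF that, of ?a g'] Ag by auto
  have inB: "\<exists>p\<in>?B. comb ?b g'' v = (\<lambda>_. p)" if "v \<in> fvecs n s" for v s
    using comb_mem_image[OF that, of ?b g''] Bg by auto
  have "const_vecs (pow_ideal n k (Suc m) (Suc d)) = comb (?a + ?b) ?g ` fvecs n (?a + ?b)"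
  proof (intro Set.set_eqI iffI)
    fix z assume "z \<in> const_vecs (pow_ideal n k (Suc m) (Suc d))"
    then obtain p q where pq: "p \<in> ?A" "q \<in> ?B" "z = (\<lambda>_. p + ?f * q)" by auto
    have "(\<lambda>_. p) \<in> comb ?a g' ` fvecs n ?a" using pq(1) Ag by blast
    then obtain u where "u \<in> fvecs n ?a" "comb ?a g' u = (\<lambda>_. p)" by (elim imageE) simp
    moreover have "(\<lambda>_. q) \<in> comb ?b g'' ` fvecs n ?b" using pq(2) Bg by blast
    then obtain w where "w \<in> fvecs n ?b" "comb ?b g'' w = (\<lambda>_. q)" by (elim imageE) simp
    ultimately show "z \<in> comb (?a + ?b) ?g ` fvecs n (?a + ?b)"
      by (intro image_eqI[of _ _ "vappend ?a u w"]) (simp_all add: comb_g pq(3) append_fvecs)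
  next
    fix z assume "z \<in> comb (?a + ?b) ?g ` fvecs n (?a + ?b)"
    then obtain v where v: "v \<in> fvecs n (?a + ?b)" "z = comb (?a + ?b) ?g v" by blast
    obtain p q where "p \<in> ?A" "comb ?a g' v = (\<lambda>_. p)" "q \<in> ?B" "comb ?b g'' (vshift ?a v) = (\<lambda>_. q)"
      using inA[OF v(1)] inB[OF shift_fvecs[OF v(1)]] by blast
    then show "z \<in> const_vecs (pow_ideal n k (Suc m) (Suc d))"
      by (auto simp: v(2) comb_g)
  qed
  moreover have "lin_res n k N (syz n (?a + ?b) ?g) k (\<lambda>i. r' (Suc i) + r'' (Suc i) + r i)"
  proof (rule horseshoe[OF lin_res_syz_product[OF syz' syz''] res submod_syz linear_on_comb_shift])
    show "{v \<in> fvecs n (?a + ?b). comb ?a g' v = (\<lambda>_. 0) \<and> comb ?b g'' (vshift ?a v) = (\<lambda>_. 0)} =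
        {x \<in> syz n (?a + ?b) ?g. comb ?b g'' (vshift ?a x) = (\<lambda>_. 0)}"
      by (auto simp: syz_def comb_g)
  next
    fix x assume x: "x \<in> syz n (?a + ?b) ?g"
    obtain p q where p: "p \<in> ?A" "comb ?a g' x = (\<lambda>_. p)" and q: "q \<in> ?B" "comb ?b g'' (vshift ?a x) = (\<lambda>_. q)"
      using inA[OF syzD(1)[OF x]] inB[OF shift_fvecs[OF syzD(1)[OF x]]] by blast
    have "p + ?f * q = 0"
      using syzD(2)[OF x] by (auto simp: comb_g p q fun_eq_iff)
    \<comment> \<open>A syzygy says that f q lies in A; regularity of f modulo A puts q itself in A,
      not only in B.\<close>
    then have "?f * q = - p" by (simp add: add_eq_0_iff)
    then have fq: "?f * q \<in> vanishing n k m (Suc d)" using p(1) A by simp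
    have "q \<in> polys {0..n}" using q(1) unfolding B by (rule vanishing_polys)
    from vanishing_binom_regular[OF m k this fq] have "q \<in> ?A" unfolding A .
    then show "comb ?b g'' (vshift ?a x) \<in> const_vecs ?A" by (auto simp: q)
  next
    fix z assume z: "z \<in> const_vecs ?A" "hom_vec (int (k * Suc d)) z"
    then obtain p where p: "p \<in> ?A" "z = (\<lambda>_. p)" by blast
    \<comment> \<open>Surjectivity: A is contained in B, so \<open>p\<close> is a combination of the
      \<open>g''\<close>, and the compensating \<open>- (?f * p)\<close> is a combination of the
      \<open>g'\<close>. Both coefficient vectors have degree \<open>k\<close>, since
      \<open>p\<close> has degree \<open>k\<close> above the generators of B.\<close>
    from p(1) have "p \<in> vanishing n k m d" unfolding A by (rule vanishing_antimono) simp
    then have "p \<in> ?B" unfolding B by (rule vanishing_mono) simp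
    then have "z \<in> comb ?b g'' ` fvecs n ?b" using p(2) Bg by blast
    moreover have "hom_vec (int k + int (k * d)) z" using z(2) by (simp add: algebra_simps)
    ultimately obtain w where w: "w \<in> fvecs n ?b" "hom_vec k w" "comb ?b g'' w = z"
      by (rule hom_vec_lift[OF _ _ g''(2)])
    have "- (?f * p) \<in> ?A" using p(1) f(1) unfolding A by simp
    then have "(\<lambda>_. - (?f * p)) \<in> comb ?a g' ` fvecs n ?a" using Ag by blast
    moreover have "hom_vec (int k + int (k * Suc d)) (\<lambda>_. - (?f * p))"
      using homogeneous_mult[OF f(2), of "int (k * Suc d)" p] z(2) p(2) by (simp add: hom_vec_def)
    ultimately obtain u where u: "u \<in> fvecs n ?a" "hom_vec k u" "comb ?a g' u = (\<lambda>_. - (?f * p))"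
      by (rule hom_vec_lift[OF _ _ g'(2)])
    show "\<exists>x\<in>syz n (?a + ?b) ?g. hom_vec k x \<and> comb ?b g'' (vshift ?a x) = z"
      by (rule bexI[of _ "vappend ?a u w"])
        (simp_all add: hom_vec_append syz_def comb_g u w append_fvecs p(2))
  next
    show "x j \<in> polys {0..n}" if "x \<in> syz n (?a + ?b) ?g" for x j
      using that by (rule fvecs_polys[OF syzD(1)])
  qed
  moreover have "?g c j \<in> polys {0..n}" if "c < ?a + ?b" for c j
    using that g'(1)[of c j] g''(1)[of "c - ?a" j] f by (auto simp: vappend_def)
  moreover have "hom_vec (int (k * Suc d)) (?g c)" if "c < ?a + ?b" for c
  proof (cases "c < ?a")
    case False
    then have "homogeneous (int k + int (k * d)) (?f * g'' (c - ?a) j)" for j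
      using that g''(2)[of "c - ?a"] by (intro homogeneous_mult f) (auto simp: hom_vec_def)
    with False show ?thesis by (simp add: hom_vec_def vappend_def)
  next
    case True
    then show ?thesis using g'(2)[OF True] by (simp add: vappend_def)
  qed
  ultimately show ?thesis
    by (intro lin_res.simps(2)[THEN iffD2] exI[of _ ?g]) simp
qed

lemma lin_res_polys:
  "lin_res n k (Suc N) (const_vecs (polys {0..n})) 0 (res_rank m 0)"
proof -
  have rank: "res_rank m 0 = (\<lambda>i. if i = 0 then 1 else 0)" by (simp add: fun_eq_iff)
  have comb: "comb (Suc 0) (\<lambda>_ _. 1) v = (\<lambda>_. v 0)" for v by (simp add: comb_def)
  have "(\<lambda>_. p) = comb (Suc 0) (\<lambda>_ _. 1) (\<lambda>c. if c = 0 then p else 0)" for p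
    by (simp add: comb)
  moreover have "(\<lambda>c. if c = 0 then p else 0) \<in> fvecs n (Suc 0)" if "p \<in> polys {0..n}" for p
    using that by (simp add: fvecs_def)
  ultimately have "const_vecs (polys {0..n}) \<subseteq> comb (Suc 0) (\<lambda>_ _. 1) ` fvecs n (Suc 0)"
    by blast
  moreover have "comb (Suc 0) (\<lambda>_ _. 1) ` fvecs n (Suc 0) \<subseteq> const_vecs (polys {0..n})"
    by (auto simp: comb fvecs_polys)
  moreover have "syz n (Suc 0) (\<lambda>_ _. 1) = {\<lambda>_. 0}"
  proof -
    have "v c = 0" if "v \<in> syz n (Suc 0) (\<lambda>_ _. 1)" for v c
      using that by (cases c) (auto simp: syz_def comb fvecs_def fun_eq_iff)
    then show ?thesis using submodD(1)[OF submod_syz] by blast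
  qed
  ultimately show ?thesis
    using lin_res_zero by (auto simp: rank hom_vec_def intro!: exI[of _ "\<lambda>_ _. 1"])
qed

text \<open>\<open>N\<close> counts the free modules, so the zero ideal admits \<open>N = 0\<close>;
  the unit ideal at \<open>d = 0\<close> takes at least one, whence the last side condition.\<close>

lemma lin_res_pow_ideal:
  assumes \<xi>: "primitive_root_of_unity k \<xi>"
  shows "m \<le> n \<Longrightarrow> m \<le> N \<Longrightarrow> 0 < d \<or> 0 < N \<Longrightarrow>
    lin_res n (int k) N (const_vecs (pow_ideal n k m d)) (int (k * d)) (res_rank m d)"
proof (induction m arbitrary: d N)
  case 0
  show ?case
  proof (cases d)
    case 0
    then show ?thesis using lin_res_polys "0.prems" by (cases N) simp_all
  next
    case (Suc d')
    have "res_rank 0 d = (\<lambda>_. 0)" using Suc by (simp add: fun_eq_iff)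
    then show ?thesis using lin_res_zero Suc by simp
  qed
next
  case (Suc m)
  note IH = Suc.IH
  show ?case using Suc.prems
  proof (induction d arbitrary: N)
    case 0
    then show ?case using lin_res_polys by (cases N) simp_all
  next
    case (Suc d)
    then obtain N' where N: "N = Suc N'" "m \<le> N'" by (cases N) auto
    have "res_rank (Suc m) (Suc d) = (\<lambda>i. res_rank m (Suc d) i + res_rank (Suc m) d i +
        (case i of 0 \<Rightarrow> 0 | Suc i' \<Rightarrow> res_rank m (Suc d) i'))"
      by (simp add: fun_eq_iff)
    then show ?case unfolding N(1)
      using lin_res_pow_ideal_step[OF \<xi> Suc.prems(1) IH Suc.IH IH] Suc.prems N by simp
  qed
qed

section \<open>From nested syzygies to a complex of matrices\<close>

lemma lin_res_sequence:
  assumes "lin_res n k N M h rs" "\<And>i. N \<le> i \<Longrightarrow> rs i = 0"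
  shows "\<exists>g. (\<forall>i. \<forall>c<rs i. (\<forall>j. g i c j \<in> polys {0..n}) \<and> hom_vec (if i = 0 then h else k) (g i c)) \<and>
    M = comb (rs 0) (g 0) ` fvecs n (rs 0) \<and>
    (\<forall>i. syz n (rs i) (g i) = comb (rs (Suc i)) (g (Suc i)) ` fvecs n (rs (Suc i)))"
  using assms
proof (induction N arbitrary: M h rs)
  case 0
  then show ?case by (intro exI[of _ "\<lambda>_ _ _. 0"]) (auto simp: syz_def)
next
  case (Suc N)
  then obtain g where g: "\<And>c. c < rs 0 \<Longrightarrow> (\<forall>j. g c j \<in> polys {0..n}) \<and> hom_vec h (g c)"
    "M = comb (rs 0) g ` fvecs n (rs 0)" "lin_res n k N (syz n (rs 0) g) k (\<lambda>i. rs (Suc i))"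
    by auto
  \<comment> \<open>The conditional with equal branches is the induction hypothesis at first degree
    \<open>k\<close>: after the first map no degree is exceptional.\<close>
  have "\<exists>g'. (\<forall>i. \<forall>c<rs (Suc i). (\<forall>j. g' i c j \<in> polys {0..n}) \<and> hom_vec (if i = 0 then k else k) (g' i c)) \<and>
    syz n (rs 0) g = comb (rs (Suc 0)) (g' 0) ` fvecs n (rs (Suc 0)) \<and>
    (\<forall>i. syz n (rs (Suc i)) (g' i) = comb (rs (Suc (Suc i))) (g' (Suc i)) ` fvecs n (rs (Suc (Suc i))))"
    using Suc.IH[OF g(3)] Suc.prems(2) by simp
  then obtain g' where g': "\<And>i c. c < rs (Suc i) \<Longrightarrow> (\<forall>j. g' i c j \<in> polys {0..n}) \<and> hom_vec k (g' i c)"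
    "syz n (rs 0) g = comb (rs (Suc 0)) (g' 0) ` fvecs n (rs (Suc 0))"
    "\<And>i. syz n (rs (Suc i)) (g' i) = comb (rs (Suc (Suc i))) (g' (Suc i)) ` fvecs n (rs (Suc (Suc i)))"
    by auto
  show ?case
  proof (intro exI[of _ "\<lambda>i. case i of 0 \<Rightarrow> g | Suc i \<Rightarrow> g' i"] conjI allI impI)
    fix i c j assume "c < rs i"
    then show "(case i of 0 \<Rightarrow> g | Suc i \<Rightarrow> g' i) c j \<in> polys {0..n}"
      "hom_vec (if i = 0 then h else k) ((case i of 0 \<Rightarrow> g | Suc i \<Rightarrow> g' i) c)"
      using g(1) g'(1) by (auto split: nat.splits)
  next
    show "syz n (rs i) (case i of 0 \<Rightarrow> g | Suc i \<Rightarrow> g' i) =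
      comb (rs (Suc i)) (case Suc i of 0 \<Rightarrow> g | Suc i \<Rightarrow> g' i) ` fvecs n (rs (Suc i))" for i
      using g'(2,3) by (cases i) simp_all
  qed (use g(2) in simp)
qed

lemma mult_mat_vec_comb:
  assumes "w \<in> carrier_vec s"
  shows "mat r s (\<lambda>(a, c). g c a) *\<^sub>v w = vec r (comb s g (\<lambda>c. w $ c))"
  using assms by (intro eq_vecI)
    (simp_all add: scalar_prod_def comb_def lessThan_atLeast0 mult.commute)

lemma vec_fvecs: "v \<in> fvecs n r \<Longrightarrow> vec r v \<in> free_mod n r"
  by (simp add: fvecs_def free_mod_def carrier_poly_ring)

lemma free_mod_fvecs: "w \<in> free_mod n r \<Longrightarrow> (\<lambda>c. if c < r then w $ c else 0) \<in> fvecs n r"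
  by (simp add: fvecs_def free_mod_def carrier_poly_ring)

lemma free_mod_carrier: "w \<in> free_mod n r \<Longrightarrow> w \<in> carrier_vec r"
  by (simp add: free_mod_def)

lemma vec_of_free_mod: "w \<in> free_mod n r \<Longrightarrow> vec r (\<lambda>c. if c < r then w $ c else 0) = w"
  by (intro eq_vecI) (auto dest: free_mod_carrier)

lemma comb_vec: "comb s g (\<lambda>c. if c < s then v c else 0) = comb s g v"
  "comb s g (\<lambda>c. vec s v $ c) = comb s g v"
  by (rule comb_cong; simp)+

lemma mat_image_free_mod:
  "(\<lambda>w. mat r s (\<lambda>(a, c). g c a) *\<^sub>v w) ` free_mod n s = vec r ` comb s g ` fvecs n s"
proof (intro Set.set_eqI iffI)
  fix z assume "z \<in> (\<lambda>w. mat r s (\<lambda>(a, c). g c a) *\<^sub>v w) ` free_mod n s"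
  then obtain w where w: "w \<in> free_mod n s" "z = vec r (comb s g (\<lambda>c. w $ c))"
    by (auto simp: mult_mat_vec_comb[OF free_mod_carrier])
  then have "z = vec r (comb s g (\<lambda>c. if c < s then w $ c else 0))" by (simp add: comb_vec)
  with free_mod_fvecs[OF w(1)] show "z \<in> vec r ` comb s g ` fvecs n s" by blast
next
  fix z assume "z \<in> vec r ` comb s g ` fvecs n s"
  then obtain v where v: "v \<in> fvecs n s" "z = vec r (comb s g v)" by blast
  then have "z = mat r s (\<lambda>(a, c). g c a) *\<^sub>v vec s v"
    by (simp add: mult_mat_vec_comb comb_vec)
  with vec_fvecs[OF v(1)] show "z \<in> (\<lambda>w. mat r s (\<lambda>(a, c). g c a) *\<^sub>v w) ` free_mod n s" by blast
qed

text \<open>A matrix sees only the coordinates below \<open>r\<close>. The assumption that these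
  determine a combination is met both by constant functions and by vectors supported below
  \<open>r\<close>.\<close>

lemma free_mod_kernel:
  assumes "\<And>v. v \<in> fvecs n s \<Longrightarrow> (\<forall>j<r. comb s g v j = 0) \<Longrightarrow> comb s g v = (\<lambda>_. 0)"
  shows "free_mod n s \<inter> mat_kernel (mat r s (\<lambda>(a, c). g c a)) = vec s ` syz n s g"
proof (intro Set.set_eqI iffI)
  fix w assume w: "w \<in> free_mod n s \<inter> mat_kernel (mat r s (\<lambda>(a, c). g c a))"
  let ?v = "\<lambda>c. if c < s then w $ c else 0"
  have "vec r (comb s g (\<lambda>c. w $ c)) = 0\<^sub>v r"
    using w by (auto simp: mat_kernel_def mult_mat_vec_comb)
  then have "comb s g (\<lambda>c. w $ c) j = 0" if "j < r" for j
    using that by (metis index_vec index_zero_vec(1))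
  then have "comb s g ?v = (\<lambda>_. 0)"
    using w by (intro assms free_mod_fvecs) (auto simp: comb_vec)
  then have "?v \<in> syz n s g" using w free_mod_fvecs[of w n s] by (simp add: syz_def)
  moreover have "w = vec s ?v" using w by (intro vec_of_free_mod [symmetric]) blast
  ultimately show "w \<in> vec s ` syz n s g" by (rule rev_image_eqI[where f = "vec s"])
next
  fix w assume "w \<in> vec s ` syz n s g"
  then obtain v where v: "v \<in> fvecs n s" "comb s g v = (\<lambda>_. 0)" "w = vec s v" by (auto simp: syz_def)
  have "mat r s (\<lambda>(a, c). g c a) *\<^sub>v w = 0\<^sub>v r"
    by (simp add: v(3) mult_mat_vec_comb comb_vec v(2)) (auto intro: eq_vecI)
  then show "w \<in> free_mod n s \<inter> mat_kernel (mat r s (\<lambda>(a, c). g c a))"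
    using vec_fvecs[OF v(1)] by (simp add: v(3) mat_kernel_def)
qed

text \<open>The ring itself, in degree 0 and with augmentation 1, is put in front of the resolution
  of the ideal, so ranks and degrees move up by one homological degree.\<close>

lemma lin_res_imp_graded_free_resolution:
  assumes "lin_res n k N (const_vecs J) h rs" "\<And>i. N \<le> i \<Longrightarrow> rs i = 0" "J \<subseteq> polys {0..n}"
  obtains F where "graded_free_resolution n J F" "frank F 0 = 1" "\<And>i. frank F (Suc i) = rs i"
    "\<And>c. fdeg F 0 c = 0" "\<And>i c. fdeg F (Suc i) c = h + k * int i"
proof -
  from lin_res_sequence[OF assms(1,2)] obtain g where G:
    "(\<forall>i. \<forall>c<rs i. (\<forall>j. g i c j \<in> polys {0..n}) \<and> hom_vec (if i = 0 then h else k) (g i c)) \<and>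
     const_vecs J = comb (rs 0) (g 0) ` fvecs n (rs 0) \<and>
     (\<forall>i. syz n (rs i) (g i) = comb (rs (Suc i)) (g (Suc i)) ` fvecs n (rs (Suc i)))"
    by (rule exE)
  note g = conjunct1[OF G, rule_format, THEN conjunct1, rule_format]
    conjunct1[OF G, rule_format, THEN conjunct2]
  have J: "const_vecs J = comb (rs 0) (g 0) ` fvecs n (rs 0)"
    and ex: "\<And>i. syz n (rs i) (g i) = comb (rs (Suc i)) (g (Suc i)) ` fvecs n (rs (Suc i))"
    using conjunct2[OF G] by simp_all
  define rk where "rk i = (case i of 0 \<Rightarrow> 1 | Suc i \<Rightarrow> rs i)" for i
  define F where "F = \<lparr>frank = rk, fdeg = (\<lambda>i c. case i of 0 \<Rightarrow> 0 | Suc i \<Rightarrow> h + k * int i),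
    fdiff = (\<lambda>i. mat (rk i) (rs i) (\<lambda>(a, c). g i c a)), faug = vec 1 (\<lambda>_. 1)\<rparr>"
  have aug: "vec (Suc 0) (\<lambda>_. 1) \<bullet> v = v $ 0" if "v \<in> carrier_vec (Suc 0)" for v :: "mpoly vec"
    using that by (simp add: scalar_prod_def)
  have supp: "comb (rs i) (g i) v = (\<lambda>_. 0)"
    if v: "v \<in> fvecs n (rs i)" "\<forall>j<rk i. comb (rs i) (g i) v j = 0" for i v
  proof (cases i)
    case 0
    then have "comb (rs i) (g i) v \<in> const_vecs J" using J v(1) by simp
    then show ?thesis using v(2) 0 by (auto simp: rk_def)
  next
    case (Suc i')
    have "comb (rs i) (g i) v \<in> syz n (rs i') (g i')" using ex[of i'] v(1) Suc by simp
    then have "comb (rs i) (g i) v j = 0" if "rk i \<le> j" for j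
      using that Suc by (simp add: rk_def syz_def fvecs_def)
    then show ?thesis using v(2) by (metis not_le)
  qed
  have "{v \<in> free_mod n 1. v $ 0 \<in> J} = vec 1 ` const_vecs J"
  proof (intro Set.set_eqI iffI)
    fix v assume v: "v \<in> {v \<in> free_mod n 1. v $ 0 \<in> J}"
    then have "v = vec 1 (\<lambda>_. v $ 0)" by (intro eq_vecI) (auto simp: free_mod_def)
    then show "v \<in> vec 1 ` const_vecs J" using v by blast
  next
    fix v assume "v \<in> vec 1 ` const_vecs J"
    then show "v \<in> {v \<in> free_mod n 1. v $ 0 \<in> J}"
      using assms(3) by (auto simp: free_mod_def carrier_poly_ring)
  qed
  moreover have "{v \<in> free_mod n 1. vec 1 (\<lambda>_. 1) \<bullet> v \<in> J} = {v \<in> free_mod n 1. v $ 0 \<in> J}"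
    by (auto simp: aug free_mod_carrier)
  ultimately have exact0: "{v \<in> free_mod n 1. vec 1 (\<lambda>_. 1) \<bullet> v \<in> J} =
      (\<lambda>w. mat 1 (rs 0) (\<lambda>(a, c). g 0 c a) *\<^sub>v w) ` free_mod n (rs 0)"
    by (simp add: mat_image_free_mod J)
  have exact: "free_mod n (rs i) \<inter> mat_kernel (mat (rk i) (rs i) (\<lambda>(a, c). g i c a)) =
      (\<lambda>w. mat (rs i) (rs (Suc i)) (\<lambda>(a, c). g (Suc i) c a) *\<^sub>v w) ` free_mod n (rs (Suc i))" for i
    using free_mod_kernel[of n "rs i" "rk i" "g i", OF supp] by (simp add: mat_image_free_mod ex)
  have onto: "\<exists>v\<in>free_mod n 1. p - vec 1 (\<lambda>_. 1) \<bullet> v \<in> J" if "p \<in> polys {0..n}" for p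
  proof (rule bexI[of _ "vec 1 (\<lambda>_. p)"])
    have "(\<lambda>_. 0) \<in> const_vecs J"
      unfolding J by (rule rev_image_eqI[of "\<lambda>_. 0"]) (simp_all add: comb_def)
    then have "0 \<in> J" by (metis imageE)
    then show "p - vec 1 (\<lambda>_. 1) \<bullet> vec 1 (\<lambda>_. p) \<in> J" by (simp add: aug)
  qed (use that in \<open>simp add: free_mod_def carrier_poly_ring\<close>)
  have hom: "homogeneous ((h + k * int i) - (case i of 0 \<Rightarrow> 0 | Suc i \<Rightarrow> h + k * int i)) (g i c a)"
    if "c < rs i" for i c a
    using g(2)[OF that] by (cases i) (simp_all add: hom_vec_def distrib_left)
  have "graded_free_resolution n J F"
    unfolding graded_free_resolution_def
    using g(1) hom exact0 exact onto
    by (simp add: F_def rk_def carrier_poly_ring free_mod_def[of n 1])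
      (simp add: carrier_poly_ring free_mod_def)
  then show ?thesis
    by (rule that) (simp_all add: F_def rk_def)
qed


section \<open>Comparison of graded free resolutions\<close>

text \<open>The matrix of a degree-0 map between graded free modules: \<open>\<gamma>\<close> lists
  the degrees of the basis of the source (columns), \<open>\<rho>\<close> those of the target
  (rows).\<close>

definition graded_mat ::
    "nat \<Rightarrow> nat \<Rightarrow> nat \<Rightarrow> (nat \<Rightarrow> int) \<Rightarrow> (nat \<Rightarrow> int) \<Rightarrow> mpoly mat \<Rightarrow> bool" where
  "graded_mat n r s \<rho> \<gamma> A \<longleftrightarrow> A \<in> carrier_mat r s \<and>
     (\<forall>a<r. \<forall>c<s. A $$ (a, c) \<in> polys {0..n} \<and> homogeneous (\<gamma> c - \<rho> a) (A $$ (a, c)))"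

lemma graded_matD:
  assumes "graded_mat n r s \<rho> \<gamma> A"
  shows "A \<in> carrier_mat r s" "dim_row A = r" "dim_col A = s"
    and "a < r \<Longrightarrow> c < s \<Longrightarrow> A $$ (a, c) \<in> polys {0..n}"
    and "a < r \<Longrightarrow> c < s \<Longrightarrow> homogeneous (\<gamma> c - \<rho> a) (A $$ (a, c))"
  using assms by (auto simp: graded_mat_def)

lemma graded_mat_mult:
  assumes A: "graded_mat n r s \<rho> \<gamma> A" and B: "graded_mat n s t \<gamma> \<delta> B"
  shows "graded_mat n r t \<rho> \<delta> (A * B)"
proof -
  have "homogeneous (\<delta> c - \<rho> a) (A $$ (a, b) * B $$ (b, c))" if "a < r" "b < s" "c < t" for a b c
    using homogeneous_mult[OF graded_matD(5)[OF A that(1,2)] graded_matD(5)[OF B that(2,3)]]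
    by (simp add: algebra_simps)
  then show ?thesis
    using graded_matD[OF A] graded_matD[OF B]
    by (auto simp: graded_mat_def scalar_prod_def intro!: homogeneous_sum polys_sum polys_mult)
qed

lemma graded_mat_diff:
  "graded_mat n r s \<rho> \<gamma> A \<Longrightarrow> graded_mat n r s \<rho> \<gamma> B \<Longrightarrow> graded_mat n r s \<rho> \<gamma> (A - B)"
  by (auto simp: graded_mat_def)

lemma graded_mat_one: "graded_mat n r r \<rho> \<rho> (1\<^sub>m r)"
  by (auto simp: graded_mat_def)

text \<open>The columns are solved one by one without regard to degrees; replacing each entry by the
  component of the prescribed degree keeps the equation valid, as \<open>A\<close> and
  \<open>B\<close> are graded.\<close>

lemma graded_mat_lift:
  assumes A: "graded_mat n r s \<rho> \<gamma> A" and B: "graded_mat n r t \<rho> \<delta> B"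
    and sol: "\<And>c. c < t \<Longrightarrow> \<exists>w\<in>free_mod n s. A *\<^sub>v w = col B c"
  shows "\<exists>C. graded_mat n s t \<gamma> \<delta> C \<and> A * C = B"
proof -
  obtain w where w: "\<And>c. c < t \<Longrightarrow> w c \<in> free_mod n s" "\<And>c. c < t \<Longrightarrow> A *\<^sub>v w c = col B c"
    using sol by metis
  let ?C = "mat s t (\<lambda>(b, c). hom_part (\<delta> c - \<gamma> b) (w c $ b))"
  have "graded_mat n s t \<gamma> \<delta> ?C"
    using w(1) by (auto simp: graded_mat_def free_mod_def carrier_poly_ring)
  moreover have "A * ?C = B"
  proof (rule eq_matI)
    fix a c assume "a < dim_row B" "c < dim_col B"
    then have ac: "a < r" "c < t" using graded_matD[OF B] by auto
    have dw: "dim_vec (w c) = s" using w(1)[OF ac(2)] by (auto simp: free_mod_def)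
    have "B $$ (a, c) = (A *\<^sub>v w c) $ a"
      unfolding w(2)[OF ac(2)] using ac graded_matD[OF B] by simp
    also have "\<dots> = (\<Sum>b<s. w c $ b * A $$ (a, b))"
      using ac graded_matD[OF A] dw by (simp add: scalar_prod_def lessThan_atLeast0 mult.commute)
    finally have Bac: "B $$ (a, c) = (\<Sum>b<s. w c $ b * A $$ (a, b))" .
    have "B $$ (a, c) = hom_part (\<delta> c - \<rho> a) (B $$ (a, c))"
      using graded_matD(5)[OF B ac] by (simp add: hom_part_homogeneous)
    also have "\<dots> = (\<Sum>b<s. hom_part (\<delta> c - \<rho> a) (w c $ b * A $$ (a, b)))"
      by (simp add: Bac hom_part_sum)
    also have "\<dots> = (\<Sum>b<s. hom_part (\<delta> c - \<gamma> b) (w c $ b) * A $$ (a, b))"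
    proof (rule sum.cong[OF refl])
      fix b assume "b \<in> {..<s}"
      then have "hom_part (\<delta> c - \<rho> a) (w c $ b * A $$ (a, b)) =
          hom_part (\<delta> c - \<rho> a - (\<gamma> b - \<rho> a)) (w c $ b) * A $$ (a, b)"
        by (intro hom_part_mult graded_matD(5)[OF A ac(1)]) simp
      then show "hom_part (\<delta> c - \<rho> a) (w c $ b * A $$ (a, b)) =
          hom_part (\<delta> c - \<gamma> b) (w c $ b) * A $$ (a, b)" by simp
    qed
    also have "\<dots> = (A * ?C) $$ (a, c)"
      using ac graded_matD[OF A] by (simp add: scalar_prod_def lessThan_atLeast0 mult.commute)
    finally show "(A * ?C) $$ (a, c) = B $$ (a, c)" ..
  qed (use graded_matD[OF A] graded_matD[OF B] in simp_all)
  ultimately show ?thesis by blast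
qed

text \<open>For index 0 this is the kernel of the augmentation to S/J, so exactness takes the same
  form in all degrees and the lifting arguments have no separate start.\<close>

definition cycles :: "nat \<Rightarrow> mpoly set \<Rightarrow> free_cplx \<Rightarrow> nat \<Rightarrow> mpoly vec set" where
  "cycles n J F i = (case i of 0 \<Rightarrow> {v \<in> free_mod n (frank F 0). faug F \<bullet> v \<in> J}
     | Suc i' \<Rightarrow> free_mod n (frank F i) \<inter> mat_kernel (fdiff F i'))"

abbreviation graded_map :: "nat \<Rightarrow> free_cplx \<Rightarrow> nat \<Rightarrow> free_cplx \<Rightarrow> nat \<Rightarrow> mpoly mat \<Rightarrow> bool" where
  "graded_map n F' i' F i A \<equiv>
     graded_mat n (frank F' i') (frank F i) (fdeg F' i') (fdeg F i) A"

lemma resolution_diff: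
  "graded_free_resolution n J F \<Longrightarrow> graded_map n F i F (Suc i) (fdiff F i)"
  by (simp add: graded_free_resolution_def graded_mat_def carrier_poly_ring)

lemma resolution_exact:
  "graded_free_resolution n J F \<Longrightarrow>
    cycles n J F i = (\<lambda>w. fdiff F i *\<^sub>v w) ` free_mod n (frank F (Suc i))"
  by (cases i) (simp_all add: graded_free_resolution_def cycles_def)

lemma resolution_lift:
  assumes F: "graded_free_resolution n J F" and B: "graded_mat n (frank F i) t (fdeg F i) \<delta> B"
    and cyc: "\<And>c. c < t \<Longrightarrow> col B c \<in> cycles n J F i"
  shows "\<exists>C. graded_mat n (frank F (Suc i)) t (fdeg F (Suc i)) \<delta> C \<and> fdiff F i * C = B"
  using cyc unfolding resolution_exact[OF F]
  by (intro graded_mat_lift[OF resolution_diff[OF F] B]) force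

lemma col_free_mod: "graded_mat n r t \<rho> \<delta> B \<Longrightarrow> c < t \<Longrightarrow> col B c \<in> free_mod n r"
  by (auto simp: graded_mat_def free_mod_def carrier_poly_ring)

lemma cycles_SucI:
  assumes F: "graded_free_resolution n J F" and B: "graded_mat n (frank F (Suc i)) t (fdeg F (Suc i)) \<delta> B"
    and "fdiff F i * B = 0\<^sub>m (frank F i) t" "c < t"
  shows "col B c \<in> cycles n J F (Suc i)"
proof -
  note D = graded_matD[OF resolution_diff[OF F, of i]]
  have "fdiff F i *\<^sub>v col B c = col (fdiff F i * B) c"
    by (rule col_mult2 [symmetric, OF D(1) graded_matD(1)[OF B] assms(4)])
  then have "fdiff F i *\<^sub>v col B c = 0\<^sub>v (frank F i)"
    using assms(3,4) by simp
  then have "col B c \<in> mat_kernel (fdiff F i)"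
    by (rule mat_kernelI[OF D(1) free_mod_carrier[OF col_free_mod[OF B assms(4)]]])
  with col_free_mod[OF B assms(4)] show ?thesis
    unfolding cycles_def nat.case by (rule IntI)
qed

lemma diff_col_cycle:
  assumes F: "graded_free_resolution n J F" and c: "c < frank F (Suc i)"
  shows "col (fdiff F i) c \<in> cycles n J F i"
proof -
  note D = graded_matD[OF resolution_diff[OF F, of i]]
  have "unit_vec (frank F (Suc i)) c \<in> free_mod n (frank F (Suc i))"
    by (simp add: free_mod_def carrier_poly_ring unit_vec_def)
  moreover have "col (fdiff F i) c = fdiff F i *\<^sub>v unit_vec (frank F (Suc i)) c"
    by (rule eq_vecI) (use D c in \<open>simp_all add: scalar_prod_right_unit[of _ "frank F (Suc i)"]\<close>)
  ultimately show ?thesis unfolding resolution_exact[OF F] by blast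
qed

lemma diff_diff:
  assumes F: "graded_free_resolution n J F"
  shows "fdiff F i * fdiff F (Suc i) = 0\<^sub>m (frank F i) (frank F (Suc (Suc i)))"
proof (rule eq_matI)
  note D = graded_matD[OF resolution_diff[OF F, of i]] graded_matD[OF resolution_diff[OF F, of "Suc i"]]
  fix a c assume "a < dim_row (0\<^sub>m (frank F i) (frank F (Suc (Suc i))) :: mpoly mat)"
    "c < dim_col (0\<^sub>m (frank F i) (frank F (Suc (Suc i))) :: mpoly mat)"
  then have ac: "a < frank F i" "c < frank F (Suc (Suc i))" by auto
  have "col (fdiff F (Suc i)) c \<in> mat_kernel (fdiff F i)"
    using diff_col_cycle[OF F ac(2)] unfolding cycles_def nat.case by (rule IntD2)
  then have "fdiff F i *\<^sub>v col (fdiff F (Suc i)) c = 0\<^sub>v (frank F i)"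
    by (rule mat_kernelD(2)[OF D(1)])
  then have "(fdiff F i *\<^sub>v col (fdiff F (Suc i)) c) $ a = 0" using ac by simp
  then show "(fdiff F i * fdiff F (Suc i)) $$ (a, c) = 0\<^sub>m (frank F i) (frank F (Suc (Suc i))) $$ (a, c)"
    using ac D by simp
next
  note D = graded_matD[OF resolution_diff[OF F, of i]] graded_matD[OF resolution_diff[OF F, of "Suc i"]]
  show "dim_row (fdiff F i * fdiff F (Suc i)) = dim_row (0\<^sub>m (frank F i) (frank F (Suc (Suc i))) :: mpoly mat)"
    "dim_col (fdiff F i * fdiff F (Suc i)) = dim_col (0\<^sub>m (frank F i) (frank F (Suc (Suc i))) :: mpoly mat)"
    using D by simp_all
qed

definition homogeneous_ideal :: "nat \<Rightarrow> mpoly set \<Rightarrow> bool" where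
  "homogeneous_ideal n J \<longleftrightarrow> ideal J (poly_ring n) \<and> (\<forall>p\<in>J. \<forall>e. hom_part e p \<in> J)"

definition chain_map :: "nat \<Rightarrow> free_cplx \<Rightarrow> free_cplx \<Rightarrow> (nat \<Rightarrow> mpoly mat) \<Rightarrow> bool" where
  "chain_map n F F' \<phi> \<longleftrightarrow> (\<forall>i. graded_map n F' i F i (\<phi> i) \<and> fdiff F' i * \<phi> (Suc i) = \<phi> i * fdiff F i)"

text \<open>Compatibility with the augmentations is asked only on basis vectors and modulo
  \<open>J\<close>, that is, as maps to S/J.\<close>

definition lifts_identity :: "mpoly set \<Rightarrow> free_cplx \<Rightarrow> free_cplx \<Rightarrow> (nat \<Rightarrow> mpoly mat) \<Rightarrow> bool" where
  "lifts_identity J F F' \<phi> \<longleftrightarrow> (\<forall>c<frank F 0. faug F $ c - faug F' \<bullet> col (\<phi> 0) c \<in> J)"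

lemma aug_mult:
  fixes u :: "mpoly vec"
  assumes \<phi>: "\<phi> \<in> carrier_mat r s" and u: "u \<in> carrier_vec r" and w: "w \<in> carrier_vec s"
  shows "u \<bullet> (\<phi> *\<^sub>v w) = (\<Sum>c<s. w $ c * (u \<bullet> col \<phi> c))"
proof -
  have "u \<bullet> (\<phi> *\<^sub>v w) = (\<Sum>a<r. \<Sum>c<s. w $ c * (u $ a * \<phi> $$ (a, c)))"
    using assms by (simp add: scalar_prod_def lessThan_atLeast0 sum_distrib_left mult_ac)
  also have "\<dots> = (\<Sum>c<s. w $ c * (\<Sum>a<r. u $ a * \<phi> $$ (a, c)))"
    unfolding sum_distrib_left by (rule sum.swap)
  also have "\<dots> = (\<Sum>c<s. w $ c * (u \<bullet> col \<phi> c))"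
    by (rule sum.cong) (use assms in \<open>simp_all add: scalar_prod_def lessThan_atLeast0\<close>)
  finally show ?thesis .
qed

lemma ideal_sum:
  assumes "ideal J (poly_ring n)" "\<And>c. c \<in> A \<Longrightarrow> p c \<in> J"
  shows "sum p A \<in> J"
  using assms(2)
  by (induction A rule: infinite_finite_induct) (simp_all add: poly_ring_idealD[OF assms(1)])

lemma ideal_diff:
  assumes "ideal J (poly_ring n)" "p \<in> J" "q \<in> J"
  shows "p - q \<in> J"
  using poly_ring_idealD(3)[OF assms(1,2), of "- q"] poly_ring_idealD(4)[OF assms(1), of "- 1" q] assms
  by simp

text \<open>Freeness of \<open>F\<close> and exactness of \<open>F'\<close> give the lifts degree by
  degree; homogeneity of \<open>J\<close> is what lets the first map be made graded without leaving
  its class in S/J.\<close>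

lemma exists_chain_map:
  assumes J: "homogeneous_ideal n J"
    and F: "graded_free_resolution n J F" and F': "graded_free_resolution n J F'"
  obtains \<phi> where "chain_map n F F' \<phi>" "lifts_identity J F F' \<phi>"
proof -
  have id: "ideal J (poly_ring n)" using J by (simp add: homogeneous_ideal_def)
  note D = graded_matD[OF resolution_diff[OF F]]
  have augF: "faug F \<in> free_mod n (frank F 0)" and augF': "faug F' \<in> free_mod n (frank F' 0)"
    and homF: "\<And>c. c < frank F 0 \<Longrightarrow> homogeneous (fdeg F 0 c) (faug F $ c)"
    and homF': "\<And>c. c < frank F' 0 \<Longrightarrow> homogeneous (fdeg F' 0 c) (faug F' $ c)"
    and onto: "\<And>p. p \<in> polys {0..n} \<Longrightarrow> \<exists>v\<in>free_mod n (frank F' 0). p - faug F' \<bullet> v \<in> J"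
    using F F' by (simp_all add: graded_free_resolution_def carrier_poly_ring)
  have "\<exists>v\<in>free_mod n (frank F' 0). faug F $ c - faug F' \<bullet> v \<in> J" if "c < frank F 0" for c
    using augF that by (intro onto) (simp add: free_mod_def carrier_poly_ring)
  then obtain v where v: "\<And>c. c < frank F 0 \<Longrightarrow> v c \<in> free_mod n (frank F' 0)"
    "\<And>c. c < frank F 0 \<Longrightarrow> faug F $ c - faug F' \<bullet> v c \<in> J" by metis
  define \<phi>0 where "\<phi>0 = mat (frank F' 0) (frank F 0) (\<lambda>(b, c). hom_part (fdeg F 0 c - fdeg F' 0 b) (v c $ b))"
  have \<phi>0: "graded_map n F' 0 F 0 \<phi>0"
    using v(1) by (auto simp: \<phi>0_def graded_mat_def free_mod_def carrier_poly_ring)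
  have aug0: "faug F $ c - faug F' \<bullet> col \<phi>0 c \<in> J" if c: "c < frank F 0" for c
  proof -
    let ?e = "fdeg F 0 c"
    have dv: "dim_vec (v c) = frank F' 0" using v(1)[OF c] by (simp add: free_mod_def)
    have "hom_part ?e (faug F' \<bullet> v c) = (\<Sum>b<frank F' 0. hom_part ?e (v c $ b * faug F' $ b))"
      by (simp add: scalar_prod_def dv lessThan_atLeast0 hom_part_sum mult.commute)
    also have "\<dots> = (\<Sum>b<frank F' 0. hom_part (?e - fdeg F' 0 b) (v c $ b) * faug F' $ b)"
      by (rule sum.cong) (use homF' in \<open>simp_all add: hom_part_mult\<close>)
    also have "\<dots> = faug F' \<bullet> col \<phi>0 c"
      using c by (simp add: scalar_prod_def \<phi>0_def lessThan_atLeast0 mult.commute)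
    finally have "hom_part ?e (faug F $ c - faug F' \<bullet> v c) = faug F $ c - faug F' \<bullet> col \<phi>0 c"
      using homF[OF c] by (simp add: hom_part_diff hom_part_homogeneous)
    moreover have "hom_part ?e (faug F $ c - faug F' \<bullet> v c) \<in> J"
      using J v(2)[OF c] by (simp add: homogeneous_ideal_def)
    ultimately show ?thesis by simp
  qed
  \<comment> \<open>The invariant includes that \<open>A * fdiff F i\<close> has its columns among
    the cycles of \<open>F'\<close>, the condition for the next lift. Index 0 is pinned to
    \<open>\<phi>0\<close> to preserve its augmentation property through the choice.\<close>
  define P where "P i A \<longleftrightarrow> graded_map n F' i F i A \<and> (i = 0 \<longrightarrow> A = \<phi>0) \<and>
    (\<forall>c<frank F (Suc i). col (A * fdiff F i) c \<in> cycles n J F' i)" for i A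
  have base: "P 0 \<phi>0"
    unfolding P_def
  proof (intro conjI allI impI \<phi>0 refl)
    fix c assume c: "c < frank F (Suc 0)"
    let ?w = "col (fdiff F 0) c"
    have w: "?w \<in> free_mod n (frank F 0)" "faug F \<bullet> ?w \<in> J"
      using diff_col_cycle[OF F c] by (simp_all add: cycles_def)
    have fw: "faug F \<bullet> ?w = (\<Sum>b<frank F 0. ?w $ b * faug F $ b)"
      using D(2) by (simp add: scalar_prod_def lessThan_atLeast0 mult.commute)
    have "faug F' \<bullet> (\<phi>0 *\<^sub>v ?w) = (\<Sum>b<frank F 0. ?w $ b * (faug F' \<bullet> col \<phi>0 b))"
      using w(1) augF' by (intro aug_mult[OF graded_matD(1)[OF \<phi>0]]) (auto simp: free_mod_def)
    also have "\<dots> = faug F \<bullet> ?w - (\<Sum>b<frank F 0. ?w $ b * (faug F $ b - faug F' \<bullet> col \<phi>0 b))"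
      unfolding fw by (simp only: right_diff_distrib sum_subtractf diff_diff_eq2 add_diff_cancel_left')
    also have "\<dots> \<in> J"
      using w(1) by (intro ideal_diff[OF id w(2)] ideal_sum[OF id] poly_ring_idealD(4)[OF id] aug0)
        (auto simp: free_mod_def carrier_poly_ring)
    finally show "col (\<phi>0 * fdiff F 0) c \<in> cycles n J F' 0"
      using col_free_mod[OF graded_mat_mult[OF \<phi>0 resolution_diff[OF F]] c]
      by (simp add: cycles_def col_mult2[OF graded_matD(1)[OF \<phi>0] D(1) c])
  qed
  have step: "\<exists>B. P (Suc i) B \<and> fdiff F' i * B = A * fdiff F i" if "P i A" for i A
  proof -
    note D' = graded_matD[OF resolution_diff[OF F', of i]]
    have A: "graded_map n F' i F i A" "\<And>c. c < frank F (Suc i) \<Longrightarrow> col (A * fdiff F i) c \<in> cycles n J F' i"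
      using that by (simp_all add: P_def)
    obtain B where B: "graded_map n F' (Suc i) F (Suc i) B" "fdiff F' i * B = A * fdiff F i"
      using resolution_lift[OF F' graded_mat_mult[OF A(1) resolution_diff[OF F]] A(2)] by blast
    have "fdiff F' i * (B * fdiff F (Suc i)) = (fdiff F' i * B) * fdiff F (Suc i)"
      by (rule assoc_mult_mat [symmetric, OF D'(1) graded_matD(1)[OF B(1)] D(1)])
    also have "\<dots> = A * (fdiff F i * fdiff F (Suc i))"
      unfolding B(2) by (rule assoc_mult_mat[OF graded_matD(1)[OF A(1)] D(1) D(1)])
    also have "\<dots> = 0\<^sub>m (frank F' i) (frank F (Suc (Suc i)))"
      unfolding diff_diff[OF F] using graded_matD[OF A(1)] by simp
    finally have "col (B * fdiff F (Suc i)) c \<in> cycles n J F' (Suc i)" if "c < frank F (Suc (Suc i))" for c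
      by (rule cycles_SucI[OF F' graded_mat_mult[OF B(1) resolution_diff[OF F]] _ that])
    with B show ?thesis by (auto simp: P_def)
  qed
  have "\<exists>\<phi>. \<forall>i. P i (\<phi> i) \<and> fdiff F' i * \<phi> (Suc i) = \<phi> i * fdiff F i"
    by (rule dependent_nat_choice) (use base step in auto)
  then obtain \<phi> where "\<forall>i. P i (\<phi> i) \<and> fdiff F' i * \<phi> (Suc i) = \<phi> i * fdiff F i" ..
  then have cm: "chain_map n F F' \<phi>" and eq: "\<phi> 0 = \<phi>0" by (auto simp: chain_map_def P_def)
  have "lifts_identity J F F' \<phi>" unfolding lifts_identity_def eq using aug0 by blast
  with cm show ?thesis by (rule that)
qed

lemma mat_minus_zero: "A \<in> carrier_mat r s \<Longrightarrow> A - 0\<^sub>m r s = (A :: 'a :: group_add mat)"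
  by (rule eq_matI) auto

lemma mat_diff_add_cancel:
  "A \<in> carrier_mat r s \<Longrightarrow> B \<in> carrier_mat r s \<Longrightarrow> A - B + B = (A :: 'a :: group_add mat)"
  by (rule eq_matI) auto

text \<open>A chain map inducing zero on S/J has its first columns among the cycles, so it starts as
  \<open>fdiff F' 0 * h 0\<close>. Exactness supplies each later correction; the homotopy identity
  is recorded for positive indices.\<close>

lemma exists_homotopy:
  assumes F: "graded_free_resolution n J F" and F': "graded_free_resolution n J F'"
    and \<theta>: "chain_map n F F' \<theta>" and zero: "\<And>c. c < frank F 0 \<Longrightarrow> faug F' \<bullet> col (\<theta> 0) c \<in> J"
  obtains h where "\<forall>i. graded_map n F' (Suc i) F i (h i)"
    "\<forall>i. \<theta> (Suc i) = fdiff F' (Suc i) * h (Suc i) + h i * fdiff F i"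
proof -
  note D = graded_matD(1)[OF resolution_diff[OF F]]
  note D' = graded_matD(1)[OF resolution_diff[OF F']]
  have \<theta>g: "graded_map n F' i F i (\<theta> i)" "fdiff F' i * \<theta> (Suc i) = \<theta> i * fdiff F i" for i
    using \<theta> by (simp_all add: chain_map_def)
  note \<theta>c = graded_matD(1)[OF \<theta>g(1)]
  \<comment> \<open>The second condition says that the error left by \<open>A\<close> consists of
    cycles, hence is \<open>fdiff F' (Suc i)\<close> times the next homotopy matrix.\<close>
  define P where "P i A \<longleftrightarrow> graded_map n F' (Suc i) F i A \<and>
    fdiff F' i * (\<theta> (Suc i) - A * fdiff F i) = 0\<^sub>m (frank F' i) (frank F (Suc i))" for i A
  have "col (\<theta> 0) c \<in> cycles n J F' 0" if "c < frank F 0" for c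
    using zero[OF that] col_free_mod[OF \<theta>g(1) that] by (simp add: cycles_def)
  from resolution_lift[OF F' \<theta>g(1) this] obtain h0
    where h0: "graded_map n F' (Suc 0) F 0 h0" "fdiff F' 0 * h0 = \<theta> 0" by blast
  have kill: "fdiff F' i * (\<theta> (Suc i) - A * fdiff F i) = 0\<^sub>m (frank F' i) (frank F (Suc i))"
    if A: "A \<in> carrier_mat (frank F' (Suc i)) (frank F i)"
      and eq: "fdiff F' i * A * fdiff F i = \<theta> i * fdiff F i" for A i
  proof -
    have "fdiff F' i * (\<theta> (Suc i) - A * fdiff F i) = fdiff F' i * \<theta> (Suc i) - fdiff F' i * (A * fdiff F i)"
      using A D by (intro mult_minus_distrib_mat[OF D' \<theta>c]) auto
    also have "fdiff F' i * (A * fdiff F i) = \<theta> i * fdiff F i"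
      unfolding eq [symmetric] by (rule assoc_mult_mat [symmetric, OF D' A D])
    also have "fdiff F' i * \<theta> (Suc i) - \<theta> i * fdiff F i = 0\<^sub>m (frank F' i) (frank F (Suc i))"
      unfolding \<theta>g(2) by (rule minus_r_inv_mat[OF mult_carrier_mat[OF \<theta>c D]])
    finally show ?thesis .
  qed
  have base: "P 0 h0"
    using h0 kill[OF graded_matD(1)[OF h0(1)]] by (simp add: P_def)
  have step: "\<exists>B. P (Suc i) B \<and> \<theta> (Suc i) = fdiff F' (Suc i) * B + A * fdiff F i" if "P i A" for i A
  proof -
    have A: "graded_map n F' (Suc i) F i A"
      "fdiff F' i * (\<theta> (Suc i) - A * fdiff F i) = 0\<^sub>m (frank F' i) (frank F (Suc i))"
      using that by (simp_all add: P_def)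
    note Ac = graded_matD(1)[OF A(1)]
    have AD: "A * fdiff F i \<in> carrier_mat (frank F' (Suc i)) (frank F (Suc i))"
      using Ac D by (rule mult_carrier_mat)
    let ?R = "\<theta> (Suc i) - A * fdiff F i"
    have R: "graded_map n F' (Suc i) F (Suc i) ?R"
      by (intro graded_mat_diff \<theta>g graded_mat_mult[OF A(1) resolution_diff[OF F]])
    obtain B where B: "graded_map n F' (Suc (Suc i)) F (Suc i) B" "fdiff F' (Suc i) * B = ?R"
      using resolution_lift[OF F' R cycles_SucI[OF F' R A(2)]] by blast
    have "?R * fdiff F (Suc i) = \<theta> (Suc i) * fdiff F (Suc i) - A * fdiff F i * fdiff F (Suc i)"
      by (rule minus_mult_distrib_mat[OF \<theta>c AD D])
    also have "A * fdiff F i * fdiff F (Suc i) = A * (fdiff F i * fdiff F (Suc i))"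
      by (rule assoc_mult_mat[OF Ac D D])
    also have "\<dots> = 0\<^sub>m (frank F' (Suc i)) (frank F (Suc (Suc i)))"
      unfolding diff_diff[OF F] using Ac by simp
    also have "\<theta> (Suc i) * fdiff F (Suc i) - \<dots> = \<theta> (Suc i) * fdiff F (Suc i)"
      by (rule mat_minus_zero[OF mult_carrier_mat[OF \<theta>c D]])
    finally have "P (Suc i) B"
      using kill[OF graded_matD(1)[OF B(1)]] B by (simp add: P_def)
    moreover have "\<theta> (Suc i) = ?R + A * fdiff F i"
      by (rule mat_diff_add_cancel [symmetric, OF \<theta>c AD])
    ultimately show ?thesis using B(2) by auto
  qed
  have "\<exists>h. \<forall>i. P i (h i) \<and> \<theta> (Suc i) = fdiff F' (Suc i) * h (Suc i) + h i * fdiff F i"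
    by (rule dependent_nat_choice) (use base step in auto)
  then obtain h where "\<forall>i. P i (h i) \<and> \<theta> (Suc i) = fdiff F' (Suc i) * h (Suc i) + h i * fdiff F i" ..
  then show ?thesis by (intro that[of h]) (auto simp: P_def)
qed


lemma aug_diff_col:
  assumes u: "u \<in> carrier_vec r" and "A \<in> carrier_mat r s" "B \<in> carrier_mat r s" "c < s"
  shows "u \<bullet> col (A - B) c = u \<bullet> col A c - u \<bullet> col (B :: mpoly mat) c"
  using assms by (simp add: scalar_prod_def right_diff_distrib sum_subtractf)

lemma aug_one_col:
  assumes "u \<in> carrier_vec r" "c < r"
  shows "u \<bullet> col (1\<^sub>m r) c = (u $ c :: mpoly)"
  using assms by (simp add: scalar_prod_right_unit)

lemma aug_mult_col:
  assumes J: "ideal J (poly_ring n)"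
    and \<phi>: "graded_mat n r s \<rho> \<gamma> \<phi>" and \<psi>: "graded_mat n t r \<tau> \<rho> \<psi>"
    and u: "u \<in> carrier_vec t" and v: "v \<in> carrier_vec r"
    and \<psi>u: "\<And>b. b < r \<Longrightarrow> v $ b - u \<bullet> col \<psi> b \<in> J" and c: "c < s"
    and \<phi>v: "p - v \<bullet> col \<phi> c \<in> J"
  shows "p - u \<bullet> col (\<psi> * \<phi>) c \<in> J"
proof -
  have w: "col \<phi> c \<in> free_mod n r" by (rule col_free_mod[OF \<phi> c])
  have "u \<bullet> col (\<psi> * \<phi>) c = (\<Sum>b<r. col \<phi> c $ b * (u \<bullet> col \<psi> b))"
    using aug_mult[OF graded_matD(1)[OF \<psi>] u free_mod_carrier[OF w]]
    by (simp add: col_mult2[OF graded_matD(1)[OF \<psi>] graded_matD(1)[OF \<phi>] c])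
  moreover have "v \<bullet> col \<phi> c = (\<Sum>b<r. col \<phi> c $ b * v $ b)"
    using graded_matD[OF \<phi>] by (simp add: scalar_prod_def lessThan_atLeast0 mult.commute)
  ultimately have eq: "p - u \<bullet> col (\<psi> * \<phi>) c =
      (p - v \<bullet> col \<phi> c) + (\<Sum>b<r. col \<phi> c $ b * (v $ b - u \<bullet> col \<psi> b))"
    by (simp add: right_diff_distrib sum_subtractf)
  have "(\<Sum>b<r. col \<phi> c $ b * (v $ b - u \<bullet> col \<psi> b)) \<in> J"
  proof (rule ideal_sum[OF J])
    fix b assume b: "b \<in> {..<r}"
    then show "col \<phi> c $ b * (v $ b - u \<bullet> col \<psi> b) \<in> J"
      using w by (intro poly_ring_idealD(4)[OF J] \<psi>u) (auto simp: free_mod_def carrier_poly_ring)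
  qed
  with \<phi>v show ?thesis unfolding eq by (rule poly_ring_idealD(3)[OF J])
qed

text \<open>Both composites of lifts of the identity agree with the identity on S/J, so the
  difference \<open>1 - \<psi> \<phi>\<close> falls under \<open>exists_homotopy\<close>.\<close>

lemma self_homotopy:
  assumes J: "homogeneous_ideal n J"
    and F: "graded_free_resolution n J F" and F': "graded_free_resolution n J F'"
    and \<phi>: "chain_map n F F' \<phi>" "lifts_identity J F F' \<phi>"
    and \<psi>: "chain_map n F' F \<psi>" "lifts_identity J F' F \<psi>"
  obtains h where "\<forall>i. graded_map n F (Suc i) F i (h i)"
    "\<forall>i. 1\<^sub>m (frank F (Suc i)) - \<psi> (Suc i) * \<phi> (Suc i) = fdiff F (Suc i) * h (Suc i) + h i * fdiff F i"
proof -
  have id: "ideal J (poly_ring n)" using J by (simp add: homogeneous_ideal_def)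
  let ?\<theta> = "\<lambda>i. 1\<^sub>m (frank F i) - \<psi> i * \<phi> i"
  have g: "graded_map n F' i F i (\<phi> i)" "graded_map n F i F' i (\<psi> i)"
    "fdiff F' i * \<phi> (Suc i) = \<phi> i * fdiff F i" "fdiff F i * \<psi> (Suc i) = \<psi> i * fdiff F' i" for i
    using \<phi>(1) \<psi>(1) by (simp_all add: chain_map_def)
  note c = graded_matD(1)[OF g(1)] graded_matD(1)[OF g(2)]
  note D = graded_matD(1)[OF resolution_diff[OF F]] and D' = graded_matD(1)[OF resolution_diff[OF F']]
  have gp: "graded_map n F i F i (\<psi> i * \<phi> i)" for i by (rule graded_mat_mult[OF g(2,1)])
  have aug: "faug F \<in> carrier_vec (frank F 0)" "faug F' \<in> carrier_vec (frank F' 0)"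
    using F F' by (simp_all add: graded_free_resolution_def free_mod_def)
  have cm: "chain_map n F F ?\<theta>"
    unfolding chain_map_def
  proof (intro allI conjI)
    fix i
    show "graded_map n F i F i (?\<theta> i)" by (intro graded_mat_diff graded_mat_one gp)
    have "fdiff F i * (\<psi> (Suc i) * \<phi> (Suc i)) = fdiff F i * \<psi> (Suc i) * \<phi> (Suc i)"
      by (rule assoc_mult_mat [symmetric, OF D c(2) c(1)])
    also have "\<dots> = \<psi> i * (fdiff F' i * \<phi> (Suc i))"
      unfolding g(4) by (rule assoc_mult_mat[OF c(2) D' c(1)])
    also have "\<dots> = \<psi> i * \<phi> i * fdiff F i"
      unfolding g(3) by (rule assoc_mult_mat [symmetric, OF c(2) c(1) D])
    finally have comm: "fdiff F i * (\<psi> (Suc i) * \<phi> (Suc i)) = \<psi> i * \<phi> i * fdiff F i" .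
    have "fdiff F i * ?\<theta> (Suc i) = fdiff F i * 1\<^sub>m (frank F (Suc i)) - fdiff F i * (\<psi> (Suc i) * \<phi> (Suc i))"
      by (rule mult_minus_distrib_mat[OF D one_carrier_mat graded_matD(1)[OF gp]])
    moreover have "?\<theta> i * fdiff F i = 1\<^sub>m (frank F i) * fdiff F i - \<psi> i * \<phi> i * fdiff F i"
      by (rule minus_mult_distrib_mat[OF one_carrier_mat graded_matD(1)[OF gp] D])
    ultimately show "fdiff F i * ?\<theta> (Suc i) = ?\<theta> i * fdiff F i"
      unfolding comm by (simp only: right_mult_one_mat[OF D] left_mult_one_mat[OF D])
  qed
  have zero: "faug F \<bullet> col (?\<theta> 0) b \<in> J" if b: "b < frank F 0" for b
  proof -
    have "faug F \<bullet> col (?\<theta> 0) b = faug F $ b - faug F \<bullet> col (\<psi> 0 * \<phi> 0) b"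
      unfolding aug_diff_col[OF aug(1) one_carrier_mat graded_matD(1)[OF gp] b] aug_one_col[OF aug(1) b] ..
    moreover have "\<dots> \<in> J"
      using \<phi>(2) \<psi>(2) b
      by (intro aug_mult_col[OF id g(1) g(2) aug(1) aug(2)]) (simp_all add: lifts_identity_def)
    ultimately show ?thesis by simp
  qed
  obtain h where "\<forall>i. graded_map n F (Suc i) F i (h i)"
    "\<forall>i. ?\<theta> (Suc i) = fdiff F (Suc i) * h (Suc i) + h i * fdiff F i"
    by (rule exists_homotopy[OF F F cm zero])
  then show ?thesis by (rule that)
qed


section \<open>Homology of the tensored complexes\<close>

text \<open>The constant term is the value at the origin; expressing it through \<open>line\<close>
  inherits multiplicativity.\<close>

lemma lookup_0_eq_line: "Poly_Mapping.lookup p 0 = coeff (line (\<lambda>_. 0) (\<lambda>_. 0) p) 0"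
proof -
  have "p \<in> polys UNIV" by simp
  then show ?thesis
  proof (induction p rule: polys_induct)
    case (single m c)
    show ?case
    proof (cases "m = 0")
      case False
      then obtain i where "i \<in> Poly_Mapping.keys m" by fastforce
      then have "line_mon (\<lambda>_. 0) (\<lambda>_. 0) m = 0"
        unfolding line_mon_def by (intro prod_zero) (auto simp: in_keys_iff zero_power)
      with False show ?thesis by (simp add: line_single lookup_single_not_eq)
    qed simp
  qed (simp_all add: lookup_add)
qed

lemma lookup_0_mult: "Poly_Mapping.lookup (p * q :: mpoly) 0 = Poly_Mapping.lookup p 0 * Poly_Mapping.lookup q 0"
  by (simp only: lookup_0_eq_line line_mult coeff_mult) simp

interpretation const_term: comm_ring_hom "\<lambda>p :: mpoly. Poly_Mapping.lookup p 0"
  by unfold_locales (simp_all add: lookup_add lookup_0_mult)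

abbreviation const_mat :: "mpoly mat \<Rightarrow> complex mat" where
  "const_mat \<equiv> map_mat (\<lambda>p. Poly_Mapping.lookup p 0)"

lemma const_mat_minus:
  assumes "A \<in> carrier_mat r s" "B \<in> carrier_mat r s"
  shows "const_mat (A - B) = const_mat A - const_mat B"
  by (rule eq_matI) (use assms in \<open>auto simp: lookup_minus\<close>)

lemma const_mat_zero: "const_mat (0\<^sub>m r s) = 0\<^sub>m r s"
  by (rule eq_matI) auto

lemma zero_mat_mult_vec: "v \<in> carrier_vec s \<Longrightarrow> 0\<^sub>m r s *\<^sub>v v = (0\<^sub>v r :: 'a :: semiring_0 vec)"
  by (rule eq_vecI) (auto simp: scalar_prod_def)

lemma mat_mult_zero_vec: "A \<in> carrier_mat r s \<Longrightarrow> A *\<^sub>v 0\<^sub>v s = (0\<^sub>v r :: 'a :: semiring_0 vec)"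
  by (rule eq_vecI) (auto simp: scalar_prod_def)

lemma const_mat_carrier: "graded_mat n r s \<rho> \<gamma> A \<Longrightarrow> const_mat A \<in> carrier_mat r s"
  by (simp add: graded_mat_def)

lemma const_mat_add:
  assumes "A \<in> carrier_mat r s" "B \<in> carrier_mat r s"
  shows "const_mat (A + B) = const_mat A + const_mat B"
  by (rule eq_matI) (use assms in \<open>auto simp: lookup_add\<close>)

lemma homogeneous_lookup_0: "homogeneous e p \<Longrightarrow> e \<noteq> 0 \<Longrightarrow> Poly_Mapping.lookup p 0 = 0"
  using homogeneous_def[of e p] in_keys_iff[of 0 p] by (auto simp: total_degree_def[of 0])

text \<open>An entry between basis vectors of different degrees has nonzero degree and no constant
  term, so tensoring with the residue field splits by internal degree.\<close>

lemma const_mat_strand: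
  assumes A: "graded_map n F' i' F i A" and w: "w \<in> tensor_strand F i j"
  shows "const_mat A *\<^sub>v w \<in> tensor_strand F' i' j"
proof -
  note AD = graded_matD[OF A]
  have w': "dim_vec w = frank F i" "\<And>c. c < frank F i \<Longrightarrow> fdeg F i c \<noteq> j \<Longrightarrow> w $ c = 0"
    using w by (auto simp: tensor_strand_def)
  have "(const_mat A *\<^sub>v w) $ a = 0" if a: "a < frank F' i'" "fdeg F' i' a \<noteq> j" for a
  proof -
    have "Poly_Mapping.lookup (A $$ (a, c)) 0 * w $ c = 0" if c: "c < frank F i" for c
      using w'(2)[OF c] homogeneous_lookup_0[OF AD(5)[OF a(1) c]] a(2) by (cases "fdeg F i c = j") simp_all
    then have "(\<Sum>c = 0..<frank F i. Poly_Mapping.lookup (A $$ (a, c)) 0 * w $ c) = 0"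
      by (intro sum.neutral) simp
    then show ?thesis using a(1) AD(2,3) w'(1) by (simp add: scalar_prod_def)
  qed
  moreover have "const_mat A *\<^sub>v w \<in> carrier_vec (frank F' i')"
    using w by (intro mult_mat_vec_carrier[OF const_mat_carrier[OF A]]) (simp add: tensor_strand_def)
  ultimately show ?thesis by (simp add: tensor_strand_def)
qed

section \<open>Dimensions of subspaces of complex vectors\<close>

lemma (in vectorspace) subspace_fin_dim:
  assumes "fin_dim" and W: "subspace K W V"
  shows "vectorspace.fin_dim K (vs W)"
proof -
  interpret W: vectorspace K "vs W" by (rule subspace_is_vs[OF W])
  have sub: "submodule K W V" using W by (simp add: subspace_def)
  then have WV: "W \<subseteq> carrier V" by (simp add: submodule_def)
  \<comment> \<open>Independence in the subspace is independence in the whole space, so the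
    dimension bounds the size and a maximal independent set exists.\<close>
  have "finite A \<and> card A \<le> dim" if "A \<subseteq> carrier (vs W) \<and> W.lin_indpt A" for A
    using that WV span_li_not_depend(2)[OF _ sub, of A] li_le_dim[OF assms(1), of A] by auto
  moreover have "{} \<subseteq> carrier (vs W) \<and> W.lin_indpt {}" by (auto simp: W.lin_dep_def)
  ultimately obtain A where A: "finite A" "maximal A (\<lambda>S. S \<subseteq> carrier (vs W) \<and> W.lin_indpt S)"
    using maximal_exists[of "\<lambda>S. S \<subseteq> carrier (vs W) \<and> W.lin_indpt S" dim "{}"] by blast
  then have "W.basis A" by (intro W.max_li_is_basis)
  with A(1) show ?thesis by (auto simp: W.fin_dim_def W.basis_def)
qed

definition closed_subspace :: "nat \<Rightarrow> complex vec set \<Rightarrow> bool" where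
  "closed_subspace r W \<longleftrightarrow> W \<subseteq> carrier_vec r \<and> 0\<^sub>v r \<in> W \<and> (\<forall>v\<in>W. \<forall>w\<in>W. v + w \<in> W) \<and>
     (\<forall>a. \<forall>v\<in>W. a \<cdot>\<^sub>v v \<in> W)"

lemma closed_subspace_vs:
  assumes "closed_subspace r W"
  shows "VectorSpace.subspace class_ring W (module_vec TYPE(complex) r)"
    and "vectorspace class_ring (module_vec TYPE(complex) r\<lparr>carrier := W\<rparr>)"
    and "vectorspace.fin_dim class_ring (module_vec TYPE(complex) r\<lparr>carrier := W\<rparr>)"
proof -
  interpret vec_space "TYPE(complex)" r .
  have "submodule class_ring W (module_vec TYPE(complex) r)"
    by unfold_locales (use assms in \<open>auto simp: closed_subspace_def module_vec_simps\<close>)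
  then show *: "VectorSpace.subspace class_ring W (module_vec TYPE(complex) r)"
    using vectorspace_axioms by (simp add: subspace_def)
  show "vectorspace class_ring (module_vec TYPE(complex) r\<lparr>carrier := W\<rparr>)"
    by (rule subspace_is_vs[OF *])
  show "vectorspace.fin_dim class_ring (module_vec TYPE(complex) r\<lparr>carrier := W\<rparr>)"
    by (rule subspace_fin_dim[OF fin_dim *])
qed

lemma subspace_dim_rank_nullity:
  assumes Q: "Q \<in> carrier_mat r' r" and Z: "closed_subspace r Z" and W: "closed_subspace r' W"
    and im: "(\<lambda>z. Q *\<^sub>v z) ` Z = W"
  shows "subspace_dim r' W + subspace_dim r {z \<in> Z. Q *\<^sub>v z = 0\<^sub>v r'} = subspace_dim r Z"
proof -
  let ?V = "module_vec TYPE(complex) r\<lparr>carrier := Z\<rparr>" and ?W = "module_vec TYPE(complex) r'\<lparr>carrier := W\<rparr>"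
  have Zc: "Z \<subseteq> carrier_vec r" using Z by (simp add: closed_subspace_def)
  interpret V: vectorspace class_ring ?V by (rule closed_subspace_vs[OF Z])
  interpret W: vectorspace class_ring ?W by (rule closed_subspace_vs[OF W])
  interpret linear_map class_ring ?V ?W "\<lambda>z. Q *\<^sub>v z"
  proof unfold_locales
    show "(\<lambda>z. Q *\<^sub>v z) \<in> LinearCombinations.module_hom class_ring ?V ?W"
      using im Zc Q
      by (auto simp: LinearCombinations.module_hom_def module_vec_simps mult_add_distrib_mat_vec[OF Q] mult_mat_vec[OF Q] subset_iff)
  qed
  have "im = W" using im by (simp add: im_def)
  moreover have "ker = {z \<in> Z. Q *\<^sub>v z = 0\<^sub>v r'}"
    by (simp add: ker_def module_vec_simps)
  ultimately show ?thesis
    using rank_nullity_main(1)[OF closed_subspace_vs(3)[OF Z]] by (simp add: subspace_dim_def)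
qed

lemma closed_subspace_carrier: "closed_subspace r (carrier_vec r)"
  by (auto simp: closed_subspace_def)

lemma subspace_dim_carrier: "subspace_dim r (carrier_vec r) = r"
proof -
  interpret vec_space "TYPE(complex)" r .
  have eq: "module_vec TYPE(complex) r\<lparr>carrier := carrier_vec r\<rparr> = module_vec TYPE(complex) r"
    by (simp add: module_vec_def)
  show ?thesis unfolding subspace_dim_def eq by (rule dim_is_n)
qed

lemma subspace_dim_zero: "subspace_dim r {0\<^sub>v r} = 0"
proof -
  have "(\<lambda>z. 1\<^sub>m r *\<^sub>v z) ` carrier_vec r = (carrier_vec r :: complex vec set)" by force
  moreover have "{z \<in> carrier_vec r. 1\<^sub>m r *\<^sub>v z = 0\<^sub>v r} = {0\<^sub>v r :: complex vec}" by auto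
  ultimately show ?thesis
    using subspace_dim_rank_nullity[of "1\<^sub>m r" r r "carrier_vec r" "carrier_vec r"]
    by (simp add: closed_subspace_carrier)
qed

lemma closed_subspace_strand: "closed_subspace (frank F i) (tensor_strand F i j)"
  by (auto simp: closed_subspace_def tensor_strand_def)

lemma closed_subspace_cycles:
  assumes "graded_free_resolution n J F"
  shows "closed_subspace (frank F (Suc i)) (tensor_cycles F (Suc i) j)"
proof -
  have D: "tensor_diff F i \<in> carrier_mat (frank F i) (frank F (Suc i))"
    unfolding tensor_diff_def by (rule const_mat_carrier[OF resolution_diff[OF assms]])
  have "tensor_diff F i *\<^sub>v 0\<^sub>v (frank F (Suc i)) = 0\<^sub>v (frank F i)"
    using D by (rule mat_mult_zero_vec)
  then show ?thesis
    unfolding closed_subspace_def tensor_cycles_def nat.case mat_kernel[OF D]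
    using closed_subspace_strand[of F "Suc i" j]
    by (auto simp: closed_subspace_def mult_add_distrib_mat_vec[OF D] mult_mat_vec[OF D] subset_iff
        mult_mat_vec_carrier[OF D])
qed

text \<open>Tensored with \<open>\<complex>\<close>, the chain maps between \<open>F\<close> and a minimal resolution \<open>G\<close> satisfy \<open>Q P = 1\<close> and
  \<open>1 - P Q = D H + H' D'\<close>, so \<open>Q\<close> maps the cycles of \<open>F\<close> onto \<open>G \<otimes> \<complex>\<close> with the boundaries as kernel.\<close>

lemma tensor_homology_dim_minimal:
  assumes J: "homogeneous_ideal n J"
    and F: "graded_free_resolution n J F" and G: "graded_free_resolution n J G"
    and minimal: "\<And>i. tensor_diff G i = 0\<^sub>m (frank G i) (frank G (Suc i))"
  shows "tensor_homology_dim F (Suc i) j = subspace_dim (frank G (Suc i)) (tensor_strand G (Suc i) j)"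
proof -
  obtain \<phi> where \<phi>: "chain_map n F G \<phi>" "lifts_identity J F G \<phi>"
    by (rule exists_chain_map[OF J F G])
  obtain \<psi> where \<psi>: "chain_map n G F \<psi>" "lifts_identity J G F \<psi>"
    by (rule exists_chain_map[OF J G F])
  obtain h where h_all: "\<forall>i. graded_map n F (Suc i) F i (h i)"
    "\<forall>i. 1\<^sub>m (frank F (Suc i)) - \<psi> (Suc i) * \<phi> (Suc i) = fdiff F (Suc i) * h (Suc i) + h i * fdiff F i"
    by (rule self_homotopy[OF J F G \<phi> \<psi>])
  obtain h' where h'_all: "\<forall>i. graded_map n G (Suc i) G i (h' i)"
    "\<forall>i. 1\<^sub>m (frank G (Suc i)) - \<phi> (Suc i) * \<psi> (Suc i) = fdiff G (Suc i) * h' (Suc i) + h' i * fdiff G i"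
    by (rule self_homotopy[OF J G F \<psi> \<phi>])
  note h = h_all [rule_format] and h' = h'_all [rule_format]
  have g: "graded_map n G i F i (\<phi> i)" "graded_map n F i G i (\<psi> i)"
    "fdiff G i * \<phi> (Suc i) = \<phi> i * fdiff F i" "fdiff F i * \<psi> (Suc i) = \<psi> i * fdiff G i" for i
    using \<phi>(1) \<psi>(1) by (simp_all add: chain_map_def)
  note gD = resolution_diff[OF F] and gE = resolution_diff[OF G]
  note hom_mult = const_term.mat_hom_mult[OF graded_matD(1) graded_matD(1)]
  note carr = const_mat_carrier[OF g(1)] const_mat_carrier[OF g(2)] const_mat_carrier[OF h(1)]
    const_mat_carrier[OF gD]
  let ?f = "frank F (Suc i)" and ?g = "frank G (Suc i)"
  let ?P = "const_mat (\<psi> (Suc i))" and ?Q = "const_mat (\<phi> (Suc i))"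
  let ?D = "const_mat (fdiff F (Suc i))" and ?D' = "const_mat (fdiff F i)"
  let ?H = "const_mat (h (Suc i))" and ?H' = "const_mat (h i)"
  have E: "const_mat (fdiff G l) = 0\<^sub>m (frank G l) (frank G (Suc l))" for l
    using minimal by (simp add: tensor_diff_def)
  have "const_mat (1\<^sub>m ?f - \<psi> (Suc i) * \<phi> (Suc i)) = const_mat (fdiff F (Suc i) * h (Suc i) + h i * fdiff F i)"
    by (simp only: h(2))
  then have homF: "1\<^sub>m ?f - ?P * ?Q = ?D * ?H + ?H' * ?D'"
    by (simp only: const_mat_minus[OF one_carrier_mat graded_matD(1)[OF graded_mat_mult[OF g(2) g(1)]]]
        const_mat_add[OF graded_matD(1)[OF graded_mat_mult[OF gD h(1)]] graded_matD(1)[OF graded_mat_mult[OF h(1) gD]]]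
        const_term.mat_hom_one hom_mult[OF g(2) g(1)] hom_mult[OF gD h(1)] hom_mult[OF h(1) gD])
  have "const_mat (1\<^sub>m ?g - \<phi> (Suc i) * \<psi> (Suc i)) = const_mat (fdiff G (Suc i) * h' (Suc i) + h' i * fdiff G i)"
    by (simp only: h'(2))
  then have homG: "1\<^sub>m ?g - ?Q * ?P = 0\<^sub>m ?g (frank G (Suc (Suc i))) * const_mat (h' (Suc i)) +
      const_mat (h' i) * 0\<^sub>m (frank G i) ?g"
    by (simp only: const_mat_minus[OF one_carrier_mat graded_matD(1)[OF graded_mat_mult[OF g(1) g(2)]]]
        const_mat_add[OF graded_matD(1)[OF graded_mat_mult[OF gE h'(1)]] graded_matD(1)[OF graded_mat_mult[OF h'(1) gE]]]
        const_term.mat_hom_one hom_mult[OF g(1) g(2)] hom_mult[OF gE h'(1)] hom_mult[OF h'(1) gE] E)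
  have QPc: "?Q * ?P \<in> carrier_mat ?g ?g" by (rule mult_carrier_mat[OF carr(1) carr(2)])
  have "1\<^sub>m ?g - ?Q * ?P = 0\<^sub>m ?g ?g"
    unfolding homG left_mult_zero_mat[OF const_mat_carrier[OF h'(1)]]
      right_mult_zero_mat[OF const_mat_carrier[OF h'(1)]] by simp
  \<comment> \<open>Minimality has killed the homotopy terms on the side of \<open>G\<close>, so the
    composite is the identity itself and not only homotopic to it.\<close>
  then have QP: "?Q * ?P = 1\<^sub>m ?g"
    using mat_diff_add_cancel[OF one_carrier_mat QPc] left_add_zero_mat[OF QPc] by simp
  have QD: "?Q * ?D = 0\<^sub>m ?g (frank F (Suc (Suc i)))"
    using arg_cong[OF g(3)[of "Suc i"], of const_mat]
    unfolding hom_mult[OF gE g(1)] hom_mult[OF g(1) gD] E left_mult_zero_mat[OF carr(1)] by (rule sym)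
  have DP: "?D' * ?P = 0\<^sub>m (frank F i) ?g"
    using arg_cong[OF g(4)[of i], of const_mat]
    unfolding hom_mult[OF gD g(2)] hom_mult[OF g(2) gE] E right_mult_zero_mat[OF carr(2)] .
  have DD: "?D' * ?D = 0\<^sub>m (frank F i) (frank F (Suc (Suc i)))"
    using arg_cong[OF diff_diff[OF F, of i], of const_mat]
    unfolding hom_mult[OF gD gD] by (simp add: const_mat_zero)
  let ?Z = "tensor_cycles F (Suc i) j" and ?B = "tensor_boundaries F (Suc i) j"
  let ?W = "tensor_strand G (Suc i) j"
  have Z: "z \<in> ?Z \<longleftrightarrow> z \<in> tensor_strand F (Suc i) j \<and> ?D' *\<^sub>v z = 0\<^sub>v (frank F i)" for z
    using mat_kernel[OF carr(4)[of i]] by (auto simp: tensor_cycles_def tensor_diff_def tensor_strand_def)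
  have B: "?B = (\<lambda>w. ?D *\<^sub>v w) ` tensor_strand F (Suc (Suc i)) j"
    by (simp add: tensor_boundaries_def tensor_diff_def)
  have strand: "tensor_strand X l j \<subseteq> carrier_vec (frank X l)" for X l
    by (auto simp: tensor_strand_def)
  have im: "(\<lambda>z. ?Q *\<^sub>v z) ` ?Z = ?W"
  proof (intro subset_antisym subsetI)
    fix w assume "w \<in> (\<lambda>z. ?Q *\<^sub>v z) ` ?Z"
    then show "w \<in> ?W" using const_mat_strand[OF g(1)] Z by auto
  next
    fix w assume w: "w \<in> ?W"
    then have wc: "w \<in> carrier_vec ?g" using strand by blast
    have "?D' *\<^sub>v (?P *\<^sub>v w) = 0\<^sub>v (frank F i)"
      unfolding assoc_mult_mat_vec [symmetric, OF carr(4) carr(2) wc] DP using wc by (rule zero_mat_mult_vec)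
    then have "?P *\<^sub>v w \<in> ?Z" using Z const_mat_strand[OF g(2) w] by simp
    moreover have "w = ?Q *\<^sub>v (?P *\<^sub>v w)"
      unfolding assoc_mult_mat_vec [symmetric, OF carr(1) carr(2) wc] QP using wc by simp
    ultimately show "w \<in> (\<lambda>z. ?Q *\<^sub>v z) ` ?Z" by (rule rev_image_eqI[where f = "\<lambda>z. ?Q *\<^sub>v z"])
  qed
  have ker: "{z \<in> ?Z. ?Q *\<^sub>v z = 0\<^sub>v ?g} = ?B"
  proof (intro subset_antisym subsetI)
    fix z assume "z \<in> {z \<in> ?Z. ?Q *\<^sub>v z = 0\<^sub>v ?g}"
    then have z: "z \<in> tensor_strand F (Suc i) j" "?D' *\<^sub>v z = 0\<^sub>v (frank F i)" "?Q *\<^sub>v z = 0\<^sub>v ?g"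
      using Z by auto
    then have zc: "z \<in> carrier_vec ?f" using strand by blast
    \<comment> \<open>For a cycle in the kernel of \<open>?Q\<close>, the second term vanishes and
      the homotopy identity reduces the first to a boundary.\<close>
    have "z = (1\<^sub>m ?f - ?P * ?Q) *\<^sub>v z + ?P *\<^sub>v (?Q *\<^sub>v z)"
      using mult_carrier_mat[OF carr(2) carr(1), of "Suc i"] zc carr
      by (subst minus_mult_distrib_mat_vec[OF one_carrier_mat mult_carrier_mat[OF carr(2) carr(1)] zc])
        (subst assoc_mult_mat_vec[OF carr(2) carr(1) zc], auto intro!: eq_vecI)
    also have "?P *\<^sub>v (?Q *\<^sub>v z) = 0\<^sub>v ?f"
      unfolding z(3) using carr(2) by (rule mat_mult_zero_vec)
    also have "(1\<^sub>m ?f - ?P * ?Q) *\<^sub>v z = ?D *\<^sub>v (?H *\<^sub>v z) + ?H' *\<^sub>v (?D' *\<^sub>v z)"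
      unfolding homF
        add_mult_distrib_mat_vec[OF mult_carrier_mat[OF carr(4) carr(3)] mult_carrier_mat[OF carr(3) carr(4)] zc]
        assoc_mult_mat_vec[OF carr(4) carr(3) zc] assoc_mult_mat_vec[OF carr(3) carr(4) zc] ..
    also have "?H' *\<^sub>v (?D' *\<^sub>v z) = 0\<^sub>v ?f"
      unfolding z(2) using carr(3) by (rule mat_mult_zero_vec)
    finally have "z = ?D *\<^sub>v (?H *\<^sub>v z)"
      using mult_mat_vec_carrier[OF carr(4) mult_mat_vec_carrier[OF carr(3) zc]] by simp
    with const_mat_strand[OF h(1) z(1)] show "z \<in> ?B" unfolding B by (rule rev_image_eqI)
  next
    fix z assume "z \<in> ?B"
    then obtain w where w: "w \<in> tensor_strand F (Suc (Suc i)) j" "z = ?D *\<^sub>v w" unfolding B by blast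
    then have wc: "w \<in> carrier_vec (frank F (Suc (Suc i)))" using strand by blast
    have "?D' *\<^sub>v z = 0\<^sub>v (frank F i)"
      unfolding w(2) assoc_mult_mat_vec [symmetric, OF carr(4) carr(4) wc] DD using wc by (rule zero_mat_mult_vec)
    moreover have "?Q *\<^sub>v z = 0\<^sub>v ?g"
      unfolding w(2) assoc_mult_mat_vec [symmetric, OF carr(1) carr(4) wc] QD using wc by (rule zero_mat_mult_vec)
    ultimately show "z \<in> {z \<in> ?Z. ?Q *\<^sub>v z = 0\<^sub>v ?g}"
      using Z const_mat_strand[OF gD w(1)] w(2) by simp
  qed
  have "subspace_dim ?g ?W + subspace_dim ?f ?B = subspace_dim ?f ?Z"
    using subspace_dim_rank_nullity[OF carr(1) closed_subspace_cycles[OF F] closed_subspace_strand im]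
    unfolding ker .
  then show ?thesis by (simp add: tensor_homology_dim_def)
qed

text \<open>With one degree \<open>e i\<close> per homological degree and these strictly increasing,
  entries of the differentials have positive degree and no constant term. The resolution
  \<open>G\<close> also shows that the choice in \<open>graded_betti\<close> yields a
  resolution.\<close>

lemma graded_betti_minimal:
  assumes J: "homogeneous_ideal n J" and G: "graded_free_resolution n J G"
    and deg: "\<And>i c. c < frank G i \<Longrightarrow> fdeg G i c = e i" and "\<And>i. e i < e (Suc i)"
  shows "graded_betti n J (Suc i) j = (if j = e (Suc i) then frank G (Suc i) else 0)"
proof -
  have "tensor_diff G i = 0\<^sub>m (frank G i) (frank G (Suc i))" for i
  proof (rule eq_matI)
    note D = graded_matD[OF resolution_diff[OF G, of i]]
    show "tensor_diff G i $$ (a, c) = 0\<^sub>m (frank G i) (frank G (Suc i)) $$ (a, c)"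
      if "a < dim_row (0\<^sub>m (frank G i) (frank G (Suc i)) :: complex mat)"
        "c < dim_col (0\<^sub>m (frank G i) (frank G (Suc i)) :: complex mat)" for a c
      using that D(1) homogeneous_lookup_0[OF D(5)[of a c]] deg[of a i] deg[of c "Suc i"] assms(4)[of i]
      by (simp add: tensor_diff_def)
    show "dim_row (tensor_diff G i) = dim_row (0\<^sub>m (frank G i) (frank G (Suc i)) :: complex mat)"
      "dim_col (tensor_diff G i) = dim_col (0\<^sub>m (frank G i) (frank G (Suc i)) :: complex mat)"
      using D(1) by (simp_all add: tensor_diff_def)
  qed
  moreover have "graded_free_resolution n J (SOME F. graded_free_resolution n J F)"
    using G by (rule someI)
  ultimately have "graded_betti n J (Suc i) j = subspace_dim (frank G (Suc i)) (tensor_strand G (Suc i) j)"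
    unfolding graded_betti_def by (intro tensor_homology_dim_minimal[OF J _ G])
  moreover have "tensor_strand G (Suc i) j =
      (if j = e (Suc i) then carrier_vec (frank G (Suc i)) else {0\<^sub>v (frank G (Suc i))})"
    by (auto simp: tensor_strand_def deg)
  ultimately show ?thesis by (simp add: subspace_dim_carrier subspace_dim_zero)
qed


theorem theorem1p4:
  fixes n k d :: nat and \<xi> :: complex
  assumes "n > 0" and "k > 0" and "d > 0"
    and "primitive_root_of_unity k \<xi>"
  defines "I \<equiv> fat_points_ideal n d (root_points n k \<xi>)"
    and "G \<equiv> (\<lambda>a :: nat \<Rightarrow> nat. \<Prod>j\<in>{1..n}. (Var j ^ k - Var 0 ^ k) ^ a j)"
  shows "(\<forall>i\<in>{1..n}. graded_betti n I i (int (k * d + k * (i - 1))) =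
            ((d + i - 2) choose (i - 1)) * ((d + n - 1) choose (n - i))) \<and>
         (\<forall>i\<ge>1. \<forall>j :: int. \<not> (i \<le> n \<and> j = int (k * d + k * (i - 1))) \<longrightarrow>
            graded_betti n I i j = 0) \<and>
         (\<forall>a. (\<Sum>j\<in>{1..n}. a j) = d \<longrightarrow> homogeneous (int (k * d)) (G a)) \<and>
         I = Idl\<^bsub>poly_ring n\<^esub> {G a | a. (\<Sum>j\<in>{1..n}. a j) = d}"
proof -
  note \<xi> = assms(4)
  have G: "G a = (\<Prod>j\<in>{1..n}. binom k j ^ a j)" for a
    by (simp add: G_def binom_def)
  have I: "I = pow_ideal n k n d" and I_gen: "I = Idl\<^bsub>poly_ring n\<^esub> {G a | a. (\<Sum>j\<in>{1..n}. a j) = d}"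
    using fat_points_ideal_eq[OF \<xi>] by (simp_all add: I_def G)
  have I_vanishing: "I = vanishing n k n d"
    unfolding I by (rule pow_ideal_eq_vanishing[OF \<xi> order_refl])
  have "ideal I (poly_ring n)"
    unfolding I_vanishing by (rule poly_ring_idealI) (auto simp: vanishing_polys)
  then have hI: "homogeneous_ideal n I"
    by (simp add: homogeneous_ideal_def I hom_part_pow_ideal)
  have rank_0: "res_rank n d i = 0" if "n \<le> i" for i
    using that \<open>n > 0\<close> by (simp add: res_rank_eq binomial_eq_0)
  obtain R where R: "graded_free_resolution n I R" "frank R 0 = 1" "\<And>i. frank R (Suc i) = res_rank n d i"
    "\<And>c. fdeg R 0 c = 0" "\<And>i c. fdeg R (Suc i) c = int (k * d) + int k * int i"
  proof (rule lin_res_imp_graded_free_resolution)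
    show "lin_res n (int k) n (const_vecs I) (int (k * d)) (res_rank n d)"
      unfolding I using \<open>d > 0\<close> by (intro lin_res_pow_ideal[OF \<xi>]) simp_all
    show "I \<subseteq> polys {0..n}" unfolding I_vanishing by (auto simp: vanishing_polys)
  qed (use rank_0 in simp_all)
  define e where "e i = (case i of 0 \<Rightarrow> 0 | Suc i \<Rightarrow> int (k * d) + int k * int i)" for i
  have "fdeg R i c = e i" for i c
    using R(4,5) by (cases i) (simp_all add: e_def)
  \<comment> \<open>The first step is \<open>k * d\<close>, positive because \<open>d > 0\<close>;
    the later ones are \<open>k\<close>.\<close>
  moreover have "e i < e (Suc i)" for i
    using \<open>k > 0\<close> \<open>d > 0\<close> by (cases i) (simp_all add: e_def distrib_left)
  ultimately have betti: "graded_betti n I (Suc i) j = (if j = e (Suc i) then res_rank n d i else 0)" for i j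
    using graded_betti_minimal[OF hI R(1)] R(3) by simp
  have e: "e (Suc i) = int (k * d + k * i)" for i by (simp add: e_def)
  show ?thesis
  proof (intro conjI ballI allI impI)
    fix i assume "i \<in> {1..n}"
    then obtain i' where i: "i = Suc i'" "i' < n" by (cases i) auto
    \<comment> \<open>The lower indices \<open>d + i'\<close> and \<open>n - i\<close> add up to
      \<open>d + n - 1\<close>.\<close>
    have "(d + n - 1) choose (d + i') = (d + n - 1) choose (n - i)"
      using binomial_symmetric[of "d + i'" "d + n - 1"] i by simp
    then show "graded_betti n I i (int (k * d + k * (i - 1))) =
        ((d + i - 2) choose (i - 1)) * ((d + n - 1) choose (n - i))"
      by (simp add: i(1) betti e res_rank_eq)
  next
    fix i j assume i: "1 \<le> i" "\<not> (i \<le> n \<and> j = int (k * d + k * (i - 1)))"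
    then obtain i' where i': "i = Suc i'" by (cases i) auto
    \<comment> \<open>Either the internal degree is wrong, or \<open>i > n\<close> and the rank
      itself vanishes.\<close>
    show "graded_betti n I i j = 0"
      using i(2) rank_0[of i'] by (auto simp: i' betti e)
  next
    fix a :: "nat \<Rightarrow> nat" assume "(\<Sum>j\<in>{1..n}. a j) = d"
    then have "int (k * d) = int (\<Sum>j\<in>{1..n}. a j) * int k" by simp
    also have "\<dots> = (\<Sum>j\<in>{1..n}. int (a j) * int k)"
      by (simp only: of_nat_sum sum_distrib_right)
    finally show "homogeneous (int (k * d)) (G a)"
      unfolding G by (simp only:) (intro homogeneous_prod homogeneous_power homogeneous_binom)
  qed (rule I_gen)
qed

end
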